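(* Let $E$ be a finite directed graph with no loops (or cycles), and let $(E,\mathcal{L},\mathcal{B})$ be a normal, weakly left-resolving labeled space with $E^0_{sink}\in\mathcal{B}$. For each $x\in E^0_{sink}$ let $A_x=\bigcap_{A\in\mathcal{B},\,x\in A}A$, and let $\mathcal{V}=\{A_x:x\in E^0_{sink}\}$. Then $$C^*(E,\mathcal{L},\mathcal{B})\cong\bigoplus_{V\in\mathcal{V}}M_{n_V+1}(\mathbb{C}),$$ where $n_V$ is the number of words $\alpha\in\mathcal{L}^*(E)$ with $V\subseteq r(\alpha)$.
   Context: A directed graph $E=(E^0,E^1,s,r)$ consists of sets $E^0$ (vertices) and $E^1$ (edges) and maps $s,r:E^1\to E^0$ (source and range); it is finite if $E^0$ and $E^1$ are finite. A sink is a vertex that is not the source of any edge, and $E^0_{sink}$ is the set of sinks. $E^n$ is the set of paths $e_1\cdots e_n$ of length $n$ (so $r(e_i)=s(e_{i+1})$), with $s(e_1\cdots e_n)=s(e_1)$ and $r(e_1\cdots e_n)=r(e_n)$. "No loops (or cycles)" means there is no path $p$ of length $\ge1$ with $s(p)=r(p)$. A labeling is a function $\mathcal{L}:E^1\to\mathcal{A}$ into an alphabet $\mathcal{A}$, assumed onto; it extends to paths by $\mathcal{L}(e_1\cdots e_n)=\mathcal{L}(e_1)\cdots\mathcal{L}(e_n)$. Put $\mathcal{L}^*(E)=\bigcup_{n\ge1}\mathcal{L}(E^n)$ (so the empty word is not included). For $\alpha\in\mathcal{L}(E^n)$, $r(\alpha)=\{r(p):p\in E^n,\mathcal{L}(p)=\alpha\}\subseteq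 E^0$; for $A\subseteq E^0$, $r(A,\alpha)=\{r(p):\mathcal{L}(p)=\alpha,\ s(p)\in A\}$ and $\mathcal{L}(AE^1)=\{\mathcal{L}(e):e\in E^1,\ s(e)\in A\}$. A non-empty $\mathcal{B}\subseteq 2^{E^0}$ (assumed $\neq\{\emptyset\}$) is accommodating if $r(\alpha)\in\mathcal{B}$ for all $\alpha\in\mathcal{L}^*(E)$, $r(A,\alpha)\in\mathcal{B}$ for all $A\in\mathcal{B}$, $\alpha\in\mathcal{L}^*(E)$, and $\mathcal{B}$ is closed under finite intersections and unions. Then $(E,\mathcal{L},\mathcal{B})$ is called a labeled space. It is weakly left-resolving if $r(A\cap B,\alpha)=r(A,\alpha)\cap r(B,\alpha)$ for all $A,B\in\mathcal{B}$, $\alpha\in\mathcal{L}^*(E)$. It is normal if it is accommodating and $\mathcal{B}$ is closed under relative complements. A representation of a weakly left-resolving labeled space $(E,\mathcal{L},\mathcal{B})$ in a $C^*$-algebra consists of projections $\{p_A:A\in\mathcal{B}\}$ and partial isometries $\{s_a:a\in\mathcal{A}\}$ such that: (1) $p_Ap_B=p_{A\cap B}$ and $p_{A\cup B}=p_A+p_B-p_{A\cap B}$ for $A,B\in\mathcal{B}$; (2) $s_a^*s_b=\delta_{a,b}\,p_{r(a)}$ for $a,b\in\mathcal{A}$; (3) $s_a^*p_A=p_{r(A,a)}s_a^*$ for $a\in\mathcal{A}$, $A\in\mathcal{B}$; (4) for $A\in\mathcal{B}$ with $\mathcal{L}(AE^1)$ finite and $A$ containing no sink, $p_A=\sum_{a\in\mathcal{L}(AE^1)}s_ap_{r(A,a)}s_a^*$.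 The labeled graph $C^*$-algebra $C^*(E,\mathcal{L},\mathcal{B})$ is the $C^*$-algebra generated by a universal representation. *)

theory Defs
  imports
    "Graph_Theory.Arc_Walk"
    "Jordan_Normal_Form.Schur_Decomposition"
    "Jordan_Normal_Form.VS_Connect"
begin

section \<open>Labeled spaces\<close>

text \<open>
  A labeled graph is a digraph \<open>E\<close> together with \<open>L :: 'e \<Rightarrow> 'l\<close>, of which only the values on
  \<open>arcs E\<close> matter. Since labelings are assumed to be onto, the alphabet is the image of \<open>L\<close>.
  Words over the alphabet are lists.
\<close>

definition alphabet :: "('v, 'e) pre_digraph \<Rightarrow> ('e \<Rightarrow> 'l) \<Rightarrow> 'l set" where
  "alphabet E L = L ` arcs E"

definition sinks :: "('v, 'e) pre_digraph \<Rightarrow> 'v set" where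
  "sinks E = {v \<in> verts E. \<not> (\<exists>e \<in> arcs E. tail E e = v)}"

definition labeled_words :: "('v, 'e) pre_digraph \<Rightarrow> ('e \<Rightarrow> 'l) \<Rightarrow> 'l list set" where
  "labeled_words E L = {map L p | u p v. pre_digraph.awalk E u p v \<and> p \<noteq> []}"

definition word_range :: "('v, 'e) pre_digraph \<Rightarrow> ('e \<Rightarrow> 'l) \<Rightarrow> 'l list \<Rightarrow> 'v set" where
  "word_range E L \<alpha> = {v. \<exists>u p. pre_digraph.awalk E u p v \<and> map L p = \<alpha>}"

definition rel_range :: "('v, 'e) pre_digraph \<Rightarrow> ('e \<Rightarrow> 'l) \<Rightarrow> 'v set \<Rightarrow> 'l list \<Rightarrow> 'v set" where
  "rel_range E L X \<alpha> = {v. \<exists>u \<in> X. \<exists>p. pre_digraph.awalk E u p v \<and> map L p = \<alpha>}"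

definition out_labels :: "('v, 'e) pre_digraph \<Rightarrow> ('e \<Rightarrow> 'l) \<Rightarrow> 'v set \<Rightarrow> 'l set" where
  "out_labels E L X = L ` {e \<in> arcs E. tail E e \<in> X}"

definition accommodating ::
  "('v, 'e) pre_digraph \<Rightarrow> ('e \<Rightarrow> 'l) \<Rightarrow> 'v set set \<Rightarrow> bool" where
  "accommodating E L B \<longleftrightarrow>
     B \<subseteq> Pow (verts E) \<and> B \<noteq> {} \<and> B \<noteq> {{}} \<and>
     (\<forall>\<alpha> \<in> labeled_words E L. word_range E L \<alpha> \<in> B) \<and>
     (\<forall>X \<in> B. \<forall>\<alpha> \<in> labeled_words E L. rel_range E L X \<alpha> \<in> B) \<and>
     (\<forall>X \<in> B. \<forall>Y \<in> B. X \<inter> Y \<in> B \<and> X \<union> Y \<in> B)"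

definition weakly_left_resolving ::
  "('v, 'e) pre_digraph \<Rightarrow> ('e \<Rightarrow> 'l) \<Rightarrow> 'v set set \<Rightarrow> bool" where
  "weakly_left_resolving E L B \<longleftrightarrow>
     (\<forall>X \<in> B. \<forall>Y \<in> B. \<forall>\<alpha> \<in> labeled_words E L.
        rel_range E L (X \<inter> Y) \<alpha> = rel_range E L X \<alpha> \<inter> rel_range E L Y \<alpha>)"

definition normal_labeled_space ::
  "('v, 'e) pre_digraph \<Rightarrow> ('e \<Rightarrow> 'l) \<Rightarrow> 'v set set \<Rightarrow> bool" where
  "normal_labeled_space E L B \<longleftrightarrow>
     accommodating E L B \<and> (\<forall>X \<in> B. \<forall>Y \<in> B. X - Y \<in> B)"


section \<open>C*-algebras\<close>

text \<open>
  Universal properties quantify over all C*-algebras, so these are structures with an explicit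
  carrier. The field \<open>one\<close> of the underlying ring record plays no role: C*-algebras need not
  be unital, and no axiom or morphism below refers to it.
\<close>

record 'a cstar = "(complex, 'a) module" +
  cadjoint :: "'a \<Rightarrow> 'a"
  cnorm :: "'a \<Rightarrow> real"

definition cstar_limit :: "'a cstar \<Rightarrow> (nat \<Rightarrow> 'a) \<Rightarrow> 'a \<Rightarrow> bool" where
  "cstar_limit A f x \<longleftrightarrow> (\<lambda>n. cnorm A (f n \<ominus>\<^bsub>A\<^esub> x)) \<longlonglongrightarrow> 0"

definition cstar_Cauchy :: "'a cstar \<Rightarrow> (nat \<Rightarrow> 'a) \<Rightarrow> bool" where
  "cstar_Cauchy A f \<longleftrightarrow>
     (\<forall>e>0. \<exists>N. \<forall>m\<ge>N. \<forall>n\<ge>N. cnorm A (f m \<ominus>\<^bsub>A\<^esub> f n) < e)"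

locale cstar_algebra = module class_ring A for A :: "'a cstar" (structure) +
  assumes mult_closed: "\<lbrakk>x \<in> carrier A; y \<in> carrier A\<rbrakk> \<Longrightarrow> x \<otimes> y \<in> carrier A"
    and mult_assoc: "\<lbrakk>x \<in> carrier A; y \<in> carrier A; z \<in> carrier A\<rbrakk> \<Longrightarrow>
          (x \<otimes> y) \<otimes> z = x \<otimes> (y \<otimes> z)"
    and mult_distrib_right: "\<lbrakk>x \<in> carrier A; y \<in> carrier A; z \<in> carrier A\<rbrakk> \<Longrightarrow>
          (x \<oplus> y) \<otimes> z = x \<otimes> z \<oplus> y \<otimes> z"
    and mult_distrib_left: "\<lbrakk>x \<in> carrier A; y \<in> carrier A; z \<in> carrier A\<rbrakk> \<Longrightarrow>
          x \<otimes> (y \<oplus> z) = x \<otimes> y \<oplus> x \<otimes> z"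
    and smult_mult_left: "\<lbrakk>x \<in> carrier A; y \<in> carrier A\<rbrakk> \<Longrightarrow>
          (c \<odot> x) \<otimes> y = c \<odot> (x \<otimes> y)"
    and smult_mult_right: "\<lbrakk>x \<in> carrier A; y \<in> carrier A\<rbrakk> \<Longrightarrow>
          x \<otimes> (c \<odot> y) = c \<odot> (x \<otimes> y)"
    and adjoint_closed: "x \<in> carrier A \<Longrightarrow> cadjoint A x \<in> carrier A"
    and adjoint_adjoint: "x \<in> carrier A \<Longrightarrow> cadjoint A (cadjoint A x) = x"
    and adjoint_add: "\<lbrakk>x \<in> carrier A; y \<in> carrier A\<rbrakk> \<Longrightarrow>
          cadjoint A (x \<oplus> y) = cadjoint A x \<oplus> cadjoint A y"
    and adjoint_smult: "x \<in> carrier A \<Longrightarrow> cadjoint A (c \<odot> x) = cnj c \<odot> cadjoint A x"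
    and adjoint_mult: "\<lbrakk>x \<in> carrier A; y \<in> carrier A\<rbrakk> \<Longrightarrow>
          cadjoint A (x \<otimes> y) = cadjoint A y \<otimes> cadjoint A x"
    and cnorm_nonneg: "x \<in> carrier A \<Longrightarrow> 0 \<le> cnorm A x"
    and cnorm_eq_0: "x \<in> carrier A \<Longrightarrow> cnorm A x = 0 \<longleftrightarrow> x = \<zero>"
    and cnorm_triangle: "\<lbrakk>x \<in> carrier A; y \<in> carrier A\<rbrakk> \<Longrightarrow>
          cnorm A (x \<oplus> y) \<le> cnorm A x + cnorm A y"
    and cnorm_smult: "x \<in> carrier A \<Longrightarrow> cnorm A (c \<odot> x) = cmod c * cnorm A x"
    and cnorm_mult: "\<lbrakk>x \<in> carrier A; y \<in> carrier A\<rbrakk> \<Longrightarrow>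
          cnorm A (x \<otimes> y) \<le> cnorm A x * cnorm A y"
    and cstar_identity: "x \<in> carrier A \<Longrightarrow> cnorm A (cadjoint A x \<otimes> x) = (cnorm A x)\<^sup>2"
    and complete: "\<lbrakk>range f \<subseteq> carrier A; cstar_Cauchy A f\<rbrakk> \<Longrightarrow>
          \<exists>x \<in> carrier A. cstar_limit A f x"

definition projection :: "'a cstar \<Rightarrow> 'a \<Rightarrow> bool" where
  "projection A x \<longleftrightarrow> x \<in> carrier A \<and> x \<otimes>\<^bsub>A\<^esub> x = x \<and> cadjoint A x = x"

definition partial_isometry :: "'a cstar \<Rightarrow> 'a \<Rightarrow> bool" where
  "partial_isometry A x \<longleftrightarrow> x \<in> carrier A \<and> x \<otimes>\<^bsub>A\<^esub> cadjoint A x \<otimes>\<^bsub>A\<^esub> x = x"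

definition cstar_hom :: "'a cstar \<Rightarrow> 'b cstar \<Rightarrow> ('a \<Rightarrow> 'b) \<Rightarrow> bool" where
  "cstar_hom A D \<phi> \<longleftrightarrow>
     \<phi> \<in> carrier A \<rightarrow> carrier D \<and>
     (\<forall>x \<in> carrier A. \<forall>y \<in> carrier A. \<phi> (x \<oplus>\<^bsub>A\<^esub> y) = \<phi> x \<oplus>\<^bsub>D\<^esub> \<phi> y) \<and>
     (\<forall>x \<in> carrier A. \<forall>y \<in> carrier A. \<phi> (x \<otimes>\<^bsub>A\<^esub> y) = \<phi> x \<otimes>\<^bsub>D\<^esub> \<phi> y) \<and>
     (\<forall>c. \<forall>x \<in> carrier A. \<phi> (c \<odot>\<^bsub>A\<^esub> x) = c \<odot>\<^bsub>D\<^esub> \<phi> x) \<and>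
     (\<forall>x \<in> carrier A. \<phi> (cadjoint A x) = cadjoint D (\<phi> x))"

text \<open>
  The usual notion of isomorphism of C*-algebras: a bijective *-homomorphism (which is
  automatically isometric).
\<close>

definition cstar_isomorphic :: "'a cstar \<Rightarrow> 'b cstar \<Rightarrow> bool" (infix \<open>\<cong>\<^sub>C\<close> 50) where
  "A \<cong>\<^sub>C D \<longleftrightarrow> (\<exists>\<phi>. cstar_hom A D \<phi> \<and> bij_betw \<phi> (carrier A) (carrier D))"

definition cstar_subalgebra :: "'a cstar \<Rightarrow> 'a set \<Rightarrow> bool" where
  "cstar_subalgebra A S \<longleftrightarrow>
     S \<subseteq> carrier A \<and> \<zero>\<^bsub>A\<^esub> \<in> S \<and>
     (\<forall>x \<in> S. \<forall>y \<in> S. x \<oplus>\<^bsub>A\<^esub> y \<in> S \<and> x \<otimes>\<^bsub>A\<^esub> y \<in> S) \<and>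
     (\<forall>c. \<forall>x \<in> S. c \<odot>\<^bsub>A\<^esub> x \<in> S) \<and>
     (\<forall>x \<in> S. cadjoint A x \<in> S) \<and>
     (\<forall>f. \<forall>x \<in> carrier A. range f \<subseteq> S \<and> cstar_limit A f x \<longrightarrow> x \<in> S)"

definition cstar_generated :: "'a cstar \<Rightarrow> 'a set \<Rightarrow> 'a set" where
  "cstar_generated A X = \<Inter>{S. cstar_subalgebra A S \<and> X \<subseteq> S}"


section \<open>Matrix algebras and finite direct sums\<close>

definition vec_norm2 :: "complex vec \<Rightarrow> real" where
  "vec_norm2 v = sqrt (\<Sum>i<dim_vec v. (cmod (v $ i))\<^sup>2)"

definition operator_norm :: "nat \<Rightarrow> complex mat \<Rightarrow> real" where
  "operator_norm n M = Sup {vec_norm2 (M *\<^sub>v v) | v. v \<in> carrier_vec n \<and> vec_norm2 v \<le> 1}"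

definition matrix_cstar :: "nat \<Rightarrow> complex mat cstar" where
  "matrix_cstar n =
     module.extend (module_mat TYPE(complex) n n)
       \<lparr>cadjoint = mat_adjoint, cnorm = operator_norm n\<rparr>"

text \<open>
  Intended for a finite index set only; the extra 0 under \<open>Max\<close> makes the norm of the
  empty direct sum meaningful.
\<close>

definition direct_sum_cstar :: "'i set \<Rightarrow> ('i \<Rightarrow> 'a cstar) \<Rightarrow> ('i \<Rightarrow> 'a) cstar" where
  "direct_sum_cstar I A =
     \<lparr>carrier = (\<Pi>\<^sub>E i\<in>I. carrier (A i)),
      monoid.mult = (\<lambda>x y. \<lambda>i\<in>I. x i \<otimes>\<^bsub>A i\<^esub> y i),
      one = (\<lambda>i\<in>I. \<one>\<^bsub>A i\<^esub>),
      zero = (\<lambda>i\<in>I. \<zero>\<^bsub>A i\<^esub>),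
      add = (\<lambda>x y. \<lambda>i\<in>I. x i \<oplus>\<^bsub>A i\<^esub> y i),
      module.smult = (\<lambda>c x. \<lambda>i\<in>I. c \<odot>\<^bsub>A i\<^esub> x i),
      cadjoint = (\<lambda>x. \<lambda>i\<in>I. cadjoint (A i) (x i)),
      cnorm = (\<lambda>x. Max (insert 0 ((\<lambda>i. cnorm (A i) (x i)) ` I)))\<rparr>"


section \<open>Labeled graph C*-algebras\<close>

definition labeled_representation ::
  "('v, 'e) pre_digraph \<Rightarrow> ('e \<Rightarrow> 'l) \<Rightarrow> 'v set set \<Rightarrow>
   'a cstar \<Rightarrow> ('v set \<Rightarrow> 'a) \<Rightarrow> ('l \<Rightarrow> 'a) \<Rightarrow> bool" where
  "labeled_representation E L B A p s \<longleftrightarrow>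
     (\<forall>X \<in> B. projection A (p X)) \<and>
     (\<forall>a \<in> alphabet E L. partial_isometry A (s a)) \<and>
     (\<forall>X \<in> B. \<forall>Y \<in> B. p X \<otimes>\<^bsub>A\<^esub> p Y = p (X \<inter> Y) \<and>
        p (X \<union> Y) = p X \<oplus>\<^bsub>A\<^esub> p Y \<ominus>\<^bsub>A\<^esub> p (X \<inter> Y)) \<and>
     (\<forall>a \<in> alphabet E L. \<forall>b \<in> alphabet E L.
        cadjoint A (s a) \<otimes>\<^bsub>A\<^esub> s b = (if a = b then p (word_range E L [a]) else \<zero>\<^bsub>A\<^esub>)) \<and>
     (\<forall>a \<in> alphabet E L. \<forall>X \<in> B.
        cadjoint A (s a) \<otimes>\<^bsub>A\<^esub> p X = p (rel_range E L X [a]) \<otimes>\<^bsub>A\<^esub> cadjoint A (s a)) \<and>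
     (\<forall>X \<in> B. finite (out_labels E L X) \<and> X \<inter> sinks E = {} \<longrightarrow>
        p X = (\<Oplus>\<^bsub>A\<^esub>a \<in> out_labels E L X.
                 s a \<otimes>\<^bsub>A\<^esub> p (rel_range E L X [a]) \<otimes>\<^bsub>A\<^esub> cadjoint A (s a)))"

text \<open>
  HOL cannot quantify over all types inside a formula, so the universal property is tested on
  the C*-algebras whose carrier lies in one fixed type, namely the functions
  from words in the generators (the \<open>p X\<close> and \<open>s a\<close>) to the complex numbers. No generality is
  lost: if there are \<open>\<kappa>\<close> generators, then a C*-algebra generated by a representation has at most
  \<open>max \<kappa> \<omega>\<close> to the power \<open>\<omega>\<close> elements, so it has an isomorphic copy with carrier in this type.
\<close>

type_synonym ('v, 'l) test_type = "('v set + 'l) list \<Rightarrow> complex"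

text \<open>
  \<open>is_labeled_graph_cstar E L B C p s\<close>: the representation \<open>(p, s)\<close> in \<open>C\<close> is universal and
  generates \<open>C\<close>; that is, \<open>C\<close> is the labeled graph C*-algebra of \<open>(E, L, B)\<close>.
\<close>

definition is_labeled_graph_cstar ::
  "('v, 'e) pre_digraph \<Rightarrow> ('e \<Rightarrow> 'l) \<Rightarrow> 'v set set \<Rightarrow>
   'a cstar \<Rightarrow> ('v set \<Rightarrow> 'a) \<Rightarrow> ('l \<Rightarrow> 'a) \<Rightarrow> bool" where
  "is_labeled_graph_cstar E L B C p s \<longleftrightarrow>
     cstar_algebra C \<and> labeled_representation E L B C p s \<and>
     cstar_generated C (p ` B \<union> s ` alphabet E L) = carrier C \<and>
     (\<forall>(D :: ('v, 'l) test_type cstar) q t.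
        cstar_algebra D \<and> labeled_representation E L B D q t \<longrightarrow>
        (\<exists>\<phi>. cstar_hom C D \<phi> \<and> (\<forall>X \<in> B. \<phi> (p X) = q X) \<and>
             (\<forall>a \<in> alphabet E L. \<phi> (s a) = t a)))"

text \<open>The set \<open>A\<^sub>x\<close>; its use presupposes that \<open>x\<close> lies in some member of \<open>B\<close>.\<close>

definition smallest_nbhd :: "'v set set \<Rightarrow> 'v \<Rightarrow> 'v set" where
  "smallest_nbhd B x = \<Inter>{X \<in> B. x \<in> X}"

definition sink_classes :: "('v, 'e) pre_digraph \<Rightarrow> 'v set set \<Rightarrow> 'v set set" where
  "sink_classes E B = smallest_nbhd B ` sinks E"

definition num_words_onto ::
  "('v, 'e) pre_digraph \<Rightarrow> ('e \<Rightarrow> 'l) \<Rightarrow> 'v set \<Rightarrow> nat" where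
  "num_words_onto E L V = card {\<alpha> \<in> labeled_words E L. V \<subseteq> word_range E L \<alpha>}"

end

theory Submission
  imports Defs "HOL-Analysis.L2_Norm"
begin

text \<open>
  Each \<open>V = A\<^sub>x\<close> is an atom of \<open>B\<close>: since \<open>B\<close> is closed under relative complements, a member
  of \<open>B\<close> either contains \<open>V\<close> or is disjoint from it. Two of these sets are therefore equal or
  disjoint, and since the set of sinks is in \<open>B\<close>, they partition the sinks. Now let
  \<open>(p, s)\<close> be any representation and consider the elements
  \<open>e((V, \<alpha>), (V, \<beta>)) = s\<^sub>\<alpha> p\<^sub>V s\<^sub>\<beta>\<^sup>*\<close> for words \<open>\<alpha>, \<beta>\<close>, possibly empty, whose ranges contain \<open>V\<close>. If a
  letter follows \<open>p\<^sub>V\<close>, the product is zero, because \<open>V\<close> consists of sinks and so \<open>r(V, b)\<close> is empty.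
  Hence \<open>p\<^sub>V s\<^sub>\<beta>\<^sup>* s\<^sub>\<gamma> p\<^sub>W\<close> vanishes unless \<open>V = W\<close> and \<open>\<beta> = \<gamma>\<close>, when it is \<open>p\<^sub>V\<close>
  (\<open>path_elt_orthogonal\<close>), and so these elements are matrix units, with one block of size
  \<open>n\<^sub>V + 1\<close> for each \<open>V\<close>; the empty word accounts for the 1.

  The matrix units span all generators. As \<open>E\<close> is finite and has no cycles, there are only finitely many
  words, and iterating the Cuntz--Krieger relation until it reaches the sinks gives
  \<open>p\<^sub>X = \<Sum> s\<^sub>\<alpha> p\<^sub>V s\<^sub>\<alpha>\<^sup>*\<close>, the sum being over \<open>V \<subseteq> r(X, \<alpha>)\<close> (\<open>p_eq_sum_e\<close>); multiplying the
  case \<open>X = r(a)\<close> by \<open>s\<^sub>a\<close> expresses \<open>s\<^sub>a\<close> (\<open>s_eq_sum_e\<close>). Conversely, these formulas define a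
  representation in the direct sum of the matrix algebras (\<open>canonical_representation\<close>), and every
  representation is its composition with the homomorphism that sends matrix units to matrix units. So
  the direct sum with this representation is universal.

  Uniqueness is proved without presupposing that a universal algebra \<open>C\<close> is finite-dimensional. The
  homomorphism from the matrices to \<open>C\<close> has a left inverse by universality of \<open>C\<close>; its range is
  closed, because a norm-convergent sequence in the span of nonzero matrix units converges in each
  coefficient (\<open>range_unit_map_subalgebra\<close>); and so the range is the whole of \<open>C\<close>, which the
  representation generates.

  The matrices are indexed by pairs \<open>(V, \<alpha>)\<close> until the last part, where enumerating the words of
  each block identifies them with matrices of numbered rows and columns.
\<close>

section \<open>The operator norm of a matrix over a finite index set\<close>

text \<open>
  Matrices are indexed by an arbitrary finite set \<open>\<Omega>\<close>, so that words can serve as row and column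
  indices.
\<close>

definition ell2_norm :: "'o set \<Rightarrow> ('o \<Rightarrow> complex) \<Rightarrow> real" where
  "ell2_norm \<Omega> \<xi> = L2_set (\<lambda>x. cmod (\<xi> x)) \<Omega>"

definition apply_matrix :: "'o set \<Rightarrow> ('o \<Rightarrow> 'o \<Rightarrow> complex) \<Rightarrow> ('o \<Rightarrow> complex) \<Rightarrow> 'o \<Rightarrow> complex" where
  "apply_matrix \<Omega> F \<xi> x = (\<Sum>y\<in>\<Omega>. F x y * \<xi> y)"

definition matrix_opnorm :: "'o set \<Rightarrow> ('o \<Rightarrow> 'o \<Rightarrow> complex) \<Rightarrow> real" where
  "matrix_opnorm \<Omega> F = Sup {ell2_norm \<Omega> (apply_matrix \<Omega> F \<xi>) | \<xi>. ell2_norm \<Omega> \<xi> \<le> 1}"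

lemma ell2_norm_nonneg [simp]: "0 \<le> ell2_norm \<Omega> \<xi>"
  by (simp add: ell2_norm_def)

lemma ell2_norm_triangle:
  "ell2_norm \<Omega> (\<lambda>x. \<xi> x + \<eta> x) \<le> ell2_norm \<Omega> \<xi> + ell2_norm \<Omega> \<eta>"
proof -
  have "ell2_norm \<Omega> (\<lambda>x. \<xi> x + \<eta> x) \<le> L2_set (\<lambda>x. cmod (\<xi> x) + cmod (\<eta> x)) \<Omega>"
    unfolding ell2_norm_def by (intro L2_set_mono norm_triangle_ineq norm_ge_zero)
  also have "\<dots> \<le> ell2_norm \<Omega> \<xi> + ell2_norm \<Omega> \<eta>"
    unfolding ell2_norm_def by (rule L2_set_triangle_ineq)
  finally show ?thesis .
qed

lemma ell2_norm_scale: "ell2_norm \<Omega> (\<lambda>x. c * \<xi> x) = cmod c * ell2_norm \<Omega> \<xi>"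
  unfolding ell2_norm_def by (simp add: norm_mult L2_set_right_distrib)

lemma norm_le_ell2_norm: "finite \<Omega> \<Longrightarrow> x \<in> \<Omega> \<Longrightarrow> cmod (\<xi> x) \<le> ell2_norm \<Omega> \<xi>"
  unfolding ell2_norm_def by (rule member_le_L2_set[where f = "\<lambda>x. cmod (\<xi> x)"])

lemma ell2_norm_eq_0: "finite \<Omega> \<Longrightarrow> ell2_norm \<Omega> \<xi> = 0 \<longleftrightarrow> (\<forall>x\<in>\<Omega>. \<xi> x = 0)"
  unfolding ell2_norm_def by (simp add: L2_set_eq_0_iff)

lemma ell2_norm_delta:
  assumes "finite \<Omega>" "y \<in> \<Omega>"
  shows "ell2_norm \<Omega> (\<lambda>x. if x = y then 1 else 0) = 1"
proof -
  have "(\<Sum>x\<in>\<Omega>. (cmod (if x = y then 1 else 0))\<^sup>2) = (\<Sum>x\<in>\<Omega>. if x = y then 1 else 0)"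
    by (intro sum.cong) auto
  then show ?thesis using assms by (simp add: ell2_norm_def L2_set_def)
qed

text \<open>
  This crude bound makes the supremum in the definition of the operator norm finite, and later
  turns entrywise convergence into norm convergence.
\<close>

lemma ell2_norm_apply_le_sum:
  assumes "finite \<Omega>"
  shows "ell2_norm \<Omega> (apply_matrix \<Omega> F \<xi>) \<le> (\<Sum>x\<in>\<Omega>. \<Sum>y\<in>\<Omega>. cmod (F x y)) * ell2_norm \<Omega> \<xi>"
proof -
  have "ell2_norm \<Omega> (apply_matrix \<Omega> F \<xi>) \<le> (\<Sum>x\<in>\<Omega>. cmod (apply_matrix \<Omega> F \<xi> x))"
    unfolding ell2_norm_def by (intro L2_set_le_sum) auto
  also have "\<dots> \<le> (\<Sum>x\<in>\<Omega>. \<Sum>y\<in>\<Omega>. cmod (F x y) * ell2_norm \<Omega> \<xi>)"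
    unfolding apply_matrix_def
  proof (intro sum_mono)
    fix x assume "x \<in> \<Omega>"
    have "cmod (\<Sum>y\<in>\<Omega>. F x y * \<xi> y) \<le> (\<Sum>y\<in>\<Omega>. cmod (F x y * \<xi> y))"
      by (rule norm_sum)
    also have "\<dots> \<le> (\<Sum>y\<in>\<Omega>. cmod (F x y) * ell2_norm \<Omega> \<xi>)"
      using assms by (intro sum_mono) (simp add: norm_mult mult_left_mono norm_le_ell2_norm)
    finally show "cmod (\<Sum>y\<in>\<Omega>. F x y * \<xi> y) \<le> (\<Sum>y\<in>\<Omega>. cmod (F x y) * ell2_norm \<Omega> \<xi>)" .
  qed
  also have "\<dots> = (\<Sum>x\<in>\<Omega>. \<Sum>y\<in>\<Omega>. cmod (F x y)) * ell2_norm \<Omega> \<xi>"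
    by (simp add: sum_distrib_right)
  finally show ?thesis .
qed

lemma matrix_opnorm_upper:
  assumes "finite \<Omega>" "ell2_norm \<Omega> \<xi> \<le> 1"
  shows "ell2_norm \<Omega> (apply_matrix \<Omega> F \<xi>) \<le> matrix_opnorm \<Omega> F"
  unfolding matrix_opnorm_def
proof (rule cSup_upper)
  show "bdd_above {ell2_norm \<Omega> (apply_matrix \<Omega> F \<xi>) | \<xi>. ell2_norm \<Omega> \<xi> \<le> 1}"
  proof (rule bdd_aboveI)
    fix r assume "r \<in> {ell2_norm \<Omega> (apply_matrix \<Omega> F \<xi>) | \<xi>. ell2_norm \<Omega> \<xi> \<le> 1}"
    then obtain \<eta> where \<eta>: "r = ell2_norm \<Omega> (apply_matrix \<Omega> F \<eta>)" "ell2_norm \<Omega> \<eta> \<le> 1"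
      by blast
    have "r \<le> (\<Sum>x\<in>\<Omega>. \<Sum>y\<in>\<Omega>. cmod (F x y)) * ell2_norm \<Omega> \<eta>"
      unfolding \<eta>(1) by (rule ell2_norm_apply_le_sum[OF assms(1)])
    also have "\<dots> \<le> (\<Sum>x\<in>\<Omega>. \<Sum>y\<in>\<Omega>. cmod (F x y)) * 1"
      by (intro mult_left_mono \<eta>(2) sum_nonneg norm_ge_zero)
    finally show "r \<le> (\<Sum>x\<in>\<Omega>. \<Sum>y\<in>\<Omega>. cmod (F x y))" by simp
  qed
qed (use assms in blast)

lemma matrix_opnorm_least:
  assumes "\<And>\<xi>. ell2_norm \<Omega> \<xi> \<le> 1 \<Longrightarrow> ell2_norm \<Omega> (apply_matrix \<Omega> F \<xi>) \<le> c"
  shows "matrix_opnorm \<Omega> F \<le> c"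
  unfolding matrix_opnorm_def
proof (rule cSup_least)
  have "ell2_norm \<Omega> (\<lambda>_. 0) \<le> 1"
    by (simp add: ell2_norm_def L2_set_def)
  then show "{ell2_norm \<Omega> (apply_matrix \<Omega> F \<xi>) | \<xi>. ell2_norm \<Omega> \<xi> \<le> 1} \<noteq> {}" by blast
qed (use assms in blast)

lemma matrix_opnorm_nonneg: "finite \<Omega> \<Longrightarrow> 0 \<le> matrix_opnorm \<Omega> F"
  using matrix_opnorm_upper[of \<Omega> "\<lambda>_. 0" F] ell2_norm_nonneg
  by (metis ell2_norm_eq_0 order_trans zero_le_one)

lemma ell2_norm_apply_le:
  assumes "finite \<Omega>"
  shows "ell2_norm \<Omega> (apply_matrix \<Omega> F \<xi>) \<le> matrix_opnorm \<Omega> F * ell2_norm \<Omega> \<xi>"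
proof (cases "ell2_norm \<Omega> \<xi> = 0")
  case True
  then show ?thesis
    using ell2_norm_apply_le_sum[OF assms, of F \<xi>] by simp
next
  case False
  define c where "c = ell2_norm \<Omega> \<xi>"
  have c: "c > 0" using False ell2_norm_nonneg[of \<Omega> \<xi>] unfolding c_def by linarith
  let ?\<eta> = "\<lambda>x. complex_of_real (inverse c) * \<xi> x"
  have app: "apply_matrix \<Omega> F ?\<eta> = (\<lambda>x. complex_of_real (inverse c) * apply_matrix \<Omega> F \<xi> x)"
    by (simp add: fun_eq_iff apply_matrix_def sum_distrib_left mult_ac)
  have "ell2_norm \<Omega> ?\<eta> \<le> 1"
    unfolding ell2_norm_scale using c by (simp add: c_def[symmetric] norm_inverse)
  from matrix_opnorm_upper[OF assms this, of F]
  have "inverse c * ell2_norm \<Omega> (apply_matrix \<Omega> F \<xi>) \<le> matrix_opnorm \<Omega> F"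
    unfolding app ell2_norm_scale using c by (simp add: norm_inverse)
  then show ?thesis using c by (simp add: c_def[symmetric] field_simps)
qed

lemma norm_entry_le_matrix_opnorm:
  assumes "finite \<Omega>" "x \<in> \<Omega>" "y \<in> \<Omega>"
  shows "cmod (F x y) \<le> matrix_opnorm \<Omega> F"
proof -
  let ?\<delta> = "\<lambda>z. if z = y then 1 else 0 :: complex"
  have app: "apply_matrix \<Omega> F ?\<delta> x = F x y"
    using assms by (simp add: apply_matrix_def if_distrib cong: if_cong)
  have "cmod (F x y) \<le> ell2_norm \<Omega> (apply_matrix \<Omega> F ?\<delta>)"
    using norm_le_ell2_norm[OF assms(1,2), of "apply_matrix \<Omega> F ?\<delta>"] by (simp add: app)
  also have "\<dots> \<le> matrix_opnorm \<Omega> F"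
    by (rule matrix_opnorm_upper[OF assms(1)]) (simp add: ell2_norm_delta[OF assms(1,3)])
  finally show ?thesis .
qed

lemma matrix_opnorm_le_sum:
  assumes "finite \<Omega>"
  shows "matrix_opnorm \<Omega> F \<le> (\<Sum>x\<in>\<Omega>. \<Sum>y\<in>\<Omega>. cmod (F x y))"
proof (rule matrix_opnorm_least)
  fix \<xi> assume "ell2_norm \<Omega> \<xi> \<le> 1"
  then have "(\<Sum>x\<in>\<Omega>. \<Sum>y\<in>\<Omega>. cmod (F x y)) * ell2_norm \<Omega> \<xi> \<le> (\<Sum>x\<in>\<Omega>. \<Sum>y\<in>\<Omega>. cmod (F x y)) * 1"
    by (intro mult_left_mono sum_nonneg norm_ge_zero)
  with ell2_norm_apply_le_sum[OF assms, of F \<xi>]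
  show "ell2_norm \<Omega> (apply_matrix \<Omega> F \<xi>) \<le> (\<Sum>x\<in>\<Omega>. \<Sum>y\<in>\<Omega>. cmod (F x y))" by simp
qed

lemma matrix_opnorm_eq_0:
  assumes "finite \<Omega>"
  shows "matrix_opnorm \<Omega> F = 0 \<longleftrightarrow> (\<forall>x\<in>\<Omega>. \<forall>y\<in>\<Omega>. F x y = 0)"
proof
  assume "matrix_opnorm \<Omega> F = 0"
  then show "\<forall>x\<in>\<Omega>. \<forall>y\<in>\<Omega>. F x y = 0"
    using norm_entry_le_matrix_opnorm[OF assms, of _ _ F] by fastforce
next
  assume "\<forall>x\<in>\<Omega>. \<forall>y\<in>\<Omega>. F x y = 0"
  then have "(\<Sum>x\<in>\<Omega>. \<Sum>y\<in>\<Omega>. cmod (F x y)) = 0" by simp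
  with matrix_opnorm_le_sum[OF assms, of F] matrix_opnorm_nonneg[OF assms, of F]
  show "matrix_opnorm \<Omega> F = 0" by simp
qed

lemma matrix_opnorm_triangle:
  assumes "finite \<Omega>"
  shows "matrix_opnorm \<Omega> (\<lambda>x y. F x y + G x y) \<le> matrix_opnorm \<Omega> F + matrix_opnorm \<Omega> G"
proof (rule matrix_opnorm_least)
  fix \<xi> assume \<xi>: "ell2_norm \<Omega> \<xi> \<le> 1"
  have "apply_matrix \<Omega> (\<lambda>x y. F x y + G x y) \<xi>
      = (\<lambda>x. apply_matrix \<Omega> F \<xi> x + apply_matrix \<Omega> G \<xi> x)"
    by (simp add: apply_matrix_def fun_eq_iff sum.distrib distrib_right)
  then have "ell2_norm \<Omega> (apply_matrix \<Omega> (\<lambda>x y. F x y + G x y) \<xi>)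
      \<le> ell2_norm \<Omega> (apply_matrix \<Omega> F \<xi>) + ell2_norm \<Omega> (apply_matrix \<Omega> G \<xi>)"
    by (simp add: ell2_norm_triangle)
  also have "\<dots> \<le> matrix_opnorm \<Omega> F + matrix_opnorm \<Omega> G"
    by (intro add_mono matrix_opnorm_upper assms \<xi>)
  finally show "ell2_norm \<Omega> (apply_matrix \<Omega> (\<lambda>x y. F x y + G x y) \<xi>) \<le> \<dots>" .
qed

lemma matrix_opnorm_scale_le:
  assumes "finite \<Omega>"
  shows "matrix_opnorm \<Omega> (\<lambda>x y. c * F x y) \<le> cmod c * matrix_opnorm \<Omega> F"
proof (rule matrix_opnorm_least)
  fix \<xi> assume \<xi>: "ell2_norm \<Omega> \<xi> \<le> 1"
  have "apply_matrix \<Omega> (\<lambda>x y. c * F x y) \<xi> = (\<lambda>x. c * apply_matrix \<Omega> F \<xi> x)"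
    by (simp add: fun_eq_iff apply_matrix_def sum_distrib_left mult.assoc)
  then show "ell2_norm \<Omega> (apply_matrix \<Omega> (\<lambda>x y. c * F x y) \<xi>) \<le> cmod c * matrix_opnorm \<Omega> F"
    by (simp add: ell2_norm_scale mult_left_mono matrix_opnorm_upper[OF assms \<xi>])
qed

lemma matrix_opnorm_scale:
  assumes "finite \<Omega>"
  shows "matrix_opnorm \<Omega> (\<lambda>x y. c * F x y) = cmod c * matrix_opnorm \<Omega> F"
proof (cases "c = 0")
  case True
  then show ?thesis using matrix_opnorm_eq_0[OF assms, of "\<lambda>_ _. 0"] by simp
next
  case False
  have "matrix_opnorm \<Omega> F \<le> cmod (inverse c) * matrix_opnorm \<Omega> (\<lambda>x y. c * F x y)"
    using matrix_opnorm_scale_le[OF assms, of "inverse c" "\<lambda>x y. c * F x y"] False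
    by (simp add: mult.assoc[symmetric])
  then have "cmod c * matrix_opnorm \<Omega> F \<le> matrix_opnorm \<Omega> (\<lambda>x y. c * F x y)"
    using False by (simp add: norm_divide field_simps)
  with matrix_opnorm_scale_le[OF assms, of c F] show ?thesis by simp
qed

lemma matrix_opnorm_mult:
  assumes "finite \<Omega>"
  shows "matrix_opnorm \<Omega> (\<lambda>x y. \<Sum>z\<in>\<Omega>. F x z * G z y) \<le> matrix_opnorm \<Omega> F * matrix_opnorm \<Omega> G"
proof (rule matrix_opnorm_least)
  fix \<xi> assume \<xi>: "ell2_norm \<Omega> \<xi> \<le> 1"
  have "apply_matrix \<Omega> (\<lambda>x y. \<Sum>z\<in>\<Omega>. F x z * G z y) \<xi> = apply_matrix \<Omega> F (apply_matrix \<Omega> G \<xi>)"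
  proof
    fix x
    show "apply_matrix \<Omega> (\<lambda>x y. \<Sum>z\<in>\<Omega>. F x z * G z y) \<xi> x
        = apply_matrix \<Omega> F (apply_matrix \<Omega> G \<xi>) x"
      unfolding apply_matrix_def sum_distrib_left sum_distrib_right
      by (subst sum.swap) (simp add: mult.assoc)
  qed
  then have "ell2_norm \<Omega> (apply_matrix \<Omega> (\<lambda>x y. \<Sum>z\<in>\<Omega>. F x z * G z y) \<xi>)
      \<le> matrix_opnorm \<Omega> F * ell2_norm \<Omega> (apply_matrix \<Omega> G \<xi>)"
    by (simp add: ell2_norm_apply_le[OF assms])
  also have "\<dots> \<le> matrix_opnorm \<Omega> F * matrix_opnorm \<Omega> G"
    by (intro mult_left_mono matrix_opnorm_upper assms \<xi> matrix_opnorm_nonneg)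
  finally show "ell2_norm \<Omega> (apply_matrix \<Omega> (\<lambda>x y. \<Sum>z\<in>\<Omega>. F x z * G z y) \<xi>) \<le> \<dots>" .
qed

text \<open>
  Half of the C*-identity: \<open>\<parallel>F \<xi>\<parallel>\<^sup>2 = \<langle>F\<^sup>* F \<xi>, \<xi>\<rangle>\<close>, to which the Cauchy--Schwarz inequality applies.
\<close>

lemma matrix_opnorm_square_le:
  assumes "finite \<Omega>"
  shows "(matrix_opnorm \<Omega> F)\<^sup>2 \<le> matrix_opnorm \<Omega> (\<lambda>x y. \<Sum>z\<in>\<Omega>. cnj (F z x) * F z y)"
    (is "_ \<le> matrix_opnorm \<Omega> ?G")
proof -
  have "ell2_norm \<Omega> (apply_matrix \<Omega> F \<xi>) \<le> sqrt (matrix_opnorm \<Omega> ?G)"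
    if \<xi>: "ell2_norm \<Omega> \<xi> \<le> 1" for \<xi>
  proof -
    let ?\<eta> = "apply_matrix \<Omega> F \<xi>" and ?\<zeta> = "apply_matrix \<Omega> ?G \<xi>"
    have "complex_of_real ((ell2_norm \<Omega> ?\<eta>)\<^sup>2) = (\<Sum>x\<in>\<Omega>. ?\<eta> x * cnj (?\<eta> x))"
      by (simp add: ell2_norm_def L2_set_def sum_nonneg complex_mult_cnj cmod_power2)
    also have "\<dots> = (\<Sum>x\<in>\<Omega>. \<Sum>y\<in>\<Omega>. ?\<eta> x * (cnj (F x y) * cnj (\<xi> y)))"
      by (subst (2) apply_matrix_def) (simp add: sum_distrib_left)
    also have "\<dots> = (\<Sum>y\<in>\<Omega>. \<Sum>x\<in>\<Omega>. ?\<eta> x * (cnj (F x y) * cnj (\<xi> y)))"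
      by (rule sum.swap)
    also have "\<dots> = (\<Sum>y\<in>\<Omega>. ?\<zeta> y * cnj (\<xi> y))"
    proof (rule sum.cong[OF refl])
      fix y assume "y \<in> \<Omega>"
      have "?\<zeta> y = (\<Sum>w\<in>\<Omega>. \<Sum>x\<in>\<Omega>. cnj (F x y) * F x w * \<xi> w)"
        by (simp add: apply_matrix_def sum_distrib_right)
      also have "\<dots> = (\<Sum>x\<in>\<Omega>. \<Sum>w\<in>\<Omega>. cnj (F x y) * F x w * \<xi> w)"
        by (rule sum.swap)
      also have "\<dots> = (\<Sum>x\<in>\<Omega>. cnj (F x y) * ?\<eta> x)"
        by (simp add: apply_matrix_def sum_distrib_left mult.assoc)
      finally show "(\<Sum>x\<in>\<Omega>. ?\<eta> x * (cnj (F x y) * cnj (\<xi> y))) = ?\<zeta> y * cnj (\<xi> y)"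
        by (simp add: sum_distrib_left mult_ac)
    qed
    finally have "(ell2_norm \<Omega> ?\<eta>)\<^sup>2 = cmod (\<Sum>y\<in>\<Omega>. ?\<zeta> y * cnj (\<xi> y))"
      by (metis norm_of_real abs_power2)
    also have "\<dots> \<le> (\<Sum>y\<in>\<Omega>. \<bar>cmod (?\<zeta> y)\<bar> * \<bar>cmod (\<xi> y)\<bar>)"
      by (rule order_trans[OF norm_sum]) (simp add: norm_mult)
    also have "\<dots> \<le> ell2_norm \<Omega> ?\<zeta> * ell2_norm \<Omega> \<xi>"
      unfolding ell2_norm_def by (rule L2_set_mult_ineq)
    also have "\<dots> \<le> matrix_opnorm \<Omega> ?G * 1"
      by (intro mult_mono matrix_opnorm_upper matrix_opnorm_nonneg assms \<xi> ell2_norm_nonneg)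
    finally show ?thesis by (intro real_le_rsqrt) simp
  qed
  then have "matrix_opnorm \<Omega> F \<le> sqrt (matrix_opnorm \<Omega> ?G)"
    by (rule matrix_opnorm_least)
  then have "(matrix_opnorm \<Omega> F)\<^sup>2 \<le> (sqrt (matrix_opnorm \<Omega> ?G))\<^sup>2"
    by (intro power_mono matrix_opnorm_nonneg assms)
  then show ?thesis by (simp add: matrix_opnorm_nonneg[OF assms])
qed

text \<open>
  From \<open>\<parallel>F\<parallel>\<^sup>2 \<le> \<parallel>F\<^sup>* F\<parallel> \<le> \<parallel>F\<^sup>*\<parallel> \<parallel>F\<parallel>\<close> one factor \<open>\<parallel>F\<parallel>\<close> cancels.
\<close>

lemma matrix_opnorm_adjoint_le:
  assumes "finite \<Omega>"
  shows "matrix_opnorm \<Omega> F \<le> matrix_opnorm \<Omega> (\<lambda>x y. cnj (F y x))"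
proof -
  let ?H = "\<lambda>x y. cnj (F y x)"
  have "(matrix_opnorm \<Omega> F)\<^sup>2 \<le> matrix_opnorm \<Omega> ?H * matrix_opnorm \<Omega> F"
    by (rule order_trans[OF matrix_opnorm_square_le[OF assms] matrix_opnorm_mult[OF assms]])
  then show ?thesis
    using matrix_opnorm_nonneg[OF assms, of F] matrix_opnorm_nonneg[OF assms, of ?H]
    by (cases "matrix_opnorm \<Omega> F = 0") (auto simp: power2_eq_square)
qed

lemma matrix_opnorm_cstar:
  assumes "finite \<Omega>"
  shows "matrix_opnorm \<Omega> (\<lambda>x y. \<Sum>z\<in>\<Omega>. cnj (F z x) * F z y) = (matrix_opnorm \<Omega> F)\<^sup>2"
proof (rule antisym)
  have "matrix_opnorm \<Omega> (\<lambda>x y. \<Sum>z\<in>\<Omega>. cnj (F z x) * F z y)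
      \<le> matrix_opnorm \<Omega> (\<lambda>x y. cnj (F y x)) * matrix_opnorm \<Omega> F"
    by (rule matrix_opnorm_mult[OF assms])
  also have "\<dots> \<le> matrix_opnorm \<Omega> F * matrix_opnorm \<Omega> F"
    using matrix_opnorm_adjoint_le[OF assms, of "\<lambda>x y. cnj (F y x)"]
    by (intro mult_right_mono matrix_opnorm_nonneg assms) simp
  finally show "matrix_opnorm \<Omega> (\<lambda>x y. \<Sum>z\<in>\<Omega>. cnj (F z x) * F z y) \<le> (matrix_opnorm \<Omega> F)\<^sup>2"
    by (simp add: power2_eq_square)
qed (rule matrix_opnorm_square_le[OF assms])

section \<open>Finite sums and homomorphisms in C*-algebras\<close>

context cstar_algebra
begin

lemma zero_mult [simp]:
  assumes "x \<in> carrier A"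
  shows "\<zero> \<otimes> x = \<zero>"
proof -
  have "\<zero> \<otimes> x = (0 \<odot> \<zero>) \<otimes> x" by simp
  also have "\<dots> = 0 \<odot> (\<zero> \<otimes> x)" using assms by (intro smult_mult_left) auto
  also have "\<dots> = \<zero>" using assms mult_closed[of \<zero> x] smult_l_null by simp
  finally show ?thesis .
qed

lemma mult_zero [simp]:
  assumes "x \<in> carrier A"
  shows "x \<otimes> \<zero> = \<zero>"
proof -
  have "x \<otimes> \<zero> = x \<otimes> (0 \<odot> \<zero>)" by simp
  also have "\<dots> = 0 \<odot> (x \<otimes> \<zero>)" using assms by (intro smult_mult_right) auto
  also have "\<dots> = \<zero>" using assms mult_closed[of x \<zero>] smult_l_null by simp
  finally show ?thesis .
qed

lemma adjoint_zero [simp]: "cadjoint A \<zero> = \<zero>"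
proof -
  have "cadjoint A \<zero> = cadjoint A (0 \<odot> \<zero>)" by simp
  also have "\<dots> = cnj 0 \<odot> cadjoint A \<zero>" by (rule adjoint_smult) simp
  also have "\<dots> = \<zero>" using adjoint_closed[of \<zero>] smult_l_null by simp
  finally show ?thesis .
qed

lemma finsum_mult_right:
  assumes "finite I" "f \<in> I \<rightarrow> carrier A" "x \<in> carrier A"
  shows "(\<Oplus>i\<in>I. f i) \<otimes> x = (\<Oplus>i\<in>I. f i \<otimes> x)"
  using assms
proof (induction I rule: finite_induct)
  case (insert i I)
  then have "f i \<in> carrier A" "f \<in> I \<rightarrow> carrier A" by auto
  moreover from this have "(\<lambda>i. f i \<otimes> x) \<in> I \<rightarrow> carrier A" using insert.prems mult_closed by auto
  ultimately show ?case using insert by (simp add: mult_distrib_right mult_closed)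
qed simp

lemma finsum_mult_left:
  assumes "finite I" "f \<in> I \<rightarrow> carrier A" "x \<in> carrier A"
  shows "x \<otimes> (\<Oplus>i\<in>I. f i) = (\<Oplus>i\<in>I. x \<otimes> f i)"
  using assms
proof (induction I rule: finite_induct)
  case (insert i I)
  then have "f i \<in> carrier A" "f \<in> I \<rightarrow> carrier A" by auto
  moreover from this have "(\<lambda>i. x \<otimes> f i) \<in> I \<rightarrow> carrier A" using insert.prems mult_closed by auto
  ultimately show ?case using insert by (simp add: mult_distrib_left mult_closed)
qed simp

lemma finsum_smult_right:
  assumes "finite I" "f \<in> I \<rightarrow> carrier A"
  shows "c \<odot> (\<Oplus>i\<in>I. f i) = (\<Oplus>i\<in>I. c \<odot> f i)"
  using assms
proof (induction I rule: finite_induct)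
  case (insert i I)
  then have "f i \<in> carrier A" "f \<in> I \<rightarrow> carrier A" by auto
  moreover from this have "(\<lambda>i. c \<odot> f i) \<in> I \<rightarrow> carrier A" by auto
  ultimately show ?case using insert by (simp add: smult_r_distr)
qed simp

lemma finsum_smult_left:
  assumes "finite I" "x \<in> carrier A"
  shows "(\<Oplus>i\<in>I. c i \<odot> x) = (\<Sum>i\<in>I. c i) \<odot> x"
  using assms
proof (induction I rule: finite_induct)
  case empty
  then show ?case using smult_l_null by simp
next
  case (insert i I)
  then show ?case using smult_l_distr[of "c i" "\<Sum>i\<in>I. c i" x] by simp
qed

lemma finsum_adjoint:
  assumes "finite I" "f \<in> I \<rightarrow> carrier A"
  shows "cadjoint A (\<Oplus>i\<in>I. f i) = (\<Oplus>i\<in>I. cadjoint A (f i))"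
  using assms
proof (induction I rule: finite_induct)
  case (insert i I)
  then have "f i \<in> carrier A" "f \<in> I \<rightarrow> carrier A" by auto
  moreover from this have "(\<lambda>i. cadjoint A (f i)) \<in> I \<rightarrow> carrier A" using adjoint_closed by auto
  ultimately show ?case using insert by (simp add: adjoint_add adjoint_closed)
qed simp

lemma finsum_swap:
  assumes "finite I" "finite J" "\<And>i j. i \<in> I \<Longrightarrow> j \<in> J \<Longrightarrow> f i j \<in> carrier A"
  shows "(\<Oplus>i\<in>I. \<Oplus>j\<in>J. f i j) = (\<Oplus>j\<in>J. \<Oplus>i\<in>I. f i j)"
  using assms(1,3)
proof (induction I rule: finite_induct)
  case empty
  then show ?case by simp
next
  case (insert i I)
  have "(\<lambda>j. f i j) \<in> J \<rightarrow> carrier A" using insert.prems by auto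
  moreover have "(\<lambda>j. \<Oplus>i\<in>I. f i j) \<in> J \<rightarrow> carrier A"
    using insert.prems by (auto intro!: finsum_closed)
  moreover have "(\<Oplus>j\<in>J. \<Oplus>i\<in>insert i I. f i j) = (\<Oplus>j\<in>J. f i j \<oplus> (\<Oplus>i\<in>I. f i j))"
    using insert by (intro M.finsum_cong' finsum_insert) (auto intro!: finsum_closed)
  moreover have "(\<Oplus>i\<in>insert i I. \<Oplus>j\<in>J. f i j) = (\<Oplus>j\<in>J. f i j) \<oplus> (\<Oplus>i\<in>I. \<Oplus>j\<in>J. f i j)"
    using insert by (intro finsum_insert) (auto intro!: finsum_closed)
  ultimately show ?case using insert by (simp add: finsum_addf)
qed

lemma cnorm_finsum_le:
  assumes "finite I" "f \<in> I \<rightarrow> carrier A"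
  shows "cnorm A (\<Oplus>i\<in>I. f i) \<le> (\<Sum>i\<in>I. cnorm A (f i))"
  using assms
proof (induction I rule: finite_induct)
  case empty
  then show ?case using cnorm_eq_0[of \<zero>] by simp
next
  case (insert i I)
  then have "f i \<in> carrier A" "f \<in> I \<rightarrow> carrier A" by auto
  with insert cnorm_triangle[of "f i" "\<Oplus>i\<in>I. f i"] show ?case
    by (simp add: finsum_closed)
qed

lemma uminus_eq_smult: "x \<in> carrier A \<Longrightarrow> \<ominus> x = (-1) \<odot> x"
  using smult_l_minus[of 1 x] smult_one[of x] by (simp add: class_ring_simps)

lemma cnorm_uminus: "x \<in> carrier A \<Longrightarrow> cnorm A (\<ominus> x) = cnorm A x"
  by (simp add: uminus_eq_smult cnorm_smult)

lemma cnorm_minus_triangle: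
  assumes "x \<in> carrier A" "y \<in> carrier A" "z \<in> carrier A"
  shows "cnorm A (x \<ominus> y) \<le> cnorm A (z \<ominus> x) + cnorm A (z \<ominus> y)"
proof -
  have "x \<ominus> y = (z \<ominus> y) \<oplus> \<ominus> (z \<ominus> x)"
  proof -
    have "(z \<ominus> y) \<oplus> \<ominus> (z \<ominus> x) = (z \<oplus> \<ominus> y) \<oplus> (\<ominus> z \<oplus> x)"
      using assms by (simp add: a_minus_def minus_add)
    also have "\<dots> = (z \<oplus> \<ominus> z) \<oplus> (x \<oplus> \<ominus> y)"
      using assms by (simp add: a_ac)
    also have "\<dots> = x \<ominus> y"
      using assms by (simp add: r_neg a_minus_def)
    finally show ?thesis by simp
  qed
  then show ?thesis
    using cnorm_triangle[of "z \<ominus> y" "\<ominus> (z \<ominus> x)"] assms by (simp add: cnorm_uminus)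
qed

lemma cnorm_minus_commute:
  assumes "x \<in> carrier A" "y \<in> carrier A"
  shows "cnorm A (x \<ominus> y) = cnorm A (y \<ominus> x)"
proof -

  have "cnorm A (y \<ominus> y) = 0" "cnorm A (x \<ominus> x) = 0"
    using assms by (simp_all add: a_minus_def r_neg cnorm_eq_0)
  then show ?thesis
    using cnorm_minus_triangle[of x y y] cnorm_minus_triangle[of y x x] assms by simp
qed

lemma cstar_limit_imp_Cauchy:
  assumes "cstar_limit A f x" "range f \<subseteq> carrier A" "x \<in> carrier A"
  shows "cstar_Cauchy A f"
  unfolding cstar_Cauchy_def
proof (intro allI impI)
  fix r :: real assume "0 < r"
  then have "0 < r / 2" by simp
  with assms(1) obtain N where N: "\<And>n. n \<ge> N \<Longrightarrow> norm (cnorm A (f n \<ominus> x) - 0) < r / 2"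
    unfolding cstar_limit_def LIMSEQ_iff by blast
  have f: "f n \<in> carrier A" for n using assms(2) by auto
  have "cnorm A (f m \<ominus> f n) < r" if "m \<ge> N" "n \<ge> N" for m n
  proof -
    have "cnorm A (f m \<ominus> f n) \<le> cnorm A (f m \<ominus> x) + cnorm A (f n \<ominus> x)"
      using cnorm_minus_triangle[OF f f assms(3), of m n] f assms(3)
      by (simp add: cnorm_minus_commute)
    then show ?thesis using N[OF that(1)] N[OF that(2)] by simp
  qed
  then show "\<exists>N. \<forall>m\<ge>N. \<forall>n\<ge>N. cnorm A (f m \<ominus> f n) < r" by blast
qed

lemma cstar_limit_unique:
  assumes "cstar_limit A f x" "cstar_limit A f y"
    and "range f \<subseteq> carrier A" "x \<in> carrier A" "y \<in> carrier A"
  shows "x = y"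
proof -
  have f: "f n \<in> carrier A" for n using assms(3) by auto
  have "cnorm A (y \<ominus> x) \<le> cnorm A (f n \<ominus> x) + cnorm A (f n \<ominus> y)" for n
    using cnorm_minus_triangle[OF assms(5,4) f, of n] by simp
  moreover have "(\<lambda>n. cnorm A (f n \<ominus> x) + cnorm A (f n \<ominus> y)) \<longlonglongrightarrow> 0 + 0"
    using assms(1,2) unfolding cstar_limit_def by (intro tendsto_add)
  ultimately have "cnorm A (y \<ominus> x) \<le> 0"
    by (intro LIMSEQ_le_const[of _ 0]) auto
  then have "y \<ominus> x = \<zero>"
    using cnorm_nonneg[of "y \<ominus> x"] cnorm_eq_0[of "y \<ominus> x"] assms(4,5) by simp
  then have "\<ominus> (\<ominus> x) = y"
    using assms(4,5) by (intro M.minus_equality) (auto simp: a_minus_def)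
  then show ?thesis using assms(4) by simp
qed

end

lemma cstar_hom_closed: "cstar_hom A D \<phi> \<Longrightarrow> x \<in> carrier A \<Longrightarrow> \<phi> x \<in> carrier D"
  unfolding cstar_hom_def by blast

lemma cstar_hom_mult:
  "cstar_hom A D \<phi> \<Longrightarrow> x \<in> carrier A \<Longrightarrow> y \<in> carrier A \<Longrightarrow> \<phi> (x \<otimes>\<^bsub>A\<^esub> y) = \<phi> x \<otimes>\<^bsub>D\<^esub> \<phi> y"
  unfolding cstar_hom_def by blast

lemma cstar_hom_add:
  "cstar_hom A D \<phi> \<Longrightarrow> x \<in> carrier A \<Longrightarrow> y \<in> carrier A \<Longrightarrow> \<phi> (x \<oplus>\<^bsub>A\<^esub> y) = \<phi> x \<oplus>\<^bsub>D\<^esub> \<phi> y"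
  unfolding cstar_hom_def by blast

lemma cstar_hom_smult:
  "cstar_hom A D \<phi> \<Longrightarrow> x \<in> carrier A \<Longrightarrow> \<phi> (c \<odot>\<^bsub>A\<^esub> x) = c \<odot>\<^bsub>D\<^esub> \<phi> x"
  unfolding cstar_hom_def by blast

lemma cstar_hom_adjoint:
  "cstar_hom A D \<phi> \<Longrightarrow> x \<in> carrier A \<Longrightarrow> \<phi> (cadjoint A x) = cadjoint D (\<phi> x)"
  unfolding cstar_hom_def by blast

lemma cstar_hom_zero:
  assumes "cstar_algebra A" "cstar_algebra D" "cstar_hom A D \<phi>"
  shows "\<phi> \<zero>\<^bsub>A\<^esub> = \<zero>\<^bsub>D\<^esub>"
proof -
  interpret A: cstar_algebra A by fact
  interpret D: cstar_algebra D by fact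
  have "\<phi> \<zero>\<^bsub>A\<^esub> = \<phi> (0 \<odot>\<^bsub>A\<^esub> \<zero>\<^bsub>A\<^esub>)" by simp
  also have "\<dots> = 0 \<odot>\<^bsub>D\<^esub> \<phi> \<zero>\<^bsub>A\<^esub>" by (rule cstar_hom_smult[OF assms(3)]) simp
  also have "\<dots> = \<zero>\<^bsub>D\<^esub>"
    using cstar_hom_closed[OF assms(3), of "\<zero>\<^bsub>A\<^esub>"] D.smult_l_null by simp
  finally show ?thesis .
qed

lemma cstar_hom_finsum:
  assumes "cstar_algebra A" "cstar_algebra D" "cstar_hom A D \<phi>"
    and "finite I" "f \<in> I \<rightarrow> carrier A"
  shows "\<phi> (\<Oplus>\<^bsub>A\<^esub>i\<in>I. f i) = (\<Oplus>\<^bsub>D\<^esub>i\<in>I. \<phi> (f i))"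
proof -
  interpret A: cstar_algebra A by fact
  interpret D: cstar_algebra D by fact
  show ?thesis using assms(4,5)
  proof (induction I rule: finite_induct)
    case empty
    then show ?case using cstar_hom_zero[OF assms(1-3)] by simp
  next
    case (insert i I)
    then have "f i \<in> carrier A" "f \<in> I \<rightarrow> carrier A" by auto
    moreover from this have "(\<lambda>i. \<phi> (f i)) \<in> I \<rightarrow> carrier D"
      using cstar_hom_closed[OF assms(3)] by auto
    ultimately show ?case using insert
      by (simp add: cstar_hom_add[OF assms(3)] cstar_hom_closed[OF assms(3)])
  qed
qed

lemma cstar_hom_minus:
  assumes "cstar_algebra A" "cstar_algebra D" "cstar_hom A D \<phi>" "x \<in> carrier A" "y \<in> carrier A"
  shows "\<phi> (x \<ominus>\<^bsub>A\<^esub> y) = \<phi> x \<ominus>\<^bsub>D\<^esub> \<phi> y"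
proof -
  interpret A: cstar_algebra A by fact
  interpret D: cstar_algebra D by fact
  show ?thesis
    using assms(4,5) cstar_hom_closed[OF assms(3)]
    by (simp add: a_minus_def A.uminus_eq_smult D.uminus_eq_smult
        cstar_hom_add[OF assms(3)] cstar_hom_smult[OF assms(3)])
qed

lemma cstar_subalgebra_finsum:
  assumes "cstar_algebra A" "cstar_subalgebra A T" "finite I" "\<And>i. i \<in> I \<Longrightarrow> f i \<in> T"
  shows "(\<Oplus>\<^bsub>A\<^esub>i\<in>I. f i) \<in> T"
proof -
  interpret A: cstar_algebra A by fact
  have T: "T \<subseteq> carrier A" using assms(2) unfolding cstar_subalgebra_def by blast
  show ?thesis using assms(3,4)
  proof (induction I rule: finite_induct)
    case empty
    then show ?case using assms(2) unfolding cstar_subalgebra_def by simp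
  next
    case (insert i I)
    then have "f i \<in> T" "(\<Oplus>\<^bsub>A\<^esub>i\<in>I. f i) \<in> T" "f \<in> I \<rightarrow> carrier A" "f i \<in> carrier A"
      using T by auto
    then show ?case using insert.hyps assms(2) unfolding cstar_subalgebra_def by simp
  qed
qed

lemma cstar_hom_compose:
  assumes "cstar_hom A D \<phi>" "cstar_hom D F \<chi>"
  shows "cstar_hom A F (\<chi> \<circ> \<phi>)"
  using assms unfolding cstar_hom_def by (auto simp: Pi_iff)

lemma cstar_isomorphic_trans:
  assumes "A \<cong>\<^sub>C D" "D \<cong>\<^sub>C F"
  shows "A \<cong>\<^sub>C F"
  using assms unfolding cstar_isomorphic_def
  by (blast intro: cstar_hom_compose bij_betw_trans)

lemma cstar_isomorphic_sym:
  assumes "cstar_algebra A" "A \<cong>\<^sub>C D"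
  shows "D \<cong>\<^sub>C A"
proof -
  interpret A: cstar_algebra A by fact
  obtain \<phi> where \<phi>: "cstar_hom A D \<phi>" "bij_betw \<phi> (carrier A) (carrier D)"
    using assms(2) unfolding cstar_isomorphic_def by blast
  let ?\<chi> = "inv_into (carrier A) \<phi>"
  have inv: "?\<chi> (\<phi> x) = x" if "x \<in> carrier A" for x
    using that \<phi>(2) by (simp add: bij_betw_inv_into_left)
  have pre: "\<exists>x\<in>carrier A. y = \<phi> x" if "y \<in> carrier D" for y
    using that \<phi>(2) by (auto simp: bij_betw_def)
  have "cstar_hom D A ?\<chi>"
    unfolding cstar_hom_def
  proof (intro conjI ballI allI)
    show "?\<chi> \<in> carrier D \<rightarrow> carrier A" using pre inv by fastforce
  next
    fix y z assume "y \<in> carrier D" "z \<in> carrier D"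
    then obtain u v where *: "u \<in> carrier A" "v \<in> carrier A" "y = \<phi> u" "z = \<phi> v"
      using pre by blast
    show "?\<chi> (y \<oplus>\<^bsub>D\<^esub> z) = ?\<chi> y \<oplus>\<^bsub>A\<^esub> ?\<chi> z"
      using * by (simp add: inv cstar_hom_add[OF \<phi>(1), symmetric])
    show "?\<chi> (y \<otimes>\<^bsub>D\<^esub> z) = ?\<chi> y \<otimes>\<^bsub>A\<^esub> ?\<chi> z"
      using * by (simp add: inv cstar_hom_mult[OF \<phi>(1), symmetric] A.mult_closed)
  next
    fix c y assume "y \<in> carrier D"
    then obtain u where *: "u \<in> carrier A" "y = \<phi> u" using pre by blast
    show "?\<chi> (c \<odot>\<^bsub>D\<^esub> y) = c \<odot>\<^bsub>A\<^esub> ?\<chi> y"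
      using * by (simp add: inv cstar_hom_smult[OF \<phi>(1), symmetric])
    show "?\<chi> (cadjoint D y) = cadjoint A (?\<chi> y)"
      using * by (simp add: inv cstar_hom_adjoint[OF \<phi>(1), symmetric] A.adjoint_closed)
  qed
  then show ?thesis
    unfolding cstar_isomorphic_def using bij_betw_inv_into[OF \<phi>(2)] by blast
qed

section \<open>Block matrix algebras\<close>

text \<open>
  The matrices over \<open>\<Omega>\<close> that vanish off an equivalence relation \<open>R\<close>, that is, block matrices with
  one block for each class. The entry at a pair in \<open>R\<close> is stored at the argument \<open>code (x, y)\<close> of a
  function on \<open>'w\<close>. With words in the generators for \<open>'w\<close>, the algebra becomes one of
  those on which the universal property is tested, so that the property can be applied to it.
\<close>

locale block_matrices =
  fixes \<Omega> :: "'o set" and R :: "('o \<times> 'o) set" and code :: "'o \<times> 'o \<Rightarrow> 'w"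
  assumes finite_index: "finite \<Omega>" and equiv_R: "equiv \<Omega> R" and inj_code: "inj_on code R"
begin

definition entry :: "('w \<Rightarrow> complex) \<Rightarrow> 'o \<Rightarrow> 'o \<Rightarrow> complex" where
  "entry f x y = (if (x, y) \<in> R then f (code (x, y)) else 0)"

definition from_entries :: "('o \<Rightarrow> 'o \<Rightarrow> complex) \<Rightarrow> 'w \<Rightarrow> complex" where
  "from_entries F w = (if w \<in> code ` R then case_prod F (inv_into R code w) else 0)"

definition alg :: "('w \<Rightarrow> complex) cstar" where
  "alg =
     \<lparr>carrier = {f. \<forall>w. w \<notin> code ` R \<longrightarrow> f w = 0},
      monoid.mult = (\<lambda>f g. from_entries (\<lambda>x y. \<Sum>z\<in>\<Omega>. entry f x z * entry g z y)),
      one = from_entries (\<lambda>x y. if x = y then 1 else 0),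
      zero = (\<lambda>w. 0),
      add = (\<lambda>f g w. f w + g w),
      module.smult = (\<lambda>c f w. c * f w),
      cadjoint = (\<lambda>f. from_entries (\<lambda>x y. cnj (entry f y x))),
      cnorm = (\<lambda>f. matrix_opnorm \<Omega> (entry f))\<rparr>"

definition unit :: "'o \<Rightarrow> 'o \<Rightarrow> 'w \<Rightarrow> complex" where
  "unit x y = from_entries (\<lambda>u v. if u = x \<and> v = y then 1 else 0)"

lemma R_in: "(x, y) \<in> R \<Longrightarrow> x \<in> \<Omega> \<and> y \<in> \<Omega>"
  using equiv_R by (auto simp: equiv_def)

lemma R_refl: "x \<in> \<Omega> \<Longrightarrow> (x, x) \<in> R"
  using equiv_R by (auto simp: equiv_def refl_on_def)

lemma R_sym: "(x, y) \<in> R \<Longrightarrow> (y, x) \<in> R"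
  using equiv_R by (auto simp: equiv_def sym_def)

lemma R_trans: "(x, y) \<in> R \<Longrightarrow> (y, z) \<in> R \<Longrightarrow> (x, z) \<in> R"
  using equiv_R unfolding equiv_def trans_def by blast

lemma entry_from_entries: "entry (from_entries F) x y = (if (x, y) \<in> R then F x y else 0)"
  using inj_code by (auto simp: entry_def from_entries_def)

lemma from_entries_closed [simp]: "from_entries F \<in> carrier alg"
  by (simp add: alg_def from_entries_def)

lemma alg_eqI:
  assumes "f \<in> carrier alg" "g \<in> carrier alg" "\<And>x y. (x, y) \<in> R \<Longrightarrow> entry f x y = entry g x y"
  shows "f = g"
proof
  fix w
  show "f w = g w"
  proof (cases "w \<in> code ` R")
    case True
    then obtain x y where "(x, y) \<in> R" "w = code (x, y)" by auto
    then show ?thesis using assms(3)[of x y] by (simp add: entry_def)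
  next
    case False
    then show ?thesis using assms(1,2) by (simp add: alg_def)
  qed
qed

lemma entry_add: "entry (f \<oplus>\<^bsub>alg\<^esub> g) x y = entry f x y + entry g x y"
  by (simp add: alg_def entry_def)

lemma entry_zero: "entry \<zero>\<^bsub>alg\<^esub> x y = 0"
  by (simp add: alg_def entry_def)

lemma entry_smult: "entry (c \<odot>\<^bsub>alg\<^esub> f) x y = c * entry f x y"
  by (simp add: alg_def entry_def)

lemma entry_mult: "entry (f \<otimes>\<^bsub>alg\<^esub> g) x y = (\<Sum>z\<in>\<Omega>. entry f x z * entry g z y)"
proof (cases "(x, y) \<in> R")
  case True
  then show ?thesis by (simp add: alg_def entry_from_entries)
next
  case False
  then have "entry f x z * entry g z y = 0" for z
    using R_trans[of x z y] by (auto simp: entry_def)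
  then show ?thesis using False by (simp add: alg_def entry_from_entries)
qed

lemma entry_adjoint: "entry (cadjoint alg f) x y = cnj (entry f y x)"
proof (cases "(x, y) \<in> R")
  case True
  then show ?thesis by (simp add: alg_def entry_from_entries)
next
  case False
  then have "(y, x) \<notin> R" using R_sym by blast
  with False show ?thesis by (simp add: entry_def)
qed

lemma cnorm_alg: "cnorm alg f = matrix_opnorm \<Omega> (entry f)"
  by (simp add: alg_def)

lemma alg_closed:
  "f \<in> carrier alg \<Longrightarrow> g \<in> carrier alg \<Longrightarrow> f \<oplus>\<^bsub>alg\<^esub> g \<in> carrier alg"
  "\<zero>\<^bsub>alg\<^esub> \<in> carrier alg"
  "f \<in> carrier alg \<Longrightarrow> c \<odot>\<^bsub>alg\<^esub> f \<in> carrier alg"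
  "f \<otimes>\<^bsub>alg\<^esub> g \<in> carrier alg"
  "cadjoint alg f \<in> carrier alg"
  by (auto simp: alg_def from_entries_def)

lemma abelian_group_alg: "abelian_group alg"
proof (rule abelian_groupI)
  fix f assume f: "f \<in> carrier alg"
  have "(\<lambda>w. - f w) \<oplus>\<^bsub>alg\<^esub> f = \<zero>\<^bsub>alg\<^esub>" by (simp add: alg_def)
  then show "\<exists>g\<in>carrier alg. g \<oplus>\<^bsub>alg\<^esub> f = \<zero>\<^bsub>alg\<^esub>"
    using f by (intro bexI[of _ "\<lambda>w. - f w"]) (auto simp: alg_def)
qed (auto simp: alg_def add.assoc add.commute)

lemma minus_alg:
  assumes "f \<in> carrier alg" "g \<in> carrier alg"
  shows "f \<ominus>\<^bsub>alg\<^esub> g = (\<lambda>w. f w - g w)"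
proof -
  interpret abelian_group alg by (rule abelian_group_alg)
  have "\<ominus>\<^bsub>alg\<^esub> g = (\<lambda>w. - g w)"
    using assms by (intro minus_equality) (auto simp: alg_def)
  then show ?thesis by (simp add: a_minus_def) (simp add: alg_def)
qed

lemma entry_minus:
  "f \<in> carrier alg \<Longrightarrow> g \<in> carrier alg \<Longrightarrow> entry (f \<ominus>\<^bsub>alg\<^esub> g) x y = entry f x y - entry g x y"
  by (simp add: minus_alg entry_def)

lemma entry_finsum:
  assumes "finite I" "h \<in> I \<rightarrow> carrier alg"
  shows "entry (\<Oplus>\<^bsub>alg\<^esub>i\<in>I. h i) x y = (\<Sum>i\<in>I. entry (h i) x y)"
proof -
  interpret abelian_group alg by (rule abelian_group_alg)
  show ?thesis using assms
  proof (induction I rule: finite_induct)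
    case (insert i I)
    then have "h i \<in> carrier alg" "h \<in> I \<rightarrow> carrier alg" by auto
    then show ?case using insert by (simp add: entry_add)
  qed (simp add: entry_zero)
qed

text \<open>
  A Cauchy sequence converges in every entry, because entries are bounded by the norm; the entrywise
  limit is a norm limit, because the norm is bounded by the sum of the moduli of the entries.
\<close>

lemma alg_complete:
  assumes f: "range f \<subseteq> carrier alg" and Cauchy: "cstar_Cauchy alg f"
  shows "\<exists>g\<in>carrier alg. cstar_limit alg f g"
proof -
  have fn: "f n \<in> carrier alg" for n using f by auto
  have conv: "convergent (\<lambda>n. entry (f n) x y)" for x y
  proof (cases "(x, y) \<in> R")
    case True
    have "Cauchy (\<lambda>n. entry (f n) x y)"
    proof (rule CauchyI)
      fix e :: real assume "0 < e"
      then obtain N where N: "\<forall>m\<ge>N. \<forall>n\<ge>N. cnorm alg (f m \<ominus>\<^bsub>alg\<^esub> f n) < e"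
        using Cauchy unfolding cstar_Cauchy_def by blast
      have "cmod (entry (f m) x y - entry (f n) x y) < e" if "m \<ge> N" "n \<ge> N" for m n
      proof -
        have "cmod (entry (f m \<ominus>\<^bsub>alg\<^esub> f n) x y) \<le> cnorm alg (f m \<ominus>\<^bsub>alg\<^esub> f n)"
          unfolding cnorm_alg using R_in[OF True]
          by (intro norm_entry_le_matrix_opnorm finite_index) auto
        with N that show ?thesis using entry_minus[OF fn fn] by fastforce
      qed
      then show "\<exists>M. \<forall>m\<ge>M. \<forall>n\<ge>M. cmod (entry (f m) x y - entry (f n) x y) < e" by blast
    qed
    then show ?thesis by (simp add: Cauchy_convergent_iff)
  next
    case False
    then show ?thesis by (simp add: entry_def convergent_const)
  qed
  define g where "g = from_entries (\<lambda>x y. lim (\<lambda>n. entry (f n) x y))"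
  have g: "g \<in> carrier alg" by (simp add: g_def)
  have lim: "(\<lambda>n. entry (f n) x y) \<longlonglongrightarrow> entry g x y" for x y
  proof (cases "(x, y) \<in> R")
    case True
    then show ?thesis using conv[of x y] by (simp add: g_def entry_from_entries convergent_LIMSEQ_iff)
  next
    case False
    then show ?thesis by (simp add: entry_def)
  qed
  have "(\<lambda>n. \<Sum>x\<in>\<Omega>. \<Sum>y\<in>\<Omega>. cmod (entry (f n) x y - entry g x y))
      \<longlonglongrightarrow> (\<Sum>x\<in>\<Omega>. \<Sum>y\<in>\<Omega>. cmod (entry g x y - entry g x y))"
    by (intro tendsto_intros lim)
  then have null: "(\<lambda>n. \<Sum>x\<in>\<Omega>. \<Sum>y\<in>\<Omega>. cmod (entry (f n) x y - entry g x y)) \<longlonglongrightarrow> 0"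
    by simp
  have "cstar_limit alg f g"
    unfolding cstar_limit_def
  proof (rule tendsto_sandwich[OF always_eventually always_eventually tendsto_const null]; intro allI)
    fix n
    show "0 \<le> cnorm alg (f n \<ominus>\<^bsub>alg\<^esub> g)"
      by (simp add: cnorm_alg matrix_opnorm_nonneg finite_index)
    show "cnorm alg (f n \<ominus>\<^bsub>alg\<^esub> g) \<le> (\<Sum>x\<in>\<Omega>. \<Sum>y\<in>\<Omega>. cmod (entry (f n) x y - entry g x y))"
      using matrix_opnorm_le_sum[OF finite_index, of "entry (f n \<ominus>\<^bsub>alg\<^esub> g)"]
      by (simp add: cnorm_alg entry_minus[OF fn g])
  qed
  with g show ?thesis by blast
qed

lemma cstar_algebra_alg: "cstar_algebra alg"
proof (intro cstar_algebra.intro cstar_algebra_axioms.intro)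
  show "module class_ring alg"
  proof (rule moduleI)
    show "cring (class_ring :: complex ring)" by unfold_locales
    show "abelian_group alg" by (rule abelian_group_alg)
  qed (auto simp: alg_def distrib_left distrib_right mult.assoc)
next
  fix f g h assume "f \<in> carrier alg" "g \<in> carrier alg" "h \<in> carrier alg"
  show "f \<otimes>\<^bsub>alg\<^esub> g \<otimes>\<^bsub>alg\<^esub> h = f \<otimes>\<^bsub>alg\<^esub> (g \<otimes>\<^bsub>alg\<^esub> h)"
  proof (rule alg_eqI)
    fix x y
    show "entry (f \<otimes>\<^bsub>alg\<^esub> g \<otimes>\<^bsub>alg\<^esub> h) x y = entry (f \<otimes>\<^bsub>alg\<^esub> (g \<otimes>\<^bsub>alg\<^esub> h)) x y"
      unfolding entry_mult sum_distrib_left sum_distrib_right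
      by (subst sum.swap) (simp add: mult.assoc)
  qed (auto simp: alg_closed)
  show "(f \<oplus>\<^bsub>alg\<^esub> g) \<otimes>\<^bsub>alg\<^esub> h = f \<otimes>\<^bsub>alg\<^esub> h \<oplus>\<^bsub>alg\<^esub> g \<otimes>\<^bsub>alg\<^esub> h"
    by (rule alg_eqI) (auto simp: alg_closed entry_mult entry_add sum.distrib distrib_right)
  show "f \<otimes>\<^bsub>alg\<^esub> (g \<oplus>\<^bsub>alg\<^esub> h) = f \<otimes>\<^bsub>alg\<^esub> g \<oplus>\<^bsub>alg\<^esub> f \<otimes>\<^bsub>alg\<^esub> h"
    by (rule alg_eqI) (auto simp: alg_closed entry_mult entry_add sum.distrib distrib_left)
next
  fix f g c assume fg: "f \<in> carrier alg" "g \<in> carrier alg"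
  show "f \<otimes>\<^bsub>alg\<^esub> g \<in> carrier alg" by (rule alg_closed)
  show "c \<odot>\<^bsub>alg\<^esub> f \<otimes>\<^bsub>alg\<^esub> g = c \<odot>\<^bsub>alg\<^esub> (f \<otimes>\<^bsub>alg\<^esub> g)"
    by (rule alg_eqI) (auto simp: alg_closed entry_mult entry_smult sum_distrib_left mult_ac)
  show "f \<otimes>\<^bsub>alg\<^esub> (c \<odot>\<^bsub>alg\<^esub> g) = c \<odot>\<^bsub>alg\<^esub> (f \<otimes>\<^bsub>alg\<^esub> g)"
    by (rule alg_eqI) (auto simp: alg_closed entry_mult entry_smult sum_distrib_left mult_ac)
  show "cadjoint alg (f \<oplus>\<^bsub>alg\<^esub> g) = cadjoint alg f \<oplus>\<^bsub>alg\<^esub> cadjoint alg g"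
    by (rule alg_eqI) (auto simp: alg_closed entry_adjoint entry_add)
  show "cadjoint alg (f \<otimes>\<^bsub>alg\<^esub> g) = cadjoint alg g \<otimes>\<^bsub>alg\<^esub> cadjoint alg f"
    by (rule alg_eqI) (auto simp: alg_closed entry_adjoint entry_mult mult.commute)
  show "cnorm alg (f \<oplus>\<^bsub>alg\<^esub> g) \<le> cnorm alg f + cnorm alg g"
    using matrix_opnorm_triangle[OF finite_index, of "entry f" "entry g"]
    by (simp add: cnorm_alg entry_add[abs_def])
  show "cnorm alg (f \<otimes>\<^bsub>alg\<^esub> g) \<le> cnorm alg f * cnorm alg g"
    using matrix_opnorm_mult[OF finite_index, of "entry f" "entry g"]
    by (simp add: cnorm_alg entry_mult[abs_def])
next
  fix f c assume f: "f \<in> carrier alg"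
  show "cadjoint alg f \<in> carrier alg" by (rule alg_closed)
  show "cadjoint alg (cadjoint alg f) = f"
    by (rule alg_eqI) (auto simp: alg_closed entry_adjoint f)
  show "cadjoint alg (c \<odot>\<^bsub>alg\<^esub> f) = cnj c \<odot>\<^bsub>alg\<^esub> cadjoint alg f"
    by (rule alg_eqI) (auto simp: alg_closed entry_adjoint entry_smult)
  show "0 \<le> cnorm alg f" by (simp add: cnorm_alg matrix_opnorm_nonneg finite_index)
  show "cnorm alg f = 0 \<longleftrightarrow> f = \<zero>\<^bsub>alg\<^esub>"
  proof
    assume "cnorm alg f = 0"
    then have "\<forall>x\<in>\<Omega>. \<forall>y\<in>\<Omega>. entry f x y = 0"
      by (simp add: cnorm_alg matrix_opnorm_eq_0 finite_index)
    then show "f = \<zero>\<^bsub>alg\<^esub>"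
      using R_in by (intro alg_eqI) (auto simp: f alg_closed entry_zero)
  next
    assume "f = \<zero>\<^bsub>alg\<^esub>"
    then show "cnorm alg f = 0" by (simp add: cnorm_alg matrix_opnorm_eq_0 finite_index entry_zero)
  qed
  show "cnorm alg (c \<odot>\<^bsub>alg\<^esub> f) = cmod c * cnorm alg f"
    using matrix_opnorm_scale[OF finite_index, of c "entry f"]
    by (simp add: cnorm_alg entry_smult[abs_def])
  show "cnorm alg (cadjoint alg f \<otimes>\<^bsub>alg\<^esub> f) = (cnorm alg f)\<^sup>2"
    using matrix_opnorm_cstar[OF finite_index, of "entry f"]
    by (simp add: cnorm_alg entry_mult[abs_def] entry_adjoint[abs_def])
next
  fix f :: "nat \<Rightarrow> 'w \<Rightarrow> complex"
  assume "range f \<subseteq> carrier alg" "cstar_Cauchy alg f"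
  then show "\<exists>g\<in>carrier alg. cstar_limit alg f g" by (rule alg_complete)
qed

lemma entry_unit: "entry (unit x y) u v = (if (x, y) \<in> R \<and> u = x \<and> v = y then 1 else 0)"
  by (auto simp: unit_def entry_from_entries)

lemma unit_closed [simp]: "unit x y \<in> carrier alg"
  by (simp add: unit_def)

text \<open>
  Cutting down by two diagonal units isolates one entry. A homomorphism preserves this identity, and
  so the entries of a matrix can be estimated from its image.
\<close>

lemma compress_eq:
  assumes "(x, y) \<in> R" "f \<in> carrier alg"
  shows "unit x x \<otimes>\<^bsub>alg\<^esub> f \<otimes>\<^bsub>alg\<^esub> unit y y = entry f x y \<odot>\<^bsub>alg\<^esub> unit x y"
proof (rule alg_eqI)
  fix u v
  have xy: "x \<in> \<Omega>" "y \<in> \<Omega>" "(x, x) \<in> R" "(y, y) \<in> R" using R_in[OF assms(1)] R_refl by auto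
  have inner: "(\<Sum>z\<in>\<Omega>. entry (unit x x) u z * entry f z w) = (if u = x then entry f x w else 0)" for w
  proof -
    have "(\<Sum>z\<in>\<Omega>. entry (unit x x) u z * entry f z w)
        = (\<Sum>z\<in>\<Omega>. if z = x then (if u = x then entry f x w else 0) else 0)"
      using xy by (intro sum.cong) (auto simp: entry_unit)
    then show ?thesis using xy finite_index by simp
  qed
  have "(\<Sum>w\<in>\<Omega>. (if u = x then entry f x w else 0) * entry (unit y y) w v)
      = (\<Sum>w\<in>\<Omega>. if w = y then (if u = x \<and> v = y then entry f x y else 0) else 0)"
    using xy by (intro sum.cong) (auto simp: entry_unit)
  also have "\<dots> = (if u = x \<and> v = y then entry f x y else 0)"
    using xy finite_index by simp
  finally have "(\<Sum>w\<in>\<Omega>. (if u = x then entry f x w else 0) * entry (unit y y) w v)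
      = (if u = x \<and> v = y then entry f x y else 0)" .
  then show "entry (unit x x \<otimes>\<^bsub>alg\<^esub> f \<otimes>\<^bsub>alg\<^esub> unit y y) u v = entry (entry f x y \<odot>\<^bsub>alg\<^esub> unit x y) u v"
    unfolding entry_mult inner entry_smult using assms(1) by (simp add: entry_unit)
qed (auto simp: alg_closed)

end

section \<open>Systems of matrix units\<close>

text \<open>
  Elements that multiply like the units of a block matrix algebra. They may be zero, since a
  representation can annihilate whole blocks.
\<close>

locale matrix_units =
  block_matrices \<Omega> R code + cstar_algebra A
  for \<Omega> :: "'o set" and R :: "('o \<times> 'o) set" and code :: "'o \<times> 'o \<Rightarrow> 'w" and A :: "'a cstar" (structure) +
  fixes e :: "'o \<Rightarrow> 'o \<Rightarrow> 'a"
  assumes e_closed: "x \<in> \<Omega> \<Longrightarrow> y \<in> \<Omega> \<Longrightarrow> e x y \<in> carrier A"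
    and e_mult: "(x, y) \<in> R \<Longrightarrow> (z, w) \<in> R \<Longrightarrow> e x y \<otimes> e z w = (if y = z then e x w else \<zero>)"
    and e_adjoint: "(x, y) \<in> R \<Longrightarrow> cadjoint A (e x y) = e y x"
begin

text \<open>
  The linear extension of \<open>unit x y \<mapsto> e x y\<close>; the relations between the \<open>e x y\<close> make it a
  *-homomorphism.
\<close>

definition unit_map :: "('w \<Rightarrow> complex) \<Rightarrow> 'a" where
  "unit_map f = (\<Oplus>x\<in>\<Omega>. \<Oplus>y\<in>\<Omega>. entry f x y \<odot> e x y)"

lemma term_closed: "x \<in> \<Omega> \<Longrightarrow> y \<in> \<Omega> \<Longrightarrow> c \<odot> e x y \<in> carrier A"
  by (simp add: e_closed)

lemma row_closed: "x \<in> \<Omega> \<Longrightarrow> (\<Oplus>y\<in>\<Omega>. c y \<odot> e x y) \<in> carrier A"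
  by (auto intro!: finsum_closed term_closed)

lemma unit_map_closed: "unit_map f \<in> carrier A"
  unfolding unit_map_def by (auto intro!: finsum_closed term_closed)

lemma unit_map_add:
  "unit_map (f \<oplus>\<^bsub>alg\<^esub> g) = unit_map f \<oplus> unit_map g"
proof -
  have "unit_map (f \<oplus>\<^bsub>alg\<^esub> g)
      = (\<Oplus>x\<in>\<Omega>. (\<Oplus>y\<in>\<Omega>. entry f x y \<odot> e x y) \<oplus> (\<Oplus>y\<in>\<Omega>. entry g x y \<odot> e x y))"
    unfolding unit_map_def
  proof (rule M.finsum_cong'[OF refl])
    fix x assume x: "x \<in> \<Omega>"
    have "(\<Oplus>y\<in>\<Omega>. entry (f \<oplus>\<^bsub>alg\<^esub> g) x y \<odot> e x y)
        = (\<Oplus>y\<in>\<Omega>. entry f x y \<odot> e x y \<oplus> entry g x y \<odot> e x y)"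
      using x smult_l_distr[of _ _ "e x _"] e_closed
      by (intro M.finsum_cong'[OF refl]) (auto simp: entry_add)
    also have "\<dots> = (\<Oplus>y\<in>\<Omega>. entry f x y \<odot> e x y) \<oplus> (\<Oplus>y\<in>\<Omega>. entry g x y \<odot> e x y)"
      using x by (intro finsum_addf) (auto simp: term_closed)
    finally show "(\<Oplus>y\<in>\<Omega>. entry (f \<oplus>\<^bsub>alg\<^esub> g) x y \<odot> e x y) = \<dots>" .
  qed (auto intro!: row_closed)
  also have "\<dots> = unit_map f \<oplus> unit_map g"
    unfolding unit_map_def by (intro finsum_addf) (auto intro!: row_closed)
  finally show ?thesis .
qed

lemma unit_map_smult: "unit_map (c \<odot>\<^bsub>alg\<^esub> f) = c \<odot> unit_map f"
proof -
  have "c \<odot> unit_map f = (\<Oplus>x\<in>\<Omega>. c \<odot> (\<Oplus>y\<in>\<Omega>. entry f x y \<odot> e x y))"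
    unfolding unit_map_def by (intro finsum_smult_right finite_index) (auto intro!: row_closed)
  also have "\<dots> = unit_map (c \<odot>\<^bsub>alg\<^esub> f)"
    unfolding unit_map_def
  proof (rule M.finsum_cong'[OF refl])
    fix x assume x: "x \<in> \<Omega>"
    have "c \<odot> (\<Oplus>y\<in>\<Omega>. entry f x y \<odot> e x y) = (\<Oplus>y\<in>\<Omega>. c \<odot> (entry f x y \<odot> e x y))"
      using x by (intro finsum_smult_right finite_index) (auto simp: term_closed)
    also have "\<dots> = (\<Oplus>y\<in>\<Omega>. entry (c \<odot>\<^bsub>alg\<^esub> f) x y \<odot> e x y)"
      using x smult_assoc1[of _ _ "e x _"] e_closed
      by (intro M.finsum_cong'[OF refl]) (auto simp: entry_smult)
    finally show "c \<odot> (\<Oplus>y\<in>\<Omega>. entry f x y \<odot> e x y) = \<dots>" .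
  qed (auto intro!: row_closed)
  finally show ?thesis by simp
qed

lemma unit_map_adjoint: "unit_map (cadjoint alg f) = cadjoint A (unit_map f)"
proof -
  have "cadjoint A (unit_map f) = (\<Oplus>x\<in>\<Omega>. cadjoint A (\<Oplus>y\<in>\<Omega>. entry f x y \<odot> e x y))"
    unfolding unit_map_def by (intro finsum_adjoint finite_index) (auto intro!: row_closed)
  also have "\<dots> = (\<Oplus>x\<in>\<Omega>. \<Oplus>y\<in>\<Omega>. entry (cadjoint alg f) y x \<odot> e y x)"
  proof (rule M.finsum_cong'[OF refl])
    fix x assume x: "x \<in> \<Omega>"
    have "cadjoint A (\<Oplus>y\<in>\<Omega>. entry f x y \<odot> e x y) = (\<Oplus>y\<in>\<Omega>. cadjoint A (entry f x y \<odot> e x y))"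
      using x by (intro finsum_adjoint finite_index) (auto simp: term_closed)
    also have "\<dots> = (\<Oplus>y\<in>\<Omega>. entry (cadjoint alg f) y x \<odot> e y x)"
    proof (rule M.finsum_cong'[OF refl])
      fix y assume y: "y \<in> \<Omega>"
      show "cadjoint A (entry f x y \<odot> e x y) = entry (cadjoint alg f) y x \<odot> e y x"
      proof (cases "(x, y) \<in> R")
        case True
        then show ?thesis using x y by (simp add: adjoint_smult e_closed e_adjoint entry_adjoint)
      next
        case False
        then show ?thesis
          using x y e_closed smult_l_null by (simp add: entry_adjoint) (simp add: entry_def)
      qed
    qed (use x term_closed in auto)
    finally show "cadjoint A (\<Oplus>y\<in>\<Omega>. entry f x y \<odot> e x y) = \<dots>" .
  qed (auto intro!: finsum_closed term_closed)
  also have "\<dots> = unit_map (cadjoint alg f)"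
    unfolding unit_map_def by (intro finsum_swap finite_index) (auto intro!: term_closed)
  finally show ?thesis by simp
qed

text \<open>
  For pairs off \<open>R\<close> nothing is known about the product of the two units, but then one of the coefficients
  vanishes.
\<close>

lemma term_mult:
  assumes "x \<in> \<Omega>" "y \<in> \<Omega>" "z \<in> \<Omega>" "w \<in> \<Omega>"
  shows "(entry f x y \<odot> e x y) \<otimes> (entry g z w \<odot> e z w)
       = (if y = z then (entry f x y * entry g y w) \<odot> e x w else \<zero>)"
proof -
  have "(entry f x y \<odot> e x y) \<otimes> (entry g z w \<odot> e z w)
      = (entry f x y * entry g z w) \<odot> (e x y \<otimes> e z w)"
    using assms smult_assoc1[of "entry g z w" "entry f x y" "e x y \<otimes> e z w"]
    by (simp add: smult_mult_left smult_mult_right e_closed mult_closed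
        mult.commute[of "entry f x y" "entry g z w"])
  also have "\<dots> = (if y = z then (entry f x y * entry g y w) \<odot> e x w else \<zero>)"
  proof (cases "(x, y) \<in> R \<and> (z, w) \<in> R")
    case True
    then show ?thesis using smult_r_null by (auto simp: e_mult)
  next
    case False
    then have "entry f x y * entry g z w = 0" by (auto simp: entry_def)
    then show ?thesis using assms smult_l_null by (auto simp: mult_closed e_closed)
  qed
  finally show ?thesis .
qed

lemma term_mult_unit_map:
  assumes x: "x \<in> \<Omega>" and y: "y \<in> \<Omega>"
  shows "(entry f x y \<odot> e x y) \<otimes> unit_map g = (\<Oplus>w\<in>\<Omega>. (entry f x y * entry g y w) \<odot> e x w)"
proof -
  have "(entry f x y \<odot> e x y) \<otimes> unit_map g
      = (\<Oplus>z\<in>\<Omega>. (entry f x y \<odot> e x y) \<otimes> (\<Oplus>w\<in>\<Omega>. entry g z w \<odot> e z w))"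
    unfolding unit_map_def
    using x y by (intro finsum_mult_left finite_index term_closed) (auto intro!: row_closed)
  also have "\<dots> = (\<Oplus>z\<in>\<Omega>. if y = z then (\<Oplus>w\<in>\<Omega>. (entry f x y * entry g y w) \<odot> e x w) else \<zero>)"
  proof (rule M.finsum_cong'[OF refl])
    fix z assume z: "z \<in> \<Omega>"
    have "(entry f x y \<odot> e x y) \<otimes> (\<Oplus>w\<in>\<Omega>. entry g z w \<odot> e z w)
        = (\<Oplus>w\<in>\<Omega>. (entry f x y \<odot> e x y) \<otimes> (entry g z w \<odot> e z w))"
      using x y z by (intro finsum_mult_left finite_index) (auto intro!: term_closed)
    also have "\<dots> = (\<Oplus>w\<in>\<Omega>. if y = z then (entry f x y * entry g y w) \<odot> e x w else \<zero>)"
      using x y z by (intro M.finsum_cong'[OF refl]) (auto simp: term_mult term_closed)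
    also have "\<dots> = (if y = z then (\<Oplus>w\<in>\<Omega>. (entry f x y * entry g y w) \<odot> e x w) else \<zero>)"
      by simp
    finally show "(entry f x y \<odot> e x y) \<otimes> (\<Oplus>w\<in>\<Omega>. entry g z w \<odot> e z w) = \<dots>" .
  qed (use x in \<open>auto intro!: row_closed\<close>)
  also have "\<dots> = (\<Oplus>w\<in>\<Omega>. (entry f x y * entry g y w) \<odot> e x w)"
    using finsum_singleton[OF y finite_index, of "\<lambda>_. \<Oplus>w\<in>\<Omega>. (entry f x y * entry g y w) \<odot> e x w"] x
    by (simp add: row_closed)
  finally show ?thesis .
qed

text \<open>
  Expanding both factors gives a fourfold sum. The relation \<open>e x y \<otimes> e z w = 0\<close> for \<open>y \<noteq> z\<close> removes one
  index, and exchanging the two inner sums produces the entries of the matrix product.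
\<close>

lemma unit_map_mult: "unit_map (f \<otimes>\<^bsub>alg\<^esub> g) = unit_map f \<otimes> unit_map g"
proof -
  have "unit_map f \<otimes> unit_map g = (\<Oplus>x\<in>\<Omega>. (\<Oplus>y\<in>\<Omega>. entry f x y \<odot> e x y) \<otimes> unit_map g)"
    by (subst unit_map_def)
      (intro finsum_mult_right finite_index unit_map_closed, auto intro!: row_closed)
  also have "\<dots> = unit_map (f \<otimes>\<^bsub>alg\<^esub> g)"
    unfolding unit_map_def[of "f \<otimes>\<^bsub>alg\<^esub> g"]
  proof (rule M.finsum_cong'[OF refl])
    fix x assume x: "x \<in> \<Omega>"
    have "(\<Oplus>y\<in>\<Omega>. entry f x y \<odot> e x y) \<otimes> unit_map g
        = (\<Oplus>y\<in>\<Omega>. (entry f x y \<odot> e x y) \<otimes> unit_map g)"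
      using x by (intro finsum_mult_right finite_index unit_map_closed) (auto intro!: term_closed)
    also have "\<dots> = (\<Oplus>y\<in>\<Omega>. \<Oplus>w\<in>\<Omega>. (entry f x y * entry g y w) \<odot> e x w)"
      using x by (intro M.finsum_cong'[OF refl]) (auto simp: term_mult_unit_map intro!: row_closed)
    also have "\<dots> = (\<Oplus>w\<in>\<Omega>. \<Oplus>y\<in>\<Omega>. (entry f x y * entry g y w) \<odot> e x w)"
      by (rule finsum_swap[OF finite_index finite_index]) (rule term_closed[OF x])
    also have "\<dots> = (\<Oplus>w\<in>\<Omega>. entry (f \<otimes>\<^bsub>alg\<^esub> g) x w \<odot> e x w)"
      using x by (intro M.finsum_cong'[OF refl])
        (simp_all add: entry_mult finsum_smult_left[OF finite_index] e_closed)
    finally show "(\<Oplus>y\<in>\<Omega>. entry f x y \<odot> e x y) \<otimes> unit_map g = \<dots>" .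
  qed (auto intro!: row_closed)
  finally show ?thesis by simp
qed

lemma unit_map_hom: "cstar_hom alg A unit_map"
  unfolding cstar_hom_def
  by (simp add: unit_map_closed unit_map_add unit_map_mult unit_map_smult unit_map_adjoint)

lemma unit_map_unit:
  assumes "(x, y) \<in> R"
  shows "unit_map (unit x y) = e x y"
proof -
  have xy: "x \<in> \<Omega>" "y \<in> \<Omega>" using R_in[OF assms] by auto
  have "unit_map (unit x y) = (\<Oplus>u\<in>\<Omega>. if x = u then e x y else \<zero>)"
    unfolding unit_map_def
  proof (rule M.finsum_cong'[OF refl])
    fix u assume u: "u \<in> \<Omega>"
    have "(\<Oplus>v\<in>\<Omega>. entry (unit x y) u v \<odot> e u v)
        = (\<Oplus>v\<in>\<Omega>. if y = v then (if x = u then e x y else \<zero>) else \<zero>)"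
      using assms u xy smult_l_null e_closed smult_one
      by (intro M.finsum_cong'[OF refl]) (auto simp: entry_unit)
    also have "\<dots> = (if x = u then e x y else \<zero>)"
      using finsum_singleton[OF xy(2) finite_index, of "\<lambda>_. e x y"] xy
      by (cases "x = u") (simp_all add: e_closed)
    finally show "(\<Oplus>v\<in>\<Omega>. entry (unit x y) u v \<odot> e u v) = \<dots>" .
  qed (use xy e_closed in auto)
  also have "\<dots> = e x y"
    using finsum_singleton[OF xy(1) finite_index, of "\<lambda>_. e x y"] xy by (simp add: e_closed)
  finally show ?thesis .
qed

lemma unit_map_sum_units:
  assumes "finite I" "\<And>i. i \<in> I \<Longrightarrow> (a i, b i) \<in> R"
    and "f = (\<Oplus>\<^bsub>alg\<^esub>i\<in>I. unit (a i) (b i))"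
  shows "unit_map f = (\<Oplus>i\<in>I. e (a i) (b i))"
proof -
  have "unit_map f = (\<Oplus>i\<in>I. unit_map (unit (a i) (b i)))"
    unfolding assms(3)
    by (rule cstar_hom_finsum[OF cstar_algebra_alg cstar_algebra_axioms unit_map_hom assms(1)]) simp
  also have "\<dots> = (\<Oplus>i\<in>I. e (a i) (b i))"
    using assms(2) R_in by (intro M.finsum_cong'[OF refl]) (auto simp: unit_map_unit intro!: e_closed)
  finally show ?thesis .
qed

lemma entry_bound:
  assumes "(x, y) \<in> R" "f \<in> carrier alg"
  shows "cmod (entry f x y) * cnorm A (e x y) \<le> cnorm A (e x x) * cnorm A (e y y) * cnorm A (unit_map f)"
proof -
  have xy: "x \<in> \<Omega>" "y \<in> \<Omega>" "(x, x) \<in> R" "(y, y) \<in> R" using R_in[OF assms(1)] R_refl by auto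
  have closed: "e x x \<in> carrier A" "e y y \<in> carrier A" "e x y \<in> carrier A" using xy e_closed by auto
  have "unit_map (unit x x \<otimes>\<^bsub>alg\<^esub> f \<otimes>\<^bsub>alg\<^esub> unit y y) = unit_map (entry f x y \<odot>\<^bsub>alg\<^esub> unit x y)"
    by (simp only: compress_eq[OF assms])
  then have "e x x \<otimes> unit_map f \<otimes> e y y = entry f x y \<odot> e x y"
    using xy assms(1) by (simp add: unit_map_mult unit_map_smult unit_map_unit)
  then have "cmod (entry f x y) * cnorm A (e x y) = cnorm A (e x x \<otimes> unit_map f \<otimes> e y y)"
    using closed by (simp add: cnorm_smult)
  also have "\<dots> \<le> cnorm A (e x x \<otimes> unit_map f) * cnorm A (e y y)"
    using closed unit_map_closed by (intro cnorm_mult mult_closed)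
  also have "\<dots> \<le> (cnorm A (e x x) * cnorm A (unit_map f)) * cnorm A (e y y)"
    using closed unit_map_closed by (intro mult_right_mono cnorm_mult cnorm_nonneg)
  finally show ?thesis by (simp add: mult_ac)
qed

text \<open>
  In particular the homomorphism is injective. The explicit constant comes from estimating each entry
  separately by compression to the corresponding pair of diagonal units.
\<close>

lemma unit_map_bounded_below:
  assumes nonzero: "\<And>x y. (x, y) \<in> R \<Longrightarrow> e x y \<noteq> \<zero>"
  obtains K where "K \<ge> 0" "\<And>f. f \<in> carrier alg \<Longrightarrow> cnorm alg f \<le> K * cnorm A (unit_map f)"
proof
  let ?k = "\<lambda>x y. if (x, y) \<in> R then cnorm A (e x x) * cnorm A (e y y) / cnorm A (e x y) else 0"
  have pos: "0 < cnorm A (e x y)" if "(x, y) \<in> R" for x y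
    using nonzero[OF that] R_in[OF that] e_closed[of x y] cnorm_nonneg[of "e x y"] cnorm_eq_0[of "e x y"]
    by auto
  have nonneg: "0 \<le> ?k x y" for x y
    using R_in[of x y] pos[of x y] e_closed cnorm_nonneg by auto
  show "0 \<le> (\<Sum>x\<in>\<Omega>. \<Sum>y\<in>\<Omega>. ?k x y)" by (intro sum_nonneg nonneg)
  fix f assume f: "f \<in> carrier alg"
  have "cnorm alg f \<le> (\<Sum>x\<in>\<Omega>. \<Sum>y\<in>\<Omega>. cmod (entry f x y))"
    unfolding cnorm_alg by (rule matrix_opnorm_le_sum[OF finite_index])
  also have "\<dots> \<le> (\<Sum>x\<in>\<Omega>. \<Sum>y\<in>\<Omega>. ?k x y * cnorm A (unit_map f))"
  proof (intro sum_mono)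
    fix x y
    show "cmod (entry f x y) \<le> ?k x y * cnorm A (unit_map f)"
    proof (cases "(x, y) \<in> R")
      case True
      then show ?thesis using entry_bound[OF True f] pos[OF True] by (simp add: field_simps)
    next
      case False
      then show ?thesis by (simp add: entry_def)
    qed
  qed
  also have "\<dots> = (\<Sum>x\<in>\<Omega>. \<Sum>y\<in>\<Omega>. ?k x y) * cnorm A (unit_map f)"
    by (simp only: sum_distrib_right)
  finally show "cnorm alg f \<le> (\<Sum>x\<in>\<Omega>. \<Sum>y\<in>\<Omega>. ?k x y) * cnorm A (unit_map f)" .
qed

lemma unit_map_bounded:
  "cnorm A (unit_map f) \<le> (\<Sum>x\<in>\<Omega>. \<Sum>y\<in>\<Omega>. cnorm A (e x y)) * cnorm alg f"
proof -
  have "cnorm A (unit_map f) \<le> (\<Sum>x\<in>\<Omega>. cnorm A (\<Oplus>y\<in>\<Omega>. entry f x y \<odot> e x y))"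
    unfolding unit_map_def by (intro cnorm_finsum_le finite_index) (auto intro!: row_closed)
  also have "\<dots> \<le> (\<Sum>x\<in>\<Omega>. \<Sum>y\<in>\<Omega>. cnorm A (entry f x y \<odot> e x y))"
    by (intro sum_mono cnorm_finsum_le finite_index) (auto intro!: term_closed)
  also have "\<dots> \<le> (\<Sum>x\<in>\<Omega>. \<Sum>y\<in>\<Omega>. cnorm A (e x y) * cnorm alg f)"
  proof (intro sum_mono)
    fix x y assume "x \<in> \<Omega>" "y \<in> \<Omega>"
    then show "cnorm A (entry f x y \<odot> e x y) \<le> cnorm A (e x y) * cnorm alg f"
      using norm_entry_le_matrix_opnorm[OF finite_index, of x y "entry f"] e_closed cnorm_nonneg
      by (simp add: cnorm_smult cnorm_alg mult.commute mult_left_mono)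
  qed
  finally show ?thesis by (simp only: sum_distrib_right)
qed

text \<open>
  The point is closedness under limits. If the images of matrices \<open>g n\<close> converge, then by
  the lower bound the \<open>g n\<close> form a Cauchy sequence, and the image of its limit is the limit of the images.
\<close>

lemma range_unit_map_subalgebra:
  assumes "\<And>x y. (x, y) \<in> R \<Longrightarrow> e x y \<noteq> \<zero>"
  shows "cstar_subalgebra A (unit_map ` carrier alg)"
  unfolding cstar_subalgebra_def
proof (intro conjI ballI allI impI)
  interpret alg: cstar_algebra alg by (rule cstar_algebra_alg)
  let ?T = "unit_map ` carrier alg"
  show "?T \<subseteq> carrier A" using unit_map_closed by blast
  show "\<zero> \<in> ?T"
    using cstar_hom_zero[OF cstar_algebra_alg cstar_algebra_axioms unit_map_hom] alg.zero_closed
    by (metis imageI)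
  fix u assume "u \<in> ?T"
  then obtain f where f: "f \<in> carrier alg" "u = unit_map f" by blast
  show "cadjoint A u \<in> ?T"
    using f by (auto simp: unit_map_adjoint[symmetric] alg.adjoint_closed)
  show "c \<odot> u \<in> ?T" for c
    using f by (auto simp: unit_map_smult[symmetric])
  fix v assume "v \<in> ?T"
  then obtain g where g: "g \<in> carrier alg" "v = unit_map g" by blast
  show "u \<oplus> v \<in> ?T" using f g by (auto simp: unit_map_add[symmetric])
  show "u \<otimes> v \<in> ?T" using f g by (auto simp: unit_map_mult[symmetric] alg.mult_closed)
next
  interpret alg: cstar_algebra alg by (rule cstar_algebra_alg)
  fix h x assume x: "x \<in> carrier A" and "range h \<subseteq> unit_map ` carrier alg \<and> cstar_limit A h x"
  then have h: "\<And>n. h n \<in> unit_map ` carrier alg" and lim: "cstar_limit A h x" by auto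
  from h have "\<forall>n. \<exists>f. f \<in> carrier alg \<and> h n = unit_map f" by blast
  then obtain g where g: "\<And>n. g n \<in> carrier alg" "\<And>n. h n = unit_map (g n)" by metis
  have hA: "range h \<subseteq> carrier A" using g unit_map_closed by auto
  have minus: "unit_map (f1 \<ominus>\<^bsub>alg\<^esub> f2) = unit_map f1 \<ominus> unit_map f2"
    if "f1 \<in> carrier alg" "f2 \<in> carrier alg" for f1 f2
    by (rule cstar_hom_minus[OF cstar_algebra_alg cstar_algebra_axioms unit_map_hom that])
  obtain K where K: "K \<ge> 0" "\<And>f. f \<in> carrier alg \<Longrightarrow> cnorm alg f \<le> K * cnorm A (unit_map f)"
    by (rule unit_map_bounded_below[OF assms]) blast+
  have "cstar_Cauchy alg g"
    unfolding cstar_Cauchy_def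
  proof (intro allI impI)
    fix r :: real assume r: "0 < r"
    \<comment> \<open>\<open>K\<close> may be 0, for instance if \<open>\<Omega>\<close> is empty, hence \<open>K + 1\<close>\<close>
    then have "0 < r / (K + 1)" using K(1) by simp
    with cstar_limit_imp_Cauchy[OF lim hA x] obtain N where
      N: "\<forall>m\<ge>N. \<forall>n\<ge>N. cnorm A (h m \<ominus> h n) < r / (K + 1)"
      unfolding cstar_Cauchy_def by blast
    have "cnorm alg (g m \<ominus>\<^bsub>alg\<^esub> g n) < r" if "m \<ge> N" "n \<ge> N" for m n
    proof -
      have "cnorm alg (g m \<ominus>\<^bsub>alg\<^esub> g n) \<le> K * cnorm A (h m \<ominus> h n)"
        using K(2)[of "g m \<ominus>\<^bsub>alg\<^esub> g n"] g by (simp add: minus)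
      also have "\<dots> \<le> K * (r / (K + 1))"
        by (rule mult_left_mono[OF _ K(1)]) (use N that in \<open>simp add: less_imp_le\<close>)
      also have "\<dots> < r" using K(1) r by (simp add: field_simps)
      finally show ?thesis .
    qed
    then show "\<exists>N. \<forall>m\<ge>N. \<forall>n\<ge>N. cnorm alg (g m \<ominus>\<^bsub>alg\<^esub> g n) < r" by blast
  qed
  then obtain f where f: "f \<in> carrier alg" "cstar_limit alg g f"
    using alg.complete[of g] g(1) by blast
  let ?M = "\<Sum>x\<in>\<Omega>. \<Sum>y\<in>\<Omega>. cnorm A (e x y)"
  have "cstar_limit A h (unit_map f)"
    unfolding cstar_limit_def
  proof (rule tendsto_sandwich[OF always_eventually always_eventually tendsto_const]; (intro allI)?)
    fix n
    show "0 \<le> cnorm A (h n \<ominus> unit_map f)"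
      using g unit_map_closed by (intro cnorm_nonneg) auto
    show "cnorm A (h n \<ominus> unit_map f) \<le> ?M * cnorm alg (g n \<ominus>\<^bsub>alg\<^esub> f)"
      using unit_map_bounded[of "g n \<ominus>\<^bsub>alg\<^esub> f"] minus[OF g(1) f(1), of n] g(2)[of n] by simp
  next
    show "(\<lambda>n. ?M * cnorm alg (g n \<ominus>\<^bsub>alg\<^esub> f)) \<longlonglongrightarrow> 0"
      using tendsto_mult_right_zero[OF f(2)[unfolded cstar_limit_def]] by simp
  qed
  then have "x = unit_map f"
    by (rule cstar_limit_unique[OF lim _ hA x unit_map_closed])
  then show "x \<in> unit_map ` carrier alg" using f(1) by blast
qed

end

section \<open>Words and generalized sinks of an acyclic labeled space\<close>

locale acyclic_labeled_space =
  fixes E :: "('v, 'e) pre_digraph" and L :: "'e \<Rightarrow> 'l" and B :: "'v set set"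
  assumes fin_digraph: "fin_digraph E"
    and acyclic: "\<not> (\<exists>u p. p \<noteq> [] \<and> pre_digraph.awalk E u p u)"
    and normal: "normal_labeled_space E L B"
    and left_resolving: "weakly_left_resolving E L B"
    and sinks_in_B: "sinks E \<in> B"
begin

sublocale fin_digraph E by (rule fin_digraph)

abbreviation "rr \<equiv> rel_range E L"
abbreviation "wr \<equiv> word_range E L"

lemma rel_rangeI: "u \<in> X \<Longrightarrow> awalk u p v \<Longrightarrow> map L p = \<alpha> \<Longrightarrow> v \<in> rr X \<alpha>"
  by (auto simp: rel_range_def)

lemma rel_rangeE:
  assumes "v \<in> rr X \<alpha>"
  obtains u p where "u \<in> X" "awalk u p v" "map L p = \<alpha>"
  using assms by (auto simp: rel_range_def)

lemma rel_range_Nil: "X \<subseteq> verts E \<Longrightarrow> rr X [] = X"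
  unfolding rel_range_def by (auto simp: awalk_Nil_iff)

lemma rel_range_Cons: "rr X (a # \<alpha>) = rr (rr X [a]) \<alpha>"
proof (rule equalityI; rule subsetI)
  fix v assume "v \<in> rr X (a # \<alpha>)"
  then obtain u p where u: "u \<in> X" "awalk u p v" "map L p = a # \<alpha>" by (rule rel_rangeE)
  then obtain e q where p: "p = e # q" "L e = a" "map L q = \<alpha>" by (cases p) auto
  with u(2) have e: "u = tail E e" "e \<in> arcs E" "awalk (head E e) q v"
    by (auto simp: awalk_Cons_iff)
  then have "awalk u [e] (head E e)" by (simp add: awalk_Cons_iff awalk_Nil_iff)
  then have "head E e \<in> rr X [a]" using u(1) p(2) by (intro rel_rangeI) auto
  then show "v \<in> rr (rr X [a]) \<alpha>" using e(3) p(3) by (rule rel_rangeI)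
next
  fix v assume "v \<in> rr (rr X [a]) \<alpha>"
  then obtain w q where q: "w \<in> rr X [a]" "awalk w q v" "map L q = \<alpha>" by (rule rel_rangeE)
  from q(1) obtain u p where p: "u \<in> X" "awalk u p w" "map L p = [a]" by (rule rel_rangeE)
  have "awalk u (p @ q) v" by (rule awalk_appendI[OF p(2) q(2)])
  then show "v \<in> rr X (a # \<alpha>)" using p(3) q(3) by (intro rel_rangeI[OF p(1), of "p @ q"]) auto
qed

lemma word_range_conv: "wr \<alpha> = rr (verts E) \<alpha>"
  unfolding word_range_def rel_range_def using awalk_hd_in_verts by blast

lemma word_range_Cons: "wr (a # \<alpha>) = rr (wr [a]) \<alpha>"
  unfolding word_range_conv by (rule rel_range_Cons)

lemma rel_range_mono: "X \<subseteq> Y \<Longrightarrow> rr X \<alpha> \<subseteq> rr Y \<alpha>"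
  unfolding rel_range_def by blast

lemma rel_range_subset_word_range: "rr X \<alpha> \<subseteq> wr \<alpha>"
  unfolding rel_range_def word_range_def by blast

lemma rel_range_Un: "rr (X \<union> Y) \<alpha> = rr X \<alpha> \<union> rr Y \<alpha>"
  unfolding rel_range_def by blast

lemma rel_range_empty [simp]: "rr {} \<alpha> = {}"
  unfolding rel_range_def by blast

lemma word_range_Cons_subset: "wr (a # \<alpha>) \<subseteq> wr \<alpha>"
  by (subst word_range_Cons) (rule rel_range_subset_word_range)

lemma labeled_words_iff: "\<alpha> \<in> labeled_words E L \<longleftrightarrow> \<alpha> \<noteq> [] \<and> wr \<alpha> \<noteq> {}"
  unfolding labeled_words_def word_range_def by auto

lemma set_subset_alphabet:
  assumes "wr \<alpha> \<noteq> {}"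
  shows "set \<alpha> \<subseteq> alphabet E L"
  using assms unfolding word_range_def alphabet_def by (fastforce simp: awalk_def)

lemma singleton_word_range: "a \<in> alphabet E L \<Longrightarrow> wr [a] \<noteq> {}"
proof -
  assume "a \<in> alphabet E L"
  then obtain e where e: "e \<in> arcs E" "a = L e" unfolding alphabet_def by blast
  then have "awalk (tail E e) [e] (head E e)" by (simp add: awalk_Cons_iff awalk_Nil_iff)
  then show ?thesis unfolding word_range_def using e(2) by force
qed

lemma B_subset_verts: "X \<in> B \<Longrightarrow> X \<subseteq> verts E"
  using normal unfolding normal_labeled_space_def accommodating_def by auto

lemma B_Int: "X \<in> B \<Longrightarrow> Y \<in> B \<Longrightarrow> X \<inter> Y \<in> B"
  using normal unfolding normal_labeled_space_def accommodating_def by blast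

lemma B_Un: "X \<in> B \<Longrightarrow> Y \<in> B \<Longrightarrow> X \<union> Y \<in> B"
  using normal unfolding normal_labeled_space_def accommodating_def by blast

lemma B_Diff: "X \<in> B \<Longrightarrow> Y \<in> B \<Longrightarrow> X - Y \<in> B"
  using normal unfolding normal_labeled_space_def by blast

lemma B_empty: "{} \<in> B"
  using B_Diff[OF sinks_in_B sinks_in_B] by simp

text \<open>
  The defining closure property concerns only words that label a path. The empty word gives \<open>X\<close>
  itself, and a word that labels no path gives the empty set, which is a relative complement.
\<close>

lemma rel_range_in_B:
  assumes "X \<in> B"
  shows "rr X \<alpha> \<in> B"
proof (cases "\<alpha> \<in> labeled_words E L")
  case True
  with assms normal show ?thesis
    unfolding normal_labeled_space_def accommodating_def by blast
next
  case False
  then have "\<alpha> = [] \<or> rr X \<alpha> = {}"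
    using rel_range_subset_word_range[of X \<alpha>] by (auto simp: labeled_words_iff)
  then show ?thesis using assms rel_range_Nil[OF B_subset_verts] B_empty by auto
qed

lemma word_range_in_B: "a \<in> alphabet E L \<Longrightarrow> wr [a] \<in> B"
  using normal singleton_word_range[of a] labeled_words_iff[of "[a]"]
  unfolding normal_labeled_space_def accommodating_def by blast

lemma rel_range_Int:
  assumes "X \<in> B" "Y \<in> B"
  shows "rr (X \<inter> Y) \<alpha> = rr X \<alpha> \<inter> rr Y \<alpha>"
proof (cases "\<alpha> \<in> labeled_words E L")
  case True
  with assms left_resolving show ?thesis unfolding weakly_left_resolving_def by blast
next
  case False
  then consider "\<alpha> = []" | "wr \<alpha> = {}" by (auto simp: labeled_words_iff)
  then show ?thesis
  proof cases
    case 1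
    then show ?thesis using B_subset_verts assms B_Int by (simp add: rel_range_Nil)
  next
    case 2
    then show ?thesis using rel_range_subset_word_range[of _ \<alpha>] by blast
  qed
qed

lemma rel_range_sinks: "X \<subseteq> sinks E \<Longrightarrow> rr X (a # \<alpha>) = {}"
  unfolding rel_range_def sinks_def by (fastforce simp: awalk_Cons_iff)

lemma out_labels_iff: "a \<in> out_labels E L X \<longleftrightarrow> rr X [a] \<noteq> {}"
proof
  assume "a \<in> out_labels E L X"
  then obtain e where e: "e \<in> arcs E" "a = L e" "tail E e \<in> X" unfolding out_labels_def by blast
  then have "awalk (tail E e) [e] (head E e)" by (simp add: awalk_Cons_iff awalk_Nil_iff)
  then show "rr X [a] \<noteq> {}" unfolding rel_range_def using e by force
next
  assume "rr X [a] \<noteq> {}"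
  then show "a \<in> out_labels E L X"
    unfolding rel_range_def out_labels_def by (auto simp: awalk_Cons_iff)
qed

lemma finite_out_labels: "finite (out_labels E L X)"
  unfolding out_labels_def using finite_arcs by simp

lemma out_labels_subset: "out_labels E L X \<subseteq> alphabet E L"
  unfolding out_labels_def alphabet_def by blast

text \<open>
  A walk that visits a vertex twice contains a cycle. Hence every walk is a path without
  repeated vertices, and a finite digraph has only finitely many of these.
\<close>

lemma finite_words: "finite {\<alpha>. wr \<alpha> \<noteq> {}}"
proof -
  have "{\<alpha>. wr \<alpha> \<noteq> {}} \<subseteq> (\<lambda>(u, p, v). map L p) ` {(u, p, v). apath u p v}"
  proof
    fix \<alpha> assume "\<alpha> \<in> {\<alpha>. wr \<alpha> \<noteq> {}}"
    then obtain u p v where p: "awalk u p v" "map L p = \<alpha>" unfolding word_range_def by blast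
    have "apath u p v"
    proof (rule ccontr)
      assume "\<not> apath u p v"
      then have "\<not> distinct (awalk_verts u p)" using p(1) by (simp add: apath_def)
      from awalk_cyc_decompE'[OF p(1) this] obtain q where "closed_w q" by blast
      then show False using acyclic unfolding closed_w_def by auto
    qed
    then show "\<alpha> \<in> (\<lambda>(u, p, v). map L p) ` {(u, p, v). apath u p v}" using p(2) by force
  qed
  then show ?thesis by (rule finite_subset) (intro finite_imageI apaths_finite_triple)
qed

lemma word_length_bound:
  obtains N where "\<And>\<alpha>. wr \<alpha> \<noteq> {} \<Longrightarrow> length \<alpha> < N"
proof -
  have "length \<alpha> < Suc (Max (length ` {\<alpha>. wr \<alpha> \<noteq> {}}))" if "wr \<alpha> \<noteq> {}" for \<alpha>
    using that finite_words by (simp add: less_Suc_eq_le)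
  then show ?thesis by (rule that)
qed

abbreviation "\<V> \<equiv> sink_classes E B"

lemma finite_B: "finite B"
  using finite_subset[of B "Pow (verts E)"] B_subset_verts finite_verts by auto

text \<open>
  \<open>B\<close> is finite, so \<open>A\<^sub>x\<close> is a finite intersection of members of \<open>B\<close>, one of which is
  the set of sinks.
\<close>

lemma sink_class_in_B:
  assumes "V \<in> \<V>"
  shows "V \<in> B" "V \<subseteq> sinks E" "V \<noteq> {}"
proof -
  obtain x where x: "x \<in> sinks E" "V = smallest_nbhd B x"
    using assms unfolding sink_classes_def by blast
  have "\<Inter>F \<in> B" if "F \<subseteq> B" "F \<noteq> {}" "finite F" for F
    using that(3,2,1) by (induction F rule: finite_ne_induct) (auto simp: B_Int)
  moreover have "{X \<in> B. x \<in> X} \<subseteq> B" "{X \<in> B. x \<in> X} \<noteq> {}" "finite {X \<in> B. x \<in> X}"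
    using x(1) sinks_in_B finite_B by auto
  ultimately show "V \<in> B"
    unfolding x(2) smallest_nbhd_def by blast
  show "V \<subseteq> sinks E" "V \<noteq> {}"
    unfolding x(2) smallest_nbhd_def using x(1) sinks_in_B by auto
qed

text \<open>
  If \<open>X\<close> does not contain the sink \<open>x\<close> with \<open>V = A\<^sub>x\<close>, then \<open>V - X\<close> is a neighbourhood of \<open>x\<close> in \<open>B\<close>,
  so by minimality it is all of \<open>V\<close>.
\<close>

lemma sink_class_atom:
  assumes "V \<in> \<V>" "X \<in> B"
  shows "V \<subseteq> X \<or> V \<inter> X = {}"
proof -
  obtain x where x: "x \<in> sinks E" "V = smallest_nbhd B x"
    using assms(1) unfolding sink_classes_def by blast
  have least: "Y \<in> B \<Longrightarrow> x \<in> Y \<Longrightarrow> V \<subseteq> Y" for Y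
    unfolding x(2) smallest_nbhd_def by blast
  have "x \<in> V" unfolding x(2) smallest_nbhd_def by blast
  then show ?thesis
    using least[OF assms(2)] least[OF B_Diff[OF sink_class_in_B(1)[OF assms(1)] assms(2)]] by blast
qed

lemma sink_class_eqI:
  assumes "V \<in> \<V>" "W \<in> \<V>" "V \<inter> W \<noteq> {}"
  shows "V = W"
  using sink_class_atom[OF assms(1) sink_class_in_B(1)[OF assms(2)]]
    sink_class_atom[OF assms(2) sink_class_in_B(1)[OF assms(1)]] assms(3) by blast

lemma sink_class_subset_Un:
  "V \<in> \<V> \<Longrightarrow> X \<in> B \<Longrightarrow> V \<subseteq> X \<union> Y \<longleftrightarrow> V \<subseteq> X \<or> V \<subseteq> Y"
  using sink_class_atom[of V X] by blast

lemma Union_sink_classes: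
  assumes "X \<in> B"
  shows "\<Union>{V \<in> \<V>. V \<subseteq> X} = X \<inter> sinks E"
proof
  show "\<Union>{V \<in> \<V>. V \<subseteq> X} \<subseteq> X \<inter> sinks E" using sink_class_in_B(2) by blast
  show "X \<inter> sinks E \<subseteq> \<Union>{V \<in> \<V>. V \<subseteq> X}"
  proof
    fix x assume "x \<in> X \<inter> sinks E"
    then have "smallest_nbhd B x \<in> \<V>" "x \<in> smallest_nbhd B x" "smallest_nbhd B x \<subseteq> X"
      using assms by (auto simp: sink_classes_def smallest_nbhd_def)
    then show "x \<in> \<Union>{V \<in> \<V>. V \<subseteq> X}" by blast
  qed
qed

lemma finite_sink_classes: "finite \<V>"
  using finite_subset[OF _ finite_B] sink_class_in_B(1) by blast

text \<open>
  The index set of the matrix units. It contains \<open>(V, [])\<close> for every \<open>V\<close>, since the range of the empty word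
  is the set of all vertices.
\<close>

definition \<Omega> :: "('v set \<times> 'l list) set" where
  "\<Omega> = {(V, \<alpha>). V \<in> \<V> \<and> V \<subseteq> wr \<alpha>}"

definition same_class :: "(('v set \<times> 'l list) \<times> ('v set \<times> 'l list)) set" where
  "same_class = {(x, y). x \<in> \<Omega> \<and> y \<in> \<Omega> \<and> fst x = fst y}"

text \<open>
  Labels are tagged \<open>Inr\<close>, so the letter \<open>Inl {}\<close> marks where the second word starts. The class
  is stored once; this suffices because \<open>pair_code\<close> is applied to pairs with a common class.
\<close>

definition pair_code :: "('v set \<times> 'l list) \<times> ('v set \<times> 'l list) \<Rightarrow> ('v set + 'l) list" where
  "pair_code = (\<lambda>(x, y). Inl (fst x) # map Inr (snd x) @ Inl {} # map Inr (snd y))"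

definition shift :: "'l \<Rightarrow> 'v set \<times> 'l list \<Rightarrow> 'v set \<times> 'l list" where
  "shift a x = (fst x, a # snd x)"

text \<open>
  For these indices \<open>(V, \<alpha>)\<close> every representation satisfies \<open>p\<^sub>X s\<^sub>\<alpha> p\<^sub>V = s\<^sub>\<alpha> p\<^sub>V\<close>, and for all
  other indices \<open>p\<^sub>X s\<^sub>\<alpha> p\<^sub>V = 0\<close>.
\<close>

definition index_of :: "'v set \<Rightarrow> ('v set \<times> 'l list) set" where
  "index_of X = {x \<in> \<Omega>. fst x \<subseteq> rr X (snd x)}"

lemma finite_\<Omega>: "finite \<Omega>"
proof (rule finite_subset)
  show "\<Omega> \<subseteq> \<V> \<times> {\<alpha>. wr \<alpha> \<noteq> {}}" unfolding \<Omega>_def using sink_class_in_B(3) by auto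
  show "finite (\<V> \<times> {\<alpha>. wr \<alpha> \<noteq> {}})"
    by (intro finite_cartesian_product finite_sink_classes finite_words)
qed

lemma finite_index_of [simp]: "finite (index_of X)"
  unfolding index_of_def using finite_\<Omega> by simp

lemma \<Omega>_words:
  assumes "(V, \<alpha>) \<in> \<Omega>"
  shows "V \<in> \<V>" "set \<alpha> \<subseteq> alphabet E L"
proof -
  show V: "V \<in> \<V>" using assms by (simp add: \<Omega>_def)
  have "V \<subseteq> wr \<alpha>" using assms by (simp add: \<Omega>_def)
  then have "wr \<alpha> \<noteq> {}" using sink_class_in_B(3)[OF V] by blast
  then show "set \<alpha> \<subseteq> alphabet E L" by (rule set_subset_alphabet)
qed

lemma \<Omega>_Nil:
  assumes "V \<in> \<V>"
  shows "(V, []) \<in> \<Omega>"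
proof -
  have "V \<subseteq> verts E" by (intro B_subset_verts sink_class_in_B(1) assms)
  then show ?thesis using assms by (simp add: \<Omega>_def word_range_conv rel_range_Nil)
qed

lemma \<Omega>_tail: "(V, a # \<alpha>) \<in> \<Omega> \<Longrightarrow> (V, \<alpha>) \<in> \<Omega>"
  using word_range_Cons_subset[of a \<alpha>] by (auto simp: \<Omega>_def)

lemma index_of_word_range: "index_of (wr [a]) = {x \<in> \<Omega>. shift a x \<in> \<Omega>}"
proof (rule Set.set_eqI)
  fix x :: "'v set \<times> 'l list"
  have "rr (wr [a]) (snd x) = wr (a # snd x)" by (rule word_range_Cons[symmetric])
  then show "x \<in> index_of (wr [a]) \<longleftrightarrow> x \<in> {x \<in> \<Omega>. shift a x \<in> \<Omega>}"
    by (auto simp: index_of_def \<Omega>_def shift_def split_beta)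
qed

lemma index_of_empty [simp]: "index_of {} = {}"
proof -
  have "\<not> fst x \<subseteq> {}" if "x \<in> \<Omega>" for x
    using that sink_class_in_B(3)[of "fst x"] by (simp add: \<Omega>_def split_beta)
  then show ?thesis by (auto simp: index_of_def)
qed

lemma shift_in_index_of:
  assumes "fst x \<in> \<V>"
  shows "shift a x \<in> index_of X \<longleftrightarrow> x \<in> index_of (rr X [a])"
proof -
  have sub: "rr X (a # snd x) \<subseteq> wr (a # snd x)" "wr (a # snd x) \<subseteq> wr (snd x)"
    by (rule rel_range_subset_word_range, rule word_range_Cons_subset)
  have "shift a x \<in> index_of X \<longleftrightarrow> fst x \<subseteq> wr (a # snd x) \<and> fst x \<subseteq> rr X (a # snd x)"
    using assms by (simp add: index_of_def \<Omega>_def shift_def)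
  moreover have "x \<in> index_of (rr X [a]) \<longleftrightarrow> fst x \<subseteq> wr (snd x) \<and> fst x \<subseteq> rr X (a # snd x)"
    using assms rel_range_Cons[of X a "snd x", symmetric] by (simp add: index_of_def \<Omega>_def split_beta)
  ultimately show ?thesis using sub by blast
qed

text \<open>
  Splitting off the first letter: this is the combinatorial counterpart of the Cuntz--Krieger
  relation, with the empty words belonging to the part of \<open>X\<close> that consists of sinks.
\<close>

lemma index_of_decompose:
  assumes "X \<in> B"
  shows "index_of X = (\<lambda>V. (V, [])) ` {V \<in> \<V>. V \<subseteq> X}
    \<union> (\<Union>a\<in>out_labels E L X. shift a ` index_of (rr X [a]))" (is "_ = ?N \<union> ?S")
proof (rule Set.set_eqI)
  fix x :: "'v set \<times> 'l list"
  obtain V \<alpha> where x: "x = (V, \<alpha>)" by (cases x)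
  show "x \<in> index_of X \<longleftrightarrow> x \<in> ?N \<union> ?S"
  proof (cases \<alpha>)
    case Nil
    have "x \<notin> ?S" unfolding x Nil shift_def by auto
    moreover have "x \<in> index_of X \<longleftrightarrow> x \<in> ?N"
      using \<Omega>_Nil[of V] \<Omega>_words(1)[of V "[]"] rel_range_Nil[OF B_subset_verts[OF assms]]
      by (auto simp: x Nil index_of_def)
    ultimately show ?thesis by blast
  next
    case (Cons a \<beta>)
    have shift: "x = shift a (V, \<beta>)" by (simp add: x Cons shift_def)
    have "x \<in> index_of X \<longleftrightarrow> (V, \<beta>) \<in> index_of (rr X [a])"
    proof (cases "V \<in> \<V>")
      case True
      then show ?thesis unfolding shift by (intro shift_in_index_of) simp
    next
      case False
      then show ?thesis unfolding x by (auto simp: index_of_def \<Omega>_def)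
    qed
    moreover have "x \<in> ?S \<longleftrightarrow> a \<in> out_labels E L X \<and> (V, \<beta>) \<in> index_of (rr X [a])"
      by (force simp: x Cons shift_def)
    moreover have "x \<notin> ?N" by (auto simp: x Cons)
    moreover have "a \<in> out_labels E L X" if "(V, \<beta>) \<in> index_of (rr X [a])"
      using that out_labels_iff[of a X] by auto
    ultimately show ?thesis by blast
  qed
qed

lemma index_of_subset: "index_of X \<subseteq> \<Omega>"
  unfolding index_of_def by blast

lemma equiv_same_class: "equiv \<Omega> same_class"
  by (auto simp: same_class_def intro!: equivI refl_onI symI transI)

lemma Inr_Inl_append_eq_iff:
  fixes \<alpha> \<beta> \<gamma> \<delta> :: "'l list" and X :: "'v set"
  shows "map Inr \<alpha> @ Inl X # map Inr \<beta> = map Inr \<gamma> @ Inl X # map Inr \<delta> \<longleftrightarrow> \<alpha> = \<gamma> \<and> \<beta> = \<delta>"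
proof (induction \<alpha> arbitrary: \<gamma>)
  case Nil
  then show ?case by (cases \<gamma>) (auto simp: inj_map_eq_map)
next
  case (Cons a \<alpha>)
  then show ?case by (cases \<gamma>) auto
qed

lemma inj_pair_code: "inj_on pair_code same_class"
proof (rule inj_onI)
  fix x y :: "('v set \<times> 'l list) \<times> ('v set \<times> 'l list)"
  assume "x \<in> same_class" "y \<in> same_class" "pair_code x = pair_code y"
  then show "x = y"
    by (auto simp: pair_code_def same_class_def Inr_Inl_append_eq_iff prod_eq_iff split_beta)
qed

sublocale block_matrices \<Omega> same_class pair_code
  by (rule block_matrices.intro[OF finite_\<Omega> equiv_same_class inj_pair_code])

end

section \<open>Matrix units in a representation\<close>

locale labeled_rep =
  acyclic_labeled_space E L B + cstar_algebra A
  for E :: "('v, 'e) pre_digraph" and L :: "'e \<Rightarrow> 'l" and B :: "'v set set"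
    and A :: "'a cstar" (structure) +
  fixes p :: "'v set \<Rightarrow> 'a" and s :: "'l \<Rightarrow> 'a"
  assumes rep: "labeled_representation E L B A p s"
begin

lemma p_closed: "X \<in> B \<Longrightarrow> p X \<in> carrier A"
  using rep unfolding labeled_representation_def projection_def by blast

lemma p_adjoint: "X \<in> B \<Longrightarrow> cadjoint A (p X) = p X"
  using rep unfolding labeled_representation_def projection_def by blast

lemma p_mult: "X \<in> B \<Longrightarrow> Y \<in> B \<Longrightarrow> p X \<otimes> p Y = p (X \<inter> Y)"
  using rep unfolding labeled_representation_def by blast

lemma p_Un: "X \<in> B \<Longrightarrow> Y \<in> B \<Longrightarrow> p (X \<union> Y) = p X \<oplus> p Y \<ominus> p (X \<inter> Y)"
  using rep unfolding labeled_representation_def by blast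

lemma s_closed: "a \<in> alphabet E L \<Longrightarrow> s a \<in> carrier A"
  using rep unfolding labeled_representation_def partial_isometry_def by blast

lemma s_isometry: "a \<in> alphabet E L \<Longrightarrow> s a \<otimes> cadjoint A (s a) \<otimes> s a = s a"
  using rep unfolding labeled_representation_def partial_isometry_def by blast

lemma s_orthogonal:
  "a \<in> alphabet E L \<Longrightarrow> b \<in> alphabet E L \<Longrightarrow>
    cadjoint A (s a) \<otimes> s b = (if a = b then p (wr [a]) else \<zero>)"
  using rep unfolding labeled_representation_def by blast

lemma s_adjoint_p:
  "a \<in> alphabet E L \<Longrightarrow> X \<in> B \<Longrightarrow> cadjoint A (s a) \<otimes> p X = p (rr X [a]) \<otimes> cadjoint A (s a)"
  using rep unfolding labeled_representation_def by blast

lemma p_Cuntz_Krieger: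
  assumes "X \<in> B" "X \<inter> sinks E = {}"
  shows "p X = (\<Oplus>a \<in> out_labels E L X. s a \<otimes> p (rr X [a]) \<otimes> cadjoint A (s a))"
  using rep assms finite_out_labels[of X] unfolding labeled_representation_def by blast

lemma p_empty: "p {} = \<zero>"
proof -
  have "out_labels E L {} = {}" by (simp add: out_labels_def)
  then show ?thesis using p_Cuntz_Krieger[OF B_empty] by simp
qed

lemma p_Un_disjoint:
  assumes "X \<in> B" "Y \<in> B" "X \<inter> Y = {}"
  shows "p (X \<union> Y) = p X \<oplus> p Y"
  using p_Un[OF assms(1,2)] assms p_closed by (simp add: p_empty a_minus_def)

lemma p_s:
  assumes "a \<in> alphabet E L" "X \<in> B"
  shows "p X \<otimes> s a = s a \<otimes> p (rr X [a])"
proof -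
  have "cadjoint A (cadjoint A (s a) \<otimes> p X) = cadjoint A (p (rr X [a]) \<otimes> cadjoint A (s a))"
    by (simp only: s_adjoint_p[OF assms])
  then show ?thesis
    using assms by (simp add: adjoint_mult adjoint_closed adjoint_adjoint s_closed p_closed
        p_adjoint rel_range_in_B)
qed

lemma s_p_word_range:
  assumes "a \<in> alphabet E L"
  shows "s a \<otimes> p (wr [a]) = s a"
  using s_isometry[OF assms] s_orthogonal[OF assms assms]
  by (simp add: mult_assoc s_closed[OF assms] adjoint_closed)

text \<open>
  The element \<open>s\<^sub>\<alpha> p\<^sub>V\<close>. Multiplying the letters onto \<open>p\<^sub>V\<close> gives the empty word a meaning even though
  the algebra need not have a unit.
\<close>

primrec path_elt :: "'v set \<Rightarrow> 'l list \<Rightarrow> 'a" where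
  "path_elt V [] = p V"
| "path_elt V (a # \<alpha>) = s a \<otimes> path_elt V \<alpha>"

lemma path_elt_closed:
  "V \<in> \<V> \<Longrightarrow> set \<alpha> \<subseteq> alphabet E L \<Longrightarrow> path_elt V \<alpha> \<in> carrier A"
  by (induction \<alpha>) (auto intro: mult_closed s_closed p_closed sink_class_in_B(1))

text \<open>
  Each letter that \<open>p\<^sub>X\<close> passes replaces \<open>X\<close> by its relative range, and at the end \<open>p\<close> of
  \<open>r(X, \<alpha>)\<close> meets \<open>p\<^sub>V\<close>, where \<open>V\<close> is an atom of \<open>B\<close>.
\<close>

lemma p_path_elt:
  assumes "V \<in> \<V>" "set \<alpha> \<subseteq> alphabet E L" "X \<in> B"
  shows "p X \<otimes> path_elt V \<alpha> = (if V \<subseteq> rr X \<alpha> then path_elt V \<alpha> else \<zero>)"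
  using assms(2,3)
proof (induction \<alpha> arbitrary: X)
  case Nil
  have V: "V \<in> B" by (rule sink_class_in_B(1)[OF assms(1)])
  show ?case
  proof (cases "V \<subseteq> X")
    case True
    then have "X \<inter> V = V" by blast
    then show ?thesis using True p_mult[OF Nil(2) V] rel_range_Nil[OF B_subset_verts[OF Nil(2)]] by simp
  next
    case False
    then have "X \<inter> V = {}" using sink_class_atom[OF assms(1) Nil(2)] by blast
    then show ?thesis
      using False p_mult[OF Nil(2) V] rel_range_Nil[OF B_subset_verts[OF Nil(2)]] p_empty by simp
  qed
next
  case (Cons a \<alpha>)
  then have a: "a \<in> alphabet E L" and \<alpha>: "set \<alpha> \<subseteq> alphabet E L" by auto
  note closed = s_closed[OF a] path_elt_closed[OF assms(1) \<alpha>] p_closed[OF Cons.prems(2)]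
    p_closed[OF rel_range_in_B[OF Cons.prems(2)]]
  have "p X \<otimes> path_elt V (a # \<alpha>) = (p X \<otimes> s a) \<otimes> path_elt V \<alpha>"
    using closed by (simp add: mult_assoc)
  also have "\<dots> = s a \<otimes> (p (rr X [a]) \<otimes> path_elt V \<alpha>)"
    using closed by (simp add: p_s[OF a Cons.prems(2)] mult_assoc)
  also have "\<dots> = (if V \<subseteq> rr (rr X [a]) \<alpha> then path_elt V (a # \<alpha>) else \<zero>)"
    using closed by (simp add: Cons.IH[OF \<alpha> rel_range_in_B[OF Cons.prems(2)]])
  also have "rr (rr X [a]) \<alpha> = rr X (a # \<alpha>)" by (rule rel_range_Cons[symmetric])
  finally show ?case .
qed

lemma path_elt_p:
  assumes "V \<in> \<V>" "set \<alpha> \<subseteq> alphabet E L"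
  shows "path_elt V \<alpha> \<otimes> p V = path_elt V \<alpha>"
  using assms(2)
proof (induction \<alpha>)
  case Nil
  then show ?case using p_mult[of V V] sink_class_in_B(1)[OF assms(1)] by simp
next
  case (Cons a \<alpha>)
  then show ?case
    using s_closed[of a] path_elt_closed[OF assms(1), of \<alpha>] p_closed[OF sink_class_in_B(1)[OF assms(1)]]
    by (simp add: mult_assoc)
qed

text \<open>
  Different first letters are orthogonal and equal ones cancel. If one word is exhausted first, then
  \<open>p\<^sub>V\<close> meets a letter \<open>s\<^sub>b\<close>, and \<open>p\<^sub>V s\<^sub>b = s\<^sub>b p\<close> with \<open>p\<close> belonging to \<open>r(V, b) = {}\<close>, because \<open>V\<close>
  consists of sinks.
\<close>

lemma path_elt_orthogonal:
  assumes "(V, \<alpha>) \<in> \<Omega>" "(W, \<beta>) \<in> \<Omega>"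
  shows "cadjoint A (path_elt V \<alpha>) \<otimes> path_elt W \<beta> = (if V = W \<and> \<alpha> = \<beta> then p V else \<zero>)"
  using assms
proof (induction \<alpha> arbitrary: \<beta>)
  case Nil
  note V = \<Omega>_words[OF Nil(1)] and W = \<Omega>_words[OF Nil(2)]
  have VB: "V \<in> B" and WB: "W \<in> B" using V W sink_class_in_B(1) by auto
  show ?case
  proof (cases \<beta>)
    case Nil: Nil
    have "p V \<otimes> p W = (if V = W then p V else \<zero>)"
      using p_mult[OF VB WB] sink_class_eqI[OF V(1) W(1)] p_empty by (cases "V \<inter> W = {}") 
        (use sink_class_in_B(3)[OF V(1)] in auto)
    then show ?thesis using Nil p_adjoint[OF VB] by simp
  next
    case (Cons b \<gamma>)
    have "\<not> W \<subseteq> rr V (b # \<gamma>)"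
      using rel_range_sinks[OF sink_class_in_B(2)[OF V(1)]] sink_class_in_B(3)[OF W(1)] by simp
    then show ?thesis
      using p_path_elt[OF W(1) W(2) VB] Cons p_adjoint[OF VB] by simp
  qed
next
  case (Cons a \<alpha>)
  note V = \<Omega>_words[OF Cons.prems(1)] and W = \<Omega>_words[OF Cons.prems(2)]
  have VB: "V \<in> B" and WB: "W \<in> B" using V W sink_class_in_B(1) by auto
  have a: "a \<in> alphabet E L" and \<alpha>: "set \<alpha> \<subseteq> alphabet E L" using V(2) by auto
  have v: "path_elt V \<alpha> \<in> carrier A" by (rule path_elt_closed[OF V(1) \<alpha>])
  note closed = v s_closed[OF a] adjoint_closed[OF v] adjoint_closed[OF s_closed[OF a]]
  have adj: "cadjoint A (path_elt V (a # \<alpha>)) = cadjoint A (path_elt V \<alpha>) \<otimes> cadjoint A (s a)"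
    using closed by (simp add: adjoint_mult)
  show ?case
  proof (cases \<beta>)
    case Nil
    have "cadjoint A (s a) \<otimes> p W = p (rr W [a]) \<otimes> cadjoint A (s a)"
      by (rule s_adjoint_p[OF a WB])
    also have "\<dots> = \<zero>"
      using closed rel_range_sinks[OF sink_class_in_B(2)[OF W(1)], of a "[]"] p_empty by simp
    finally show ?thesis
      unfolding adj Nil using closed p_closed[OF WB] by (simp add: mult_assoc)
  next
    case b: (Cons b \<gamma>)
    have b': "b \<in> alphabet E L" "set \<gamma> \<subseteq> alphabet E L" using W(2) b by auto
    have \<gamma>: "(W, \<gamma>) \<in> \<Omega>" using Cons.prems(2) b \<Omega>_tail by blast
    note closed = closed s_closed[OF b'(1)] path_elt_closed[OF W(1) b'(2)] word_range_in_B[OF a]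
    have "cadjoint A (path_elt V (a # \<alpha>)) \<otimes> path_elt W \<beta>
        = cadjoint A (path_elt V \<alpha>) \<otimes> ((cadjoint A (s a) \<otimes> s b) \<otimes> path_elt W \<gamma>)"
      unfolding adj b using closed by (simp add: mult_assoc mult_closed)
    also have "\<dots> = (if V = W \<and> a # \<alpha> = \<beta> then p V else \<zero>)"
    proof (cases "a = b")
      case True
      \<comment> \<open>what remains of the two letters, \<open>p (wr [a])\<close>, is absorbed because \<open>(W, a # \<gamma>)\<close> is in \<open>\<Omega>\<close>\<close>
      have "W \<subseteq> wr (b # \<gamma>)" using Cons.prems(2) b by (simp add: \<Omega>_def)
      then have "W \<subseteq> rr (wr [a]) \<gamma>" using True word_range_Cons[of b \<gamma>] by simp
      then have "p (wr [a]) \<otimes> path_elt W \<gamma> = path_elt W \<gamma>"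
        using p_path_elt[OF W(1) b'(2) word_range_in_B[OF a]] by simp
      then show ?thesis
        using s_orthogonal[OF a a] True Cons.IH[OF \<Omega>_tail[OF Cons.prems(1)] \<gamma>] b by simp
    next
      case False
      then show ?thesis using s_orthogonal[OF a b'(1)] closed b by simp
    qed
    finally show ?thesis .
  qed
qed

definition elt :: "'v set \<times> 'l list \<Rightarrow> 'a" where
  "elt x = path_elt (fst x) (snd x)"

text \<open>
  For \<open>x = (V, \<alpha>)\<close> and \<open>y = (V, \<beta>)\<close> this is \<open>s\<^sub>\<alpha> p\<^sub>V s\<^sub>\<beta>\<^sup>*\<close>.
\<close>

definition e :: "'v set \<times> 'l list \<Rightarrow> 'v set \<times> 'l list \<Rightarrow> 'a" where
  "e x y = elt x \<otimes> cadjoint A (elt y)"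

lemma elt_closed: "x \<in> \<Omega> \<Longrightarrow> elt x \<in> carrier A"
  unfolding elt_def using \<Omega>_words[of "fst x" "snd x"] by (simp add: path_elt_closed)

lemma elt_shift: "elt (shift a x) = s a \<otimes> elt x"
  by (simp add: elt_def shift_def)

sublocale matrix_units \<Omega> same_class pair_code A e
proof (rule matrix_units.intro[OF block_matrices_axioms cstar_algebra_axioms], rule matrix_units_axioms.intro)
  fix x y assume "x \<in> \<Omega>" "y \<in> \<Omega>"
  then show "e x y \<in> carrier A" by (simp add: e_def elt_closed mult_closed adjoint_closed)
next
  fix x y assume "(x, y) \<in> same_class"
  then have "x \<in> \<Omega>" "y \<in> \<Omega>" by (auto simp: same_class_def)
  then show "cadjoint A (e x y) = e y x"
    by (simp add: e_def elt_closed adjoint_mult adjoint_adjoint adjoint_closed)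
next
  fix x y z w assume "(x, y) \<in> same_class" "(z, w) \<in> same_class"
  then have mem: "x \<in> \<Omega>" "y \<in> \<Omega>" "z \<in> \<Omega>" "w \<in> \<Omega>" and V: "fst x = fst y"
    by (auto simp: same_class_def)
  note closed = elt_closed[OF mem(1)] elt_closed[OF mem(3)]
    adjoint_closed[OF elt_closed[OF mem(2)]] adjoint_closed[OF elt_closed[OF mem(4)]]
  have "e x y \<otimes> e z w = elt x \<otimes> ((cadjoint A (elt y) \<otimes> elt z) \<otimes> cadjoint A (elt w))"
    unfolding e_def using closed by (simp add: mult_assoc mult_closed)
  also have "cadjoint A (elt y) \<otimes> elt z = (if y = z then p (fst y) else \<zero>)"
    unfolding elt_def using path_elt_orthogonal[of "fst y" "snd y" "fst z" "snd z"] mem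
    by (simp add: prod_eq_iff)
  also have "elt x \<otimes> ((if y = z then p (fst y) else \<zero>) \<otimes> cadjoint A (elt w))
      = (if y = z then e x w else \<zero>)"
  proof (cases "y = z")
    case True
    have x: "fst x \<in> \<V>" "set (snd x) \<subseteq> alphabet E L"
      using \<Omega>_words[of "fst x" "snd x"] mem(1) by auto
    have "elt x \<otimes> (p (fst y) \<otimes> cadjoint A (elt w)) = (elt x \<otimes> p (fst x)) \<otimes> cadjoint A (elt w)"
      using closed p_closed[OF sink_class_in_B(1)[OF x(1)]] V by (simp add: mult_assoc)
    also have "\<dots> = e x w" unfolding e_def elt_def path_elt_p[OF x] ..
    finally show ?thesis using True by simp
  next
    case False
    then show ?thesis using closed by simp
  qed
  finally show "e x y \<otimes> e z w = (if y = z then e x w else \<zero>)" .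
qed

lemma p_sum_sink_classes:
  assumes "X \<in> B" "X \<subseteq> sinks E"
  shows "p X = (\<Oplus>V \<in> {V \<in> \<V>. V \<subseteq> X}. p V)"
proof -
  have "\<Union>F \<in> B \<and> p (\<Union>F) = (\<Oplus>V\<in>F. p V)" if "finite F" "F \<subseteq> \<V>" for F
    using that
  proof (induction F rule: finite_induct)
    case empty
    then show ?case by (simp add: B_empty p_empty)
  next
    case (insert V F)
    have disj: "V \<inter> \<Union>F = {}" using insert sink_class_eqI[of V] by blast
    have V: "V \<in> B" and F: "p \<in> F \<rightarrow> carrier A"
      using insert.prems sink_class_in_B(1) p_closed by auto
    show ?case
      using insert V F disj by (simp add: B_Un p_Un_disjoint p_closed)
  qed
  from this[of "{V \<in> \<V>. V \<subseteq> X}"]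
  have "p (\<Union>{V \<in> \<V>. V \<subseteq> X}) = (\<Oplus>V \<in> {V \<in> \<V>. V \<subseteq> X}. p V)"
    using finite_sink_classes by auto
  moreover have "\<Union>{V \<in> \<V>. V \<subseteq> X} = X" using Union_sink_classes[OF assms(1)] assms(2) by blast
  ultimately show ?thesis by simp
qed

lemma e_shift:
  assumes "a \<in> alphabet E L" "x \<in> \<Omega>"
  shows "s a \<otimes> e x x \<otimes> cadjoint A (s a) = e (shift a x) (shift a x)"
  using s_closed[OF assms(1)] elt_closed[OF assms(2)]
  by (simp add: e_def elt_shift adjoint_mult mult_assoc mult_closed adjoint_closed)

lemma e_diag_closed: "(\<lambda>x. e x x) \<in> index_of X \<rightarrow> carrier A"
  using index_of_subset e_closed by blast

text \<open>
  Inside the sinks, \<open>X\<close> is the disjoint union of the classes below it. Off the sinks, the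
  Cuntz--Krieger relation expresses \<open>p\<^sub>X\<close> through projections of the sets \<open>r(X, a)\<close>, from which only shorter
  words can be read; the recursion ends because the lengths of words are bounded.
\<close>

lemma p_eq_sum_e:
  assumes "X \<in> B"
  shows "p X = (\<Oplus>x\<in>index_of X. e x x)"
proof -
  obtain N where N: "\<And>\<alpha>. wr \<alpha> \<noteq> {} \<Longrightarrow> length \<alpha> < N"
    by (rule word_length_bound) blast
  \<comment> \<open>induction on a strict bound for the length of the words that can be read from \<open>X\<close>\<close>
  have "p X = (\<Oplus>x\<in>index_of X. e x x)"
    if "X \<in> B" "\<And>\<alpha>. rr X \<alpha> \<noteq> {} \<Longrightarrow> length \<alpha> < n" for X n
    using that
  proof (induction n arbitrary: X)
    case 0
    then have "X = {}" using rel_range_Nil[OF B_subset_verts[OF 0(1)]] by fastforce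
    then show ?case by (simp add: p_empty)
  next
    case (Suc n)
    let ?Y = "X - sinks E" and ?Z = "X \<inter> sinks E"
    have Y: "?Y \<in> B" and Z: "?Z \<in> B" using Suc.prems(1) sinks_in_B B_Diff B_Int by auto
    have rrY: "rr ?Y [a] = rr X [a]" for a
      using rel_range_Un[of ?Y ?Z "[a]"] rel_range_sinks[of ?Z a "[]"] by (simp add: Un_Diff_Int)
    have outY: "out_labels E L ?Y = out_labels E L X"
      using out_labels_iff[of _ ?Y] out_labels_iff[of _ X] rrY by blast
    let ?out = "out_labels E L X"
    have out: "a \<in> alphabet E L" if "a \<in> ?out" for a using that out_labels_subset by blast
    have IH: "p (rr X [a]) = (\<Oplus>x\<in>index_of (rr X [a]). e x x)" for a
    proof (rule Suc.IH)
      show "rr X [a] \<in> B" by (rule rel_range_in_B[OF Suc.prems(1)])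
      fix \<alpha> assume "rr (rr X [a]) \<alpha> \<noteq> {}"
      then have "rr X (a # \<alpha>) \<noteq> {}" using rel_range_Cons[of X a \<alpha>] by simp
      then show "length \<alpha> < n" using Suc.prems(2)[of "a # \<alpha>"] by simp
    qed
    have inj: "inj_on (shift a) S" for a S by (auto simp: inj_on_def shift_def prod_eq_iff)
    have shifted: "shift a ` index_of (rr X [a]) \<subseteq> \<Omega>" if "a \<in> ?out" for a
      using index_of_decompose[OF Suc.prems(1)] that index_of_subset[of X] by blast
    have "p ?Y = (\<Oplus>a\<in>?out. s a \<otimes> p (rr X [a]) \<otimes> cadjoint A (s a))"
      using p_Cuntz_Krieger[OF Y] unfolding outY rrY by blast
    also have "\<dots> = (\<Oplus>a\<in>?out. \<Oplus>x\<in>shift a ` index_of (rr X [a]). e x x)"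
    proof (rule M.finsum_cong'[OF refl])
      show "(\<lambda>a. \<Oplus>x\<in>shift a ` index_of (rr X [a]). e x x) \<in> ?out \<rightarrow> carrier A"
        using shifted e_closed by (fastforce intro!: finsum_closed)
      fix a assume a: "a \<in> ?out"
      note sa = s_closed[OF out[OF a]]
      have "s a \<otimes> p (rr X [a]) = (\<Oplus>x\<in>index_of (rr X [a]). s a \<otimes> e x x)"
        unfolding IH by (intro finsum_mult_left finite_index_of e_diag_closed sa)
      then have "s a \<otimes> p (rr X [a]) \<otimes> cadjoint A (s a)
          = (\<Oplus>x\<in>index_of (rr X [a]). s a \<otimes> e x x) \<otimes> cadjoint A (s a)" by simp
      also have "\<dots> = (\<Oplus>x\<in>index_of (rr X [a]). s a \<otimes> e x x \<otimes> cadjoint A (s a))"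
        using e_diag_closed[of "rr X [a]"] sa
        by (intro finsum_mult_right finite_index_of adjoint_closed) (auto intro: mult_closed)
      also have "\<dots> = (\<Oplus>x\<in>index_of (rr X [a]). e (shift a x) (shift a x))"
      proof (rule M.finsum_cong'[OF refl])
        show "(\<lambda>x. e (shift a x) (shift a x)) \<in> index_of (rr X [a]) \<rightarrow> carrier A"
          using shifted[OF a] e_closed by blast
        fix x assume "x \<in> index_of (rr X [a])"
        then show "s a \<otimes> e x x \<otimes> cadjoint A (s a) = e (shift a x) (shift a x)"
          using index_of_subset by (intro e_shift out[OF a]) blast
      qed
      also have "\<dots> = (\<Oplus>x\<in>shift a ` index_of (rr X [a]). e x x)"
        using shifted[OF a] e_closed by (intro finsum_reindex[symmetric] inj) blast
      finally show "s a \<otimes> p (rr X [a]) \<otimes> cadjoint A (s a) = \<dots>" .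
    qed
    also have "\<dots> = (\<Oplus>x\<in>(\<Union>a\<in>?out. shift a ` index_of (rr X [a])). e x x)"
    proof (rule M.add.finprod_UN_disjoint[symmetric])
      show "pairwise (\<lambda>a b. disjnt (shift a ` index_of (rr X [a])) (shift b ` index_of (rr X [b]))) ?out"
        by (auto simp: pairwise_def disjnt_def shift_def)
      show "e x x \<in> carrier A" if "a \<in> ?out" "x \<in> shift a ` index_of (rr X [a])" for a x
        using that shifted e_closed by blast
    qed (auto simp: finite_out_labels)
    finally have sumY: "p ?Y = \<dots>" .
    have "p ?Z = (\<Oplus>V \<in> {V \<in> \<V>. V \<subseteq> X}. p V)"
    proof -
      have "{V \<in> \<V>. V \<subseteq> ?Z} = {V \<in> \<V>. V \<subseteq> X}" using sink_class_in_B(2) by blast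
      then show ?thesis using p_sum_sink_classes[OF Z] by simp
    qed
    also have "\<dots> = (\<Oplus>V \<in> {V \<in> \<V>. V \<subseteq> X}. e (V, []) (V, []))"
    proof (rule M.finsum_cong'[OF refl])
      show "(\<lambda>V. e (V, []) (V, [])) \<in> {V \<in> \<V>. V \<subseteq> X} \<rightarrow> carrier A"
        using \<Omega>_Nil e_closed by blast
      fix V assume "V \<in> {V \<in> \<V>. V \<subseteq> X}"
      then have "V \<in> B" using sink_class_in_B(1) by blast
      then show "p V = e (V, []) (V, [])" by (simp add: e_def elt_def p_adjoint p_mult)
    qed
    also have "\<dots> = (\<Oplus>x\<in>(\<lambda>V. (V, [])) ` {V \<in> \<V>. V \<subseteq> X}. e x x)"
    proof (rule finsum_reindex[symmetric])
      show "(\<lambda>x. e x x) \<in> (\<lambda>V. (V, [])) ` {V \<in> \<V>. V \<subseteq> X} \<rightarrow> carrier A"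
        using \<Omega>_Nil e_closed by blast
    qed (auto intro: inj_onI)
    finally have sumZ: "p ?Z = \<dots>" .
    have "?Z \<inter> ?Y = {}" "?Z \<union> ?Y = X" by auto
    then have "p X = p ?Z \<oplus> p ?Y"
      using p_Un_disjoint[OF Z Y] by simp
    also have "\<dots> = (\<Oplus>x\<in>index_of X. e x x)"
      unfolding sumZ sumY index_of_decompose[OF Suc.prems(1)]
    proof (rule finsum_Un_disjoint[symmetric])
      show "(\<lambda>x. e x x) \<in> (\<lambda>V. (V, [])) ` {V \<in> \<V>. V \<subseteq> X} \<rightarrow> carrier A"
        using \<Omega>_Nil e_closed by blast
      show "(\<lambda>x. e x x) \<in> (\<Union>a\<in>?out. shift a ` index_of (rr X [a])) \<rightarrow> carrier A"
        using shifted e_closed by blast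
    qed (auto simp: shift_def finite_sink_classes finite_out_labels)
    finally show ?case .
  qed
  from this[OF assms] show ?thesis using N rel_range_subset_word_range by blast
qed

lemma s_eq_sum_e:
  assumes "a \<in> alphabet E L"
  shows "s a = (\<Oplus>x\<in>index_of (wr [a]). e (shift a x) x)"
proof -
  have "s a = s a \<otimes> (\<Oplus>x\<in>index_of (wr [a]). e x x)"
    using s_p_word_range[OF assms] p_eq_sum_e[OF word_range_in_B[OF assms]] by simp
  also have "\<dots> = (\<Oplus>x\<in>index_of (wr [a]). s a \<otimes> e x x)"
    by (intro finsum_mult_left finite_index_of e_diag_closed s_closed[OF assms])
  also have "\<dots> = (\<Oplus>x\<in>index_of (wr [a]). e (shift a x) x)"
    using s_closed[OF assms] elt_closed
    by (intro M.finsum_cong'[OF refl])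
      (auto simp: index_of_word_range e_def elt_shift mult_assoc mult_closed adjoint_closed)
  finally show ?thesis .
qed

end

section \<open>The canonical representation by matrices\<close>

context acyclic_labeled_space
begin

interpretation alg: cstar_algebra alg by (rule cstar_algebra_alg)

text \<open>
  The matrices to which \<open>p\<^sub>X\<close> and \<open>s\<^sub>a\<close> correspond by \<open>p_eq_sum_e\<close> and \<open>s_eq_sum_e\<close>, which hold
  in every representation.
\<close>

definition P :: "'v set \<Rightarrow> ('v set + 'l) list \<Rightarrow> complex" where
  "P X = (\<Oplus>\<^bsub>alg\<^esub>x\<in>index_of X. unit x x)"

definition S :: "'l \<Rightarrow> ('v set + 'l) list \<Rightarrow> complex" where
  "S a = (\<Oplus>\<^bsub>alg\<^esub>x\<in>index_of (wr [a]). unit (shift a x) x)"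

lemma P_closed [simp]: "P X \<in> carrier alg"
  unfolding P_def by (rule alg.finsum_closed) simp

lemma S_closed [simp]: "S a \<in> carrier alg"
  unfolding S_def by (rule alg.finsum_closed) simp

lemma in_\<Omega>: "x \<in> index_of X \<Longrightarrow> x \<in> \<Omega>"
  using index_of_subset by blast

lemma shift_in_\<Omega>: "x \<in> index_of (wr [a]) \<Longrightarrow> shift a x \<in> \<Omega>"
  by (simp add: index_of_word_range)

lemma shift_same_class: "x \<in> index_of (wr [a]) \<Longrightarrow> (shift a x, x) \<in> same_class"
  using shift_in_\<Omega>[of x a] in_\<Omega>[of x] by (simp add: same_class_def) (simp add: shift_def)

lemma shift_eq_iff: "shift a x = shift b y \<longleftrightarrow> a = b \<and> x = y"
  by (auto simp: shift_def prod_eq_iff)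

lemma entry_P: "entry (P X) u v = (if u = v \<and> u \<in> index_of X then 1 else 0)"
proof -
  have "entry (P X) u v = (\<Sum>x\<in>index_of X. entry (unit x x) u v)"
    unfolding P_def by (rule entry_finsum) auto
  also have "\<dots> = (\<Sum>x\<in>index_of X. if x = u then (if u = v then 1 else 0) else 0)"
    using R_refl in_\<Omega> by (intro sum.cong) (auto simp: entry_unit)
  also have "\<dots> = (if u = v \<and> u \<in> index_of X then 1 else 0)" by simp
  finally show ?thesis .
qed

lemma entry_S: "entry (S a) u v = (if v \<in> index_of (wr [a]) \<and> u = shift a v then 1 else 0)"
proof -
  have "entry (S a) u v = (\<Sum>x\<in>index_of (wr [a]). entry (unit (shift a x) x) u v)"
    unfolding S_def by (rule entry_finsum) auto
  also have "\<dots> = (\<Sum>x\<in>index_of (wr [a]). if x = v then (if u = shift a v then 1 else 0) else 0)"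
    using shift_same_class by (intro sum.cong) (auto simp: entry_unit)
  also have "\<dots> = (if v \<in> index_of (wr [a]) \<and> u = shift a v then 1 else 0)" by simp
  finally show ?thesis .
qed

lemma entry_P_mult: "entry (P X \<otimes>\<^bsub>alg\<^esub> f) u v = (if u \<in> index_of X then entry f u v else 0)"
proof -
  have "entry (P X \<otimes>\<^bsub>alg\<^esub> f) u v
      = (\<Sum>z\<in>\<Omega>. if z = u then (if u \<in> index_of X then entry f u v else 0) else 0)"
    unfolding entry_mult by (intro sum.cong) (auto simp: entry_P)
  then show ?thesis using in_\<Omega>[of u X] finite_\<Omega> by simp
qed

lemma entry_mult_P: "entry (f \<otimes>\<^bsub>alg\<^esub> P X) u v = (if v \<in> index_of X then entry f u v else 0)"
proof -
  have "entry (f \<otimes>\<^bsub>alg\<^esub> P X) u v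
      = (\<Sum>z\<in>\<Omega>. if z = v then (if v \<in> index_of X then entry f u v else 0) else 0)"
    unfolding entry_mult by (intro sum.cong) (auto simp: entry_P)
  then show ?thesis using in_\<Omega>[of v X] finite_\<Omega> by simp
qed

lemma entry_S_adjoint_mult:
  "entry (cadjoint alg (S a) \<otimes>\<^bsub>alg\<^esub> f) u v
    = (if u \<in> index_of (wr [a]) then entry f (shift a u) v else 0)"
proof -
  have "entry (cadjoint alg (S a) \<otimes>\<^bsub>alg\<^esub> f) u v
      = (\<Sum>z\<in>\<Omega>. if z = shift a u then (if u \<in> index_of (wr [a]) then entry f (shift a u) v else 0) else 0)"
    unfolding entry_mult by (intro sum.cong) (auto simp: entry_adjoint entry_S)
  then show ?thesis using shift_in_\<Omega>[of u a] finite_\<Omega> by simp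
qed

lemma S_mult_unit:
  assumes "x \<in> index_of (wr [a])" "(x, y) \<in> same_class"
  shows "S a \<otimes>\<^bsub>alg\<^esub> unit x y = unit (shift a x) y"
proof (rule alg_eqI)
  fix u v
  have "(shift a x, y) \<in> same_class"
    using R_trans[OF shift_same_class[OF assms(1)] assms(2)] .
  moreover have "entry (S a \<otimes>\<^bsub>alg\<^esub> unit x y) u v
      = (\<Sum>z\<in>\<Omega>. if z = x then (if u = shift a x \<and> v = y then 1 else 0) else 0)"
    unfolding entry_mult using assms by (intro sum.cong) (auto simp: entry_unit entry_S)
  ultimately show "entry (S a \<otimes>\<^bsub>alg\<^esub> unit x y) u v = entry (unit (shift a x) y) u v"
    using in_\<Omega>[OF assms(1)] finite_\<Omega> by (simp add: entry_unit)
qed (auto simp: alg.mult_closed)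

lemma index_of_Int: "X \<in> B \<Longrightarrow> Y \<in> B \<Longrightarrow> index_of (X \<inter> Y) = index_of X \<inter> index_of Y"
  by (auto simp: index_of_def rel_range_Int)

lemma index_of_Un:
  assumes "X \<in> B" "Y \<in> B"
  shows "index_of (X \<union> Y) = index_of X \<union> index_of Y"
proof -
  have "V \<subseteq> rr (X \<union> Y) \<alpha> \<longleftrightarrow> V \<subseteq> rr X \<alpha> \<or> V \<subseteq> rr Y \<alpha>" if "(V, \<alpha>) \<in> \<Omega>" for V \<alpha>
    using sink_class_subset_Un[OF \<Omega>_words(1)[OF that] rel_range_in_B[OF assms(1)], of \<alpha> "rr Y \<alpha>"]
    by (simp add: rel_range_Un)
  then have "x \<in> index_of (X \<union> Y) \<longleftrightarrow> x \<in> index_of X \<union> index_of Y" for x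
    by (cases "x \<in> \<Omega>") (simp_all add: index_of_def split_beta)
  then show ?thesis by blast
qed

lemma index_of_rel_range_subset: "index_of (rr X [a]) \<subseteq> index_of (wr [a])"
  unfolding index_of_def using rel_range_mono[OF rel_range_subset_word_range[of X "[a]"]] by blast

lemma entry_range_projection:
  "entry (S a \<otimes>\<^bsub>alg\<^esub> P (rr X [a]) \<otimes>\<^bsub>alg\<^esub> cadjoint alg (S a)) u v
    = (if u = v \<and> u \<in> shift a ` index_of (rr X [a]) then 1 else 0)"
proof -
  let ?I = "index_of (rr X [a])"
  have "entry (S a \<otimes>\<^bsub>alg\<^esub> P (rr X [a]) \<otimes>\<^bsub>alg\<^esub> cadjoint alg (S a)) u v
      = (\<Sum>z\<in>\<Omega>. if z \<in> ?I \<and> u = shift a z \<and> v = shift a z then 1 else 0)"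
    unfolding entry_mult[of "S a \<otimes>\<^bsub>alg\<^esub> P (rr X [a])"] entry_mult_P entry_adjoint
    using index_of_rel_range_subset[of X a] by (intro sum.cong) (auto simp: entry_S)
  also have "\<dots> = (if u = v \<and> u \<in> shift a ` ?I then 1 else 0)"
  proof (cases "u = v \<and> u \<in> shift a ` ?I")
    case True
    then obtain x where x: "x \<in> ?I" "u = shift a x" "v = shift a x" by blast
    have "(\<Sum>z\<in>\<Omega>. if z \<in> ?I \<and> u = shift a z \<and> v = shift a z then 1 else 0)
        = (\<Sum>z\<in>\<Omega>. if z = x then 1 else (0 :: complex))"
      using x by (intro sum.cong) (auto simp: shift_eq_iff)
    then show ?thesis using True in_\<Omega>[OF x(1)] finite_\<Omega> by auto
  next
    case False
    then have "(\<Sum>z\<in>\<Omega>. if z \<in> ?I \<and> u = shift a z \<and> v = shift a z then 1 else (0 :: complex)) = 0"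
      by (intro sum.neutral) auto
    then show ?thesis using False by simp
  qed
  finally show ?thesis .
qed

text \<open>
  Entrywise this is \<open>index_of_decompose\<close>. The part with empty words is void, since a class is a nonempty set
  of sinks.
\<close>

lemma P_Cuntz_Krieger:
  assumes "X \<in> B" "X \<inter> sinks E = {}"
  shows "P X = (\<Oplus>\<^bsub>alg\<^esub>a\<in>out_labels E L X. S a \<otimes>\<^bsub>alg\<^esub> P (rr X [a]) \<otimes>\<^bsub>alg\<^esub> cadjoint alg (S a))"
    (is "_ = ?sum")
proof (rule alg_eqI)
  have closed: "(\<lambda>a. S a \<otimes>\<^bsub>alg\<^esub> P (rr X [a]) \<otimes>\<^bsub>alg\<^esub> cadjoint alg (S a)) \<in> out_labels E L X \<rightarrow> carrier alg"
    by (auto simp: alg_closed)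
  show "?sum \<in> carrier alg" by (rule alg.finsum_closed[OF closed])
  have no_class: "\<not> V \<subseteq> X" if "V \<in> \<V>" for V
    using sink_class_in_B(2,3)[OF that] assms(2) by blast
  then have index: "index_of X = (\<Union>a\<in>out_labels E L X. shift a ` index_of (rr X [a]))"
    using index_of_decompose[OF assms(1)] by auto
  fix u v
  have "entry ?sum u v
      = (\<Sum>a\<in>out_labels E L X. if u = v \<and> u \<in> shift a ` index_of (rr X [a]) then 1 else 0)"
    by (simp only: entry_finsum[OF finite_out_labels closed] entry_range_projection)
  also have "\<dots> = (if u = v \<and> u \<in> index_of X then 1 else 0)"
  proof (cases "u = v \<and> u \<in> index_of X")
    case True
    then obtain b where b: "b \<in> out_labels E L X" "u \<in> shift b ` index_of (rr X [b])"
      using index by blast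
    have "(\<Sum>a\<in>out_labels E L X. if u = v \<and> u \<in> shift a ` index_of (rr X [a]) then 1 else 0)
        = (\<Sum>a\<in>out_labels E L X. if a = b then 1 else (0 :: complex))"
      using True b by (intro sum.cong) (auto simp: shift_eq_iff)
    then show ?thesis using True b(1) finite_out_labels by auto
  next
    case False
    then have "(\<Sum>a\<in>out_labels E L X. if u = v \<and> u \<in> shift a ` index_of (rr X [a]) then 1 else (0 :: complex)) = 0"
      unfolding index by (intro sum.neutral) auto
    then show ?thesis using False by simp
  qed
  finally show "entry (P X) u v = entry ?sum u v" by (simp add: entry_P)
qed simp

text \<open>
  Prefixing a letter is injective, and words with different first letters are different.
\<close>

lemma S_adjoint_S:
  "cadjoint alg (S a) \<otimes>\<^bsub>alg\<^esub> S b = (if a = b then P (wr [a]) else \<zero>\<^bsub>alg\<^esub>)"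
proof (rule alg_eqI)
  fix u v
  show "entry (cadjoint alg (S a) \<otimes>\<^bsub>alg\<^esub> S b) u v = entry (if a = b then P (wr [a]) else \<zero>\<^bsub>alg\<^esub>) u v"
    by (auto simp: entry_S_adjoint_mult entry_S entry_P entry_zero shift_eq_iff)
qed (auto simp: alg_closed)

lemma S_mult_P: "S a \<otimes>\<^bsub>alg\<^esub> P (wr [a]) = S a"
  by (rule alg_eqI) (auto simp: alg_closed entry_mult_P entry_S)

lemma canonical_representation: "labeled_representation E L B alg P S"
  unfolding labeled_representation_def projection_def partial_isometry_def
proof (intro conjI ballI impI)
  fix X assume X: "X \<in> B"
  show "P X \<otimes>\<^bsub>alg\<^esub> P X = P X"
    by (rule alg_eqI) (auto simp: alg_closed entry_P_mult entry_P)
  show "cadjoint alg (P X) = P X"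
    by (rule alg_eqI) (auto simp: alg_closed entry_adjoint entry_P)
next
  fix X Y assume XY: "X \<in> B" "Y \<in> B"
  show "P X \<otimes>\<^bsub>alg\<^esub> P Y = P (X \<inter> Y)"
    by (rule alg_eqI) (auto simp: alg_closed entry_P_mult entry_P index_of_Int[OF XY])
  show "P (X \<union> Y) = P X \<oplus>\<^bsub>alg\<^esub> P Y \<ominus>\<^bsub>alg\<^esub> P (X \<inter> Y)"
    by (rule alg_eqI)
      (auto simp: alg_closed entry_add entry_minus entry_P index_of_Int[OF XY] index_of_Un[OF XY])
next
  fix a assume "a \<in> alphabet E L"
  have "S a \<otimes>\<^bsub>alg\<^esub> cadjoint alg (S a) \<otimes>\<^bsub>alg\<^esub> S a = S a \<otimes>\<^bsub>alg\<^esub> (cadjoint alg (S a) \<otimes>\<^bsub>alg\<^esub> S a)"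
    by (rule alg.mult_assoc) (auto simp: alg_closed)
  then show "S a \<otimes>\<^bsub>alg\<^esub> cadjoint alg (S a) \<otimes>\<^bsub>alg\<^esub> S a = S a"
    by (simp add: S_adjoint_S S_mult_P)
next
  fix a b
  show "cadjoint alg (S a) \<otimes>\<^bsub>alg\<^esub> S b = (if a = b then P (wr [a]) else \<zero>\<^bsub>alg\<^esub>)"
    by (rule S_adjoint_S)
next
  fix a X assume "a \<in> alphabet E L" "X \<in> B"
  show "cadjoint alg (S a) \<otimes>\<^bsub>alg\<^esub> P X = P (rr X [a]) \<otimes>\<^bsub>alg\<^esub> cadjoint alg (S a)"
  proof (rule alg_eqI)
    fix u v
    have "shift a u \<in> index_of X \<longleftrightarrow> u \<in> index_of (rr X [a])" if "u \<in> index_of (wr [a])"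
      using in_\<Omega>[OF that] by (intro shift_in_index_of) (auto simp: \<Omega>_def)
    then show "entry (cadjoint alg (S a) \<otimes>\<^bsub>alg\<^esub> P X) u v
        = entry (P (rr X [a]) \<otimes>\<^bsub>alg\<^esub> cadjoint alg (S a)) u v"
      by (auto simp: entry_mult_P entry_P_mult entry_adjoint entry_S)
  qed (auto simp: alg_closed)
next
  fix X assume "X \<in> B" "finite (out_labels E L X) \<and> X \<inter> sinks E = {}"
  then show "P X = (\<Oplus>\<^bsub>alg\<^esub>a\<in>out_labels E L X. S a \<otimes>\<^bsub>alg\<^esub> P (rr X [a]) \<otimes>\<^bsub>alg\<^esub> cadjoint alg (S a))"
    by (intro P_Cuntz_Krieger) auto
qed auto

interpretation canon: labeled_rep E L B alg P S
  by (intro labeled_rep.intro labeled_rep_axioms.intro acyclic_labeled_space_axioms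
      cstar_algebra_alg canonical_representation)

lemma P_sink_class:
  assumes "V \<in> \<V>"
  shows "P V = unit (V, []) (V, [])"
proof -
  have "index_of V = {(V, [])}"
  proof (rule equalityI; rule subsetI)
    fix x :: "'v set \<times> 'l list" assume x: "x \<in> index_of V"
    obtain W \<alpha> where W: "x = (W, \<alpha>)" by (cases x)
    have WV: "W \<in> \<V>" "W \<subseteq> rr V \<alpha>" using x W by (auto simp: index_of_def \<Omega>_def)
    have "\<alpha> = []"
      using WV sink_class_in_B(3)[OF WV(1)] rel_range_sinks[OF sink_class_in_B(2)[OF assms]]
      by (cases \<alpha>) auto
    moreover from this have "W \<subseteq> V"
      using WV rel_range_Nil[OF B_subset_verts[OF sink_class_in_B(1)[OF assms]]] by simp
    then have "W = V"
      using sink_class_eqI[OF WV(1) assms] sink_class_in_B(3)[OF WV(1)] by blast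
    ultimately show "x \<in> {(V, [])}" using W by simp
  next
    fix x :: "'v set \<times> 'l list" assume "x \<in> {(V, [])}"
    then show "x \<in> index_of V"
      using \<Omega>_Nil[OF assms] rel_range_Nil[OF B_subset_verts[OF sink_class_in_B(1)[OF assms]]]
      by (auto simp: index_of_def)
  qed
  then show ?thesis by (simp add: P_def)
qed

text \<open>
  A column of matrix units: multiplying by \<open>S a\<close> prefixes \<open>a\<close> to the row index, starting from the empty word.
\<close>

lemma canon_elt:
  assumes "x \<in> \<Omega>"
  shows "canon.elt x = unit x (fst x, [])"
proof -
  have "canon.path_elt V \<alpha> = unit (V, \<alpha>) (V, [])" if "(V, \<alpha>) \<in> \<Omega>" for V \<alpha>
    using that
  proof (induction \<alpha>)
    case Nil
    then show ?case using P_sink_class[OF \<Omega>_words(1)[OF Nil]] by simp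
  next
    case (Cons a \<alpha>)
    have tl: "(V, \<alpha>) \<in> \<Omega>" by (rule \<Omega>_tail[OF Cons.prems])
    have "(V, \<alpha>) \<in> index_of (wr [a])"
      using tl Cons.prems by (simp add: index_of_word_range shift_def)
    moreover have "((V, \<alpha>), (V, [])) \<in> same_class"
      using tl \<Omega>_Nil[OF \<Omega>_words(1)[OF tl]] by (simp add: same_class_def)
    ultimately have "S a \<otimes>\<^bsub>alg\<^esub> unit (V, \<alpha>) (V, []) = unit (shift a (V, \<alpha>)) (V, [])"
      by (rule S_mult_unit)
    then show ?case using Cons.IH[OF tl] by (simp add: shift_def)
  qed
  from this[of "fst x" "snd x"] assms show ?thesis by (simp add: canon.elt_def)
qed

text \<open>
  The canonical representation thus generates the whole matrix algebra, and its matrix units are nonzero.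
\<close>

lemma canon_e:
  assumes "(x, y) \<in> same_class"
  shows "canon.e x y = unit x y"
proof (rule alg_eqI)
  have xy: "x \<in> \<Omega>" "y \<in> \<Omega>" "fst y = fst x" using assms by (auto simp: same_class_def)
  let ?z = "(fst x, [])"
  have z: "(x, ?z) \<in> same_class" "(y, ?z) \<in> same_class" "?z \<in> \<Omega>"
    using xy \<Omega>_Nil[of "fst x"] \<Omega>_words(1)[of "fst x" "snd x"] by (auto simp: same_class_def)
  fix u v
  have "entry (canon.e x y) u v = (\<Sum>z\<in>\<Omega>. if z = ?z then (if u = x \<and> v = y then 1 else 0) else 0)"
    unfolding canon.e_def canon_elt[OF xy(1)] canon_elt[OF xy(2)] entry_mult entry_adjoint
    using z xy(3) by (intro sum.cong) (auto simp: entry_unit)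
  then show "entry (canon.e x y) u v = entry (unit x y) u v"
    using z(3) finite_\<Omega> assms by (simp add: entry_unit)
qed (use assms in \<open>auto simp: canon.e_def alg_closed\<close>)

lemma canon_unit_map:
  assumes "f \<in> carrier alg"
  shows "canon.unit_map f = f"
proof (rule alg_eqI)
  fix u v assume uv: "(u, v) \<in> same_class"
  have closed: "(\<lambda>y. entry f x y \<odot>\<^bsub>alg\<^esub> canon.e x y) \<in> \<Omega> \<rightarrow> carrier alg" for x
    by (auto simp: alg_closed canon.e_def)
  have "entry (canon.unit_map f) u v = (\<Sum>x\<in>\<Omega>. \<Sum>y\<in>\<Omega>. entry f x y * entry (canon.e x y) u v)"
    unfolding canon.unit_map_def
    by (subst entry_finsum[OF finite_\<Omega>])
      (use closed in \<open>auto intro!: alg.finsum_closed simp: entry_finsum[OF finite_\<Omega> closed] entry_smult\<close>)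
  also have "\<dots> = (\<Sum>x\<in>\<Omega>. \<Sum>y\<in>\<Omega>. if y = v then (if x = u then entry f u v else 0) else 0)"
  proof (intro sum.cong refl)
    fix x y
    show "entry f x y * entry (canon.e x y) u v = (if y = v then (if x = u then entry f u v else 0) else 0)"
    proof (cases "(x, y) \<in> same_class")
      case True
      then show ?thesis by (auto simp: canon_e entry_unit)
    next
      case False
      then have "entry f x y = 0" by (simp add: entry_def)
      then show ?thesis by auto
    qed
  qed
  also have "\<dots> = entry f u v"
    using R_in[OF uv] finite_\<Omega> by simp
  finally show "entry (canon.unit_map f) u v = entry f u v" .
qed (use assms canon.unit_map_closed in auto)

end

section \<open>Universality of the canonical representation\<close>

context labeled_rep
begin

text \<open>
  With \<open>unit_map_S\<close>: every representation factors through the canonical one.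
\<close>

lemma unit_map_P:
  assumes "X \<in> B"
  shows "unit_map (P X) = p X"
proof -
  have "unit_map (P X) = (\<Oplus>x\<in>index_of X. e x x)"
    using R_refl in_\<Omega> by (intro unit_map_sum_units P_def finite_index_of) blast
  then show ?thesis by (simp only: p_eq_sum_e[OF assms])
qed

lemma unit_map_S:
  assumes "a \<in> alphabet E L"
  shows "unit_map (S a) = s a"
proof -
  have "unit_map (S a) = (\<Oplus>x\<in>index_of (wr [a]). e (shift a x) x)"
    by (intro unit_map_sum_units S_def finite_index_of shift_same_class)
  then show ?thesis by (simp only: s_eq_sum_e[OF assms])
qed

lemma unit_map_in_subalgebra:
  assumes T: "cstar_subalgebra A T" and gen: "p ` B \<union> s ` alphabet E L \<subseteq> T"
  shows "unit_map f \<in> T"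
proof -
  have path: "path_elt V \<alpha> \<in> T" if "V \<in> \<V>" "set \<alpha> \<subseteq> alphabet E L" for V \<alpha>
    using that(2)
  proof (induction \<alpha>)
    case Nil
    then show ?case using gen sink_class_in_B(1)[OF that(1)] by auto
  next
    case (Cons a \<alpha>)
    then have "s a \<in> T" "path_elt V \<alpha> \<in> T" using gen by auto
    then show ?case using T unfolding cstar_subalgebra_def by simp
  qed
  have "elt x \<in> T" if "x \<in> \<Omega>" for x
    unfolding elt_def using \<Omega>_words[of "fst x" "snd x"] that by (intro path) auto
  then have "e x y \<in> T" if "x \<in> \<Omega>" "y \<in> \<Omega>" for x y
    using T that unfolding e_def cstar_subalgebra_def by simp
  then have "c \<odot> e x y \<in> T" if "x \<in> \<Omega>" "y \<in> \<Omega>" for c x y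
    using T that unfolding cstar_subalgebra_def by blast
  then show ?thesis
    unfolding unit_map_def
    by (intro cstar_subalgebra_finsum[OF cstar_algebra_axioms T] finite_\<Omega>)
qed

end

context acyclic_labeled_space
begin

interpretation canon: labeled_rep E L B alg P S
  by (intro labeled_rep.intro labeled_rep_axioms.intro acyclic_labeled_space_axioms
      cstar_algebra_alg canonical_representation)

lemma alg_generated: "cstar_generated alg (P ` B \<union> S ` alphabet E L) = carrier alg"
proof (rule equalityI)
  have "cstar_subalgebra alg (carrier alg)"
    unfolding cstar_subalgebra_def by (auto simp: alg_closed)
  then show "cstar_generated alg (P ` B \<union> S ` alphabet E L) \<subseteq> carrier alg"
    unfolding cstar_generated_def using P_closed S_closed by blast
  show "carrier alg \<subseteq> cstar_generated alg (P ` B \<union> S ` alphabet E L)"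
    unfolding cstar_generated_def
  proof (intro subsetI InterI)
    fix f T assume "f \<in> carrier alg"
      and "T \<in> {T. cstar_subalgebra alg T \<and> P ` B \<union> S ` alphabet E L \<subseteq> T}"
    then show "f \<in> T" using canon.unit_map_in_subalgebra[of T f] canon_unit_map[of f] by auto
  qed
qed

lemma canonical_universal:
  "is_labeled_graph_cstar E L B (alg :: ('v, 'l) test_type cstar) P S"
  unfolding is_labeled_graph_cstar_def
proof (intro conjI allI impI)
  fix D :: "('v, 'l) test_type cstar" and q t
  assume "cstar_algebra D \<and> labeled_representation E L B D q t"
  then interpret D: labeled_rep E L B D q t
    by (intro labeled_rep.intro labeled_rep_axioms.intro acyclic_labeled_space_axioms) auto
  show "\<exists>\<phi>. cstar_hom alg D \<phi> \<and> (\<forall>X\<in>B. \<phi> (P X) = q X) \<and> (\<forall>a\<in>alphabet E L. \<phi> (S a) = t a)"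
    using D.unit_map_hom D.unit_map_P D.unit_map_S by blast
qed (rule cstar_algebra_alg canonical_representation alg_generated)+

text \<open>
  Universality of \<open>C\<close> provides a homomorphism \<open>\<phi>\<close> back to the matrix algebra. It maps the matrix
  units of \<open>C\<close> to the genuine ones, so these are nonzero and \<open>\<phi>\<close> is a left inverse of
  \<open>C.unit_map\<close>. The range of \<open>C.unit_map\<close> is then a closed subalgebra that contains the generators, hence all of \<open>C\<close>.
\<close>

lemma universal_isomorphic:
  fixes C :: "'c cstar"
  assumes "is_labeled_graph_cstar E L B C p s"
  shows "alg \<cong>\<^sub>C C"
proof -
  interpret C: labeled_rep E L B C p s
    using assms unfolding is_labeled_graph_cstar_def
    by (intro labeled_rep.intro labeled_rep_axioms.intro acyclic_labeled_space_axioms) auto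
  obtain \<phi> where \<phi>: "cstar_hom C alg \<phi>" "\<And>X. X \<in> B \<Longrightarrow> \<phi> (p X) = P X"
    "\<And>a. a \<in> alphabet E L \<Longrightarrow> \<phi> (s a) = S a"
    using assms cstar_algebra_alg canonical_representation
    unfolding is_labeled_graph_cstar_def by blast
  have path: "\<phi> (C.path_elt V \<alpha>) = canon.path_elt V \<alpha>"
    if "V \<in> \<V>" "set \<alpha> \<subseteq> alphabet E L" for V \<alpha>
    using that(2)
  proof (induction \<alpha>)
    case Nil
    then show ?case using \<phi>(2) sink_class_in_B(1)[OF that(1)] by simp
  next
    case (Cons a \<alpha>)
    then show ?case
      using cstar_hom_mult[OF \<phi>(1), of "s a" "C.path_elt V \<alpha>"] C.s_closed[of a]
        C.path_elt_closed[OF that(1), of \<alpha>] \<phi>(3)[of a] by simp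
  qed
  have elt: "\<phi> (C.elt x) = canon.elt x" if "x \<in> \<Omega>" for x
    unfolding C.elt_def canon.elt_def using \<Omega>_words[of "fst x" "snd x"] that by (intro path) auto
  have e: "\<phi> (C.e x y) = canon.e x y" if "x \<in> \<Omega>" "y \<in> \<Omega>" for x y
    using that C.elt_closed
    by (simp add: C.e_def canon.e_def cstar_hom_mult[OF \<phi>(1)] cstar_hom_adjoint[OF \<phi>(1)]
        C.adjoint_closed elt)
  have left_inverse: "\<phi> (C.unit_map f) = f" if f: "f \<in> carrier alg" for f
  proof -
    have "\<phi> (C.unit_map f) = (\<Oplus>\<^bsub>alg\<^esub>x\<in>\<Omega>. \<phi> (\<Oplus>\<^bsub>C\<^esub>y\<in>\<Omega>. entry f x y \<odot>\<^bsub>C\<^esub> C.e x y))"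
      unfolding C.unit_map_def
      by (rule cstar_hom_finsum[OF C.cstar_algebra_axioms cstar_algebra_alg \<phi>(1) finite_\<Omega>])
        (auto intro!: C.row_closed)
    also have "\<dots> = canon.unit_map f"
      unfolding canon.unit_map_def
    proof (rule canon.M.finsum_cong'[OF refl])
      fix x assume x: "x \<in> \<Omega>"
      have "\<phi> (\<Oplus>\<^bsub>C\<^esub>y\<in>\<Omega>. entry f x y \<odot>\<^bsub>C\<^esub> C.e x y) = (\<Oplus>\<^bsub>alg\<^esub>y\<in>\<Omega>. \<phi> (entry f x y \<odot>\<^bsub>C\<^esub> C.e x y))"
        by (rule cstar_hom_finsum[OF C.cstar_algebra_axioms cstar_algebra_alg \<phi>(1) finite_\<Omega>])
          (use x in \<open>auto intro!: C.term_closed\<close>)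
      also have "\<dots> = (\<Oplus>\<^bsub>alg\<^esub>y\<in>\<Omega>. entry f x y \<odot>\<^bsub>alg\<^esub> canon.e x y)"
      proof (rule canon.M.finsum_cong'[OF refl])
        fix y assume "y \<in> \<Omega>"
        then show "\<phi> (entry f x y \<odot>\<^bsub>C\<^esub> C.e x y) = entry f x y \<odot>\<^bsub>alg\<^esub> canon.e x y"
          using x cstar_hom_smult[OF \<phi>(1) C.e_closed] e by simp
      qed (use x in \<open>auto intro!: canon.term_closed\<close>)
      finally show "\<phi> (\<Oplus>\<^bsub>C\<^esub>y\<in>\<Omega>. entry f x y \<odot>\<^bsub>C\<^esub> C.e x y)
          = (\<Oplus>\<^bsub>alg\<^esub>y\<in>\<Omega>. entry f x y \<odot>\<^bsub>alg\<^esub> canon.e x y)" .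
    qed (auto intro!: canon.row_closed)
    also have "\<dots> = f" by (rule canon_unit_map[OF f])
    finally show ?thesis .
  qed
  have nonzero: "C.e x y \<noteq> \<zero>\<^bsub>C\<^esub>" if xy: "(x, y) \<in> same_class" for x y
  proof
    assume "C.e x y = \<zero>\<^bsub>C\<^esub>"
    then have "canon.e x y = \<zero>\<^bsub>alg\<^esub>"
      using e[of x y] R_in[OF xy] cstar_hom_zero[OF C.cstar_algebra_axioms cstar_algebra_alg \<phi>(1)]
      by simp
    then have "entry (unit x y) x y = 0" by (simp add: canon_e[OF xy] entry_zero)
    then show False using xy by (simp add: entry_unit)
  qed
  let ?T = "C.unit_map ` carrier alg"
  have "p X \<in> ?T" if "X \<in> B" for X
    by (rule image_eqI[where x = "P X"]) (simp_all add: C.unit_map_P[OF that])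
  moreover have "s a \<in> ?T" if "a \<in> alphabet E L" for a
    by (rule image_eqI[where x = "S a"]) (simp_all add: C.unit_map_S[OF that])
  ultimately have "p ` B \<union> s ` alphabet E L \<subseteq> ?T" by blast
  then have "cstar_generated C (p ` B \<union> s ` alphabet E L) \<subseteq> ?T"
    unfolding cstar_generated_def using C.range_unit_map_subalgebra[OF nonzero] by blast
  then have "carrier C \<subseteq> ?T"
    using assms unfolding is_labeled_graph_cstar_def by simp
  then have "?T = carrier C" using C.unit_map_closed by blast
  moreover have "inj_on C.unit_map (carrier alg)"
    by (rule inj_on_inverseI[of _ \<phi>]) (rule left_inverse)
  ultimately have "bij_betw C.unit_map (carrier alg) (carrier C)" by (simp add: bij_betw_def)
  then show ?thesis unfolding cstar_isomorphic_def using C.unit_map_hom by blast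
qed

end

section \<open>Identification with a direct sum of matrix algebras\<close>

lemma matrix_cstar_simps:
  "carrier (matrix_cstar n) = carrier_mat n n"
  "x \<otimes>\<^bsub>matrix_cstar n\<^esub> y = x * y"
  "x \<oplus>\<^bsub>matrix_cstar n\<^esub> y = x + y"
  "c \<odot>\<^bsub>matrix_cstar n\<^esub> x = c \<cdot>\<^sub>m x"
  "cadjoint (matrix_cstar n) x = mat_adjoint x"
  by (simp_all add: matrix_cstar_def module.defs module_mat_def)

lemma direct_sum_cstar_simps:
  "carrier (direct_sum_cstar I A) = (\<Pi>\<^sub>E i\<in>I. carrier (A i))"
  "x \<otimes>\<^bsub>direct_sum_cstar I A\<^esub> y = (\<lambda>i\<in>I. x i \<otimes>\<^bsub>A i\<^esub> y i)"
  "x \<oplus>\<^bsub>direct_sum_cstar I A\<^esub> y = (\<lambda>i\<in>I. x i \<oplus>\<^bsub>A i\<^esub> y i)"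
  "c \<odot>\<^bsub>direct_sum_cstar I A\<^esub> x = (\<lambda>i\<in>I. c \<odot>\<^bsub>A i\<^esub> x i)"
  "cadjoint (direct_sum_cstar I A) x = (\<lambda>i\<in>I. cadjoint (A i) (x i))"
  by (simp_all add: direct_sum_cstar_def)

lemma mat_adjoint_index:
  fixes M :: "complex mat"
  shows "dim_row (mat_adjoint M) = dim_col M" "dim_col (mat_adjoint M) = dim_row M"
    "i < dim_col M \<Longrightarrow> j < dim_row M \<Longrightarrow> mat_adjoint M $$ (i, j) = cnj (M $$ (j, i))"
  by (simp_all add: mat_adjoint_def mat_of_rows_index)

context acyclic_labeled_space
begin

definition words_onto :: "'v set \<Rightarrow> 'l list set" where
  "words_onto V = {\<alpha>. (V, \<alpha>) \<in> \<Omega>}"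

lemma finite_words_onto: "finite (words_onto V)"
proof -
  have "words_onto V \<subseteq> snd ` \<Omega>" unfolding words_onto_def by force
  then show ?thesis using finite_\<Omega> finite_subset by blast
qed

text \<open>
  The empty word, which is not in \<open>labeled_words\<close>, accounts for the summand 1.
\<close>

lemma card_words_onto:
  assumes "V \<in> \<V>"
  shows "card (words_onto V) = num_words_onto E L V + 1"
proof -
  let ?N = "{\<alpha> \<in> labeled_words E L. V \<subseteq> wr \<alpha>}"
  have "words_onto V = insert [] ?N"
    using \<Omega>_Nil[OF assms] sink_class_in_B(3)[OF assms] assms
    by (auto simp: words_onto_def \<Omega>_def labeled_words_iff)
  moreover have "[] \<notin> ?N" by (simp add: labeled_words_iff)
  moreover have "finite ?N" using finite_words_onto[of V] calculation(1) by simp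
  ultimately show ?thesis by (simp add: num_words_onto_def)
qed

text \<open>
  Any enumeration will do: a different one conjugates each block by a permutation matrix.
\<close>

definition word_enum :: "'v set \<Rightarrow> nat \<Rightarrow> 'l list" where
  "word_enum V = (SOME h. bij_betw h {0..<card (words_onto V)} (words_onto V))"

lemma bij_word_enum: "bij_betw (word_enum V) {0..<card (words_onto V)} (words_onto V)"
  using ex_bij_betw_nat_finite[OF finite_words_onto[of V]] unfolding word_enum_def by (rule someI_ex)

definition to_blocks :: "(('v set + 'l) list \<Rightarrow> complex) \<Rightarrow> 'v set \<Rightarrow> complex mat" where
  "to_blocks f = (\<lambda>V\<in>\<V>. mat (card (words_onto V)) (card (words_onto V))
     (\<lambda>(i, j). entry f (V, word_enum V i) (V, word_enum V j)))"

lemma word_enum_in: "i < card (words_onto V) \<Longrightarrow> (V, word_enum V i) \<in> \<Omega>"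
  using bij_betwE[OF bij_word_enum[of V]] by (simp add: words_onto_def)

text \<open>
  Entries between different classes vanish, so the sum over all of \<open>\<Omega>\<close> is the sum over the block of \<open>V\<close>.
\<close>

lemma sum_block:
  assumes "V \<in> \<V>"
  shows "(\<Sum>z\<in>\<Omega>. entry f (V, \<alpha>) z * entry g z (V, \<beta>))
    = (\<Sum>k=0..<card (words_onto V). entry f (V, \<alpha>) (V, word_enum V k) * entry g (V, word_enum V k) (V, \<beta>))"
proof -
  have "(\<Sum>z\<in>\<Omega>. entry f (V, \<alpha>) z * entry g z (V, \<beta>))
      = (\<Sum>z\<in>Pair V ` words_onto V. entry f (V, \<alpha>) z * entry g z (V, \<beta>))"
  proof (rule sum.mono_neutral_right[OF finite_\<Omega>])
    show "\<forall>z\<in>\<Omega> - Pair V ` words_onto V. entry f (V, \<alpha>) z * entry g z (V, \<beta>) = 0"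
    proof
      fix z assume "z \<in> \<Omega> - Pair V ` words_onto V"
      then have "fst z \<noteq> V" by (cases z) (auto simp: words_onto_def)
      then have "((V, \<alpha>), z) \<notin> same_class" by (auto simp: same_class_def)
      then show "entry f (V, \<alpha>) z * entry g z (V, \<beta>) = 0" by (simp add: entry_def)
    qed
  qed (auto simp: words_onto_def)
  also have "\<dots> = (\<Sum>\<gamma>\<in>words_onto V. entry f (V, \<alpha>) (V, \<gamma>) * entry g (V, \<gamma>) (V, \<beta>))"
    by (subst sum.reindex) (auto simp: inj_on_def)
  also have "\<dots> = (\<Sum>k=0..<card (words_onto V).
      entry f (V, \<alpha>) (V, word_enum V k) * entry g (V, word_enum V k) (V, \<beta>))"
    by (rule sum.reindex_bij_betw[OF bij_word_enum, symmetric])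
  finally show ?thesis .
qed

abbreviation "M \<equiv> direct_sum_cstar \<V> (\<lambda>V. matrix_cstar (num_words_onto E L V + 1))"

lemma to_blocks_hom: "cstar_hom alg M to_blocks"
  unfolding cstar_hom_def
proof (intro conjI ballI allI)
  show "to_blocks \<in> carrier alg \<rightarrow> carrier M"
    by (auto simp: direct_sum_cstar_simps matrix_cstar_simps to_blocks_def card_words_onto)
  fix f
  show "to_blocks (c \<odot>\<^bsub>alg\<^esub> f) = c \<odot>\<^bsub>M\<^esub> to_blocks f" for c
    unfolding direct_sum_cstar_simps matrix_cstar_simps to_blocks_def
    by (intro restrict_ext eq_matI) (auto simp: entry_smult)
  show "to_blocks (cadjoint alg f) = cadjoint M (to_blocks f)"
    unfolding direct_sum_cstar_simps matrix_cstar_simps to_blocks_def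
    by (intro restrict_ext eq_matI) (auto simp: entry_adjoint mat_adjoint_index)
  fix g
  show "to_blocks (f \<oplus>\<^bsub>alg\<^esub> g) = to_blocks f \<oplus>\<^bsub>M\<^esub> to_blocks g"
    unfolding direct_sum_cstar_simps matrix_cstar_simps to_blocks_def
    by (intro restrict_ext eq_matI) (auto simp: entry_add)
  show "to_blocks (f \<otimes>\<^bsub>alg\<^esub> g) = to_blocks f \<otimes>\<^bsub>M\<^esub> to_blocks g"
    unfolding direct_sum_cstar_simps matrix_cstar_simps to_blocks_def
    by (intro restrict_ext eq_matI) (auto simp: entry_mult sum_block scalar_prod_def)
qed

lemma to_blocks_bij: "bij_betw to_blocks (carrier alg) (carrier M)"
proof (rule bij_betw_imageI)
  have enum: "\<exists>i<card (words_onto (fst x)). x = (fst x, word_enum (fst x) i)" if "x \<in> \<Omega>" for x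
  proof -
    have "snd x \<in> word_enum (fst x) ` {0..<card (words_onto (fst x))}"
      using that bij_word_enum[of "fst x"] by (simp add: bij_betw_def words_onto_def)
    then show ?thesis by (auto simp: prod_eq_iff)
  qed
  show "inj_on to_blocks (carrier alg)"
  proof (rule inj_onI)
    fix f g assume fg: "f \<in> carrier alg" "g \<in> carrier alg" and eq: "to_blocks f = to_blocks g"
    show "f = g"
    proof (rule alg_eqI[OF fg])
      fix x y assume xy: "(x, y) \<in> same_class"
      define V where "V = fst x"
      have "(V, snd x) \<in> \<Omega>" using R_in[OF xy] by (simp add: V_def)
      then have V: "V \<in> \<V>" by (rule \<Omega>_words(1))
      have y: "fst y = V" using xy by (simp add: same_class_def V_def)
      obtain i j where ij: "i < card (words_onto V)" "j < card (words_onto V)"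
        "x = (V, word_enum V i)" "y = (V, word_enum V j)"
        using enum[of x] enum[of y] R_in[OF xy] y unfolding V_def by metis
      have "to_blocks f V $$ (i, j) = to_blocks g V $$ (i, j)" by (simp add: eq)
      then show "entry f x y = entry g x y" using V ij by (simp add: to_blocks_def)
    qed
  qed
  show "to_blocks ` carrier alg = carrier M"
  proof (rule equalityI)
    show "to_blocks ` carrier alg \<subseteq> carrier M" using to_blocks_hom unfolding cstar_hom_def by blast
    show "carrier M \<subseteq> to_blocks ` carrier alg"
    proof
      fix m assume m: "m \<in> carrier M"
      define pos where "pos V = inv_into {0..<card (words_onto V)} (word_enum V)" for V
      have pos: "pos V (word_enum V i) = i" if "i < card (words_onto V)" for V i
        unfolding pos_def using that bij_word_enum[of V] by (simp add: bij_betw_def inv_into_f_f)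
      define f where "f = from_entries (\<lambda>x y. m (fst x) $$ (pos (fst x) (snd x), pos (fst y) (snd y)))"
      have "to_blocks f = m"
      proof (rule extensionalityI[of _ \<V>])
        show "m \<in> extensional \<V>" using m by (auto simp: direct_sum_cstar_simps PiE_def)
        show "to_blocks f \<in> extensional \<V>" by (simp add: to_blocks_def)
        fix V assume V: "V \<in> \<V>"
        have "m V \<in> carrier_mat (card (words_onto V)) (card (words_onto V))"
          using m V by (auto simp: direct_sum_cstar_simps matrix_cstar_simps card_words_onto)
        moreover have "((V, word_enum V i), (V, word_enum V j)) \<in> same_class"
          if "i < card (words_onto V)" "j < card (words_onto V)" for i j
          using that by (simp add: same_class_def word_enum_in)
        ultimately show "to_blocks f V = m V"
          using V by (intro eq_matI) (auto simp: to_blocks_def f_def entry_from_entries pos)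
      qed
      moreover have "f \<in> carrier alg" by (simp add: f_def)
      ultimately show "m \<in> to_blocks ` carrier alg" by blast
    qed
  qed
qed

lemma alg_isomorphic: "alg \<cong>\<^sub>C M"
  unfolding cstar_isomorphic_def using to_blocks_hom to_blocks_bij by blast

end

theorem proposition4p5:
  fixes E :: "('v, 'e) pre_digraph" and L :: "'e \<Rightarrow> 'l" and B :: "'v set set"
  assumes "fin_digraph E"
    and "\<not> (\<exists>u p. p \<noteq> [] \<and> pre_digraph.awalk E u p u)"
    and "normal_labeled_space E L B"
    and "weakly_left_resolving E L B"
    and "sinks E \<in> B"
  shows "(\<exists>(C :: ('v, 'l) test_type cstar) p s. is_labeled_graph_cstar E L B C p s) \<and>
    (\<forall>(C :: 'c cstar) p s. is_labeled_graph_cstar E L B C p s \<longrightarrow>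
       C \<cong>\<^sub>C direct_sum_cstar (sink_classes E B) (\<lambda>V. matrix_cstar (num_words_onto E L V + 1)))"
proof (intro conjI allI impI)
  interpret acyclic_labeled_space E L B
    using assms by (rule acyclic_labeled_space.intro)
  show "\<exists>(C :: ('v, 'l) test_type cstar) p s. is_labeled_graph_cstar E L B C p s"
    using canonical_universal by blast
  fix C :: "'c cstar" and p s
  assume "is_labeled_graph_cstar E L B C p s"
  then have "C \<cong>\<^sub>C alg"
    by (rule cstar_isomorphic_sym[OF cstar_algebra_alg universal_isomorphic])
  then show "C \<cong>\<^sub>C direct_sum_cstar (sink_classes E B) (\<lambda>V. matrix_cstar (num_words_onto E L V + 1))"
    using alg_isomorphic by (rule cstar_isomorphic_trans)
qed

end
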